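(* For arbitrary finite subgroups $G_1,G_2\subset\mathrm{SO}(3)$, the misorientation space $X(G_1,G_2)$ is a closed orientable topological $3$-manifold.
   Context: For finite subgroups $G_1,G_2\subset \mathrm{SO}(3)$, the misorientation space is the topological orbit space $X(G_1,G_2)=\mathrm{SO}(3)/(G_1\times G_2)=G_1\backslash \mathrm{SO}(3)/G_2$, where $(g_1,g_2)\cdot A=g_1Ag_2^{-1}$. *)

theory Defs
  imports "HOL-Analysis.Analysis" "HOL-Algebra.Group_Action" "HOL-Homology.Homology"
begin

section \<open>Orbit spaces\<close>

definition quotient_topology :: "'a topology \<Rightarrow> ('a \<Rightarrow> 'b) \<Rightarrow> 'b topology"
  where "quotient_topology X f =
    topology (\<lambda>U. U \<subseteq> f ` topspace X \<and> openin X {x \<in> topspace X. f x \<in> U})"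

lemma istopology_quotient_topology:
  "istopology (\<lambda>U. U \<subseteq> f ` topspace X \<and> openin X {x \<in> topspace X. f x \<in> U})"
proof -
  have Int: "{x \<in> topspace X. f x \<in> S \<inter> T}
      = {x \<in> topspace X. f x \<in> S} \<inter> {x \<in> topspace X. f x \<in> T}" for S T
    by auto
  have Un: "{x \<in> topspace X. f x \<in> \<Union>\<K>} = (\<Union>K\<in>\<K>. {x \<in> topspace X. f x \<in> K})" for \<K>
    by auto
  show ?thesis
    unfolding istopology_def Int Un by (auto intro!: openin_Union)
qed

lemma openin_quotient_topology:
  "openin (quotient_topology X f) U \<longleftrightarrow>
    U \<subseteq> f ` topspace X \<and> openin X {x \<in> topspace X. f x \<in> U}"
  unfolding quotient_topology_def topology_inverse'[OF istopology_quotient_topology] ..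

lemma topspace_quotient_topology [simp]:
  "topspace (quotient_topology X f) = f ` topspace X"
proof
  show "topspace (quotient_topology X f) \<subseteq> f ` topspace X"
    using openin_topspace[of "quotient_topology X f"] by (simp only: openin_quotient_topology)
  have "{x \<in> topspace X. f x \<in> f ` topspace X} = topspace X"
    by auto
  then have "openin (quotient_topology X f) (f ` topspace X)"
    by (simp add: openin_quotient_topology)
  then show "f ` topspace X \<subseteq> topspace (quotient_topology X f)"
    by (rule openin_subset)
qed

lemma quotient_map_quotient_topology: "quotient_map X (quotient_topology X f) f"
  by (auto simp: quotient_map_def openin_quotient_topology)

definition orbit_space ::
    "('g, 'm) monoid_scheme \<Rightarrow> ('g \<Rightarrow> 'a \<Rightarrow> 'a) \<Rightarrow> 'a topology \<Rightarrow> 'a set topology"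
  where "orbit_space G \<phi> X = quotient_topology X (orbit G \<phi>)"

lemma topspace_orbit_space: "topspace (orbit_space G \<phi> X) = orbits G (topspace X) \<phi>"
  by (auto simp: orbit_space_def orbits_def)


section \<open>The misorientation space\<close>

definition SO3 :: "(real^3^3) monoid"
  where "SO3 = \<lparr>carrier = {A. rotation_matrix A}, mult = (**), one = mat 1\<rparr>"

definition SO3_topology :: "(real^3^3) topology"
  where "SO3_topology = top_of_set (carrier SO3)"

text \<open>The maps are restricted to the carrier because the library's group actions take values in
  the group of \<^emph>\<open>extensional\<close> bijections.\<close>

definition misorientation_action :: "(real^3^3) \<times> (real^3^3) \<Rightarrow> (real^3^3) \<Rightarrow> (real^3^3)"
  where "misorientation_action =
    (\<lambda>(g\<^sub>1, g\<^sub>2). \<lambda>A\<in>carrier SO3. g\<^sub>1 \<otimes>\<^bsub>SO3\<^esub> A \<otimes>\<^bsub>SO3\<^esub> inv\<^bsub>SO3\<^esub> g\<^sub>2)"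

definition misorientation_space :: "(real^3^3) set \<Rightarrow> (real^3^3) set \<Rightarrow> (real^3^3) set topology"
  where "misorientation_space G\<^sub>1 G\<^sub>2 =
    orbit_space (SO3\<lparr>carrier := G\<^sub>1\<rparr> \<times>\<times> SO3\<lparr>carrier := G\<^sub>2\<rparr>) misorientation_action SO3_topology"

lemma group_SO3: "group SO3"
proof (rule groupI)
  fix A assume A: "A \<in> carrier SO3"
  then have "transpose A \<in> carrier SO3" "transpose A \<otimes>\<^bsub>SO3\<^esub> A = \<one>\<^bsub>SO3\<^esub>"
    by (auto simp: SO3_def rotation_matrix_def orthogonal_matrix_def)
  then show "\<exists>B\<in>carrier SO3. B \<otimes>\<^bsub>SO3\<^esub> A = \<one>\<^bsub>SO3\<^esub>"
    by blast
qed (auto simp: SO3_def rotation_matrix_def orthogonal_matrix_mul orthogonal_matrix_id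
       det_mul matrix_mul_assoc)

lemma group_action_misorientation:
  assumes "subgroup G\<^sub>1 SO3" "subgroup G\<^sub>2 SO3"
  shows "group_action (SO3\<lparr>carrier := G\<^sub>1\<rparr> \<times>\<times> SO3\<lparr>carrier := G\<^sub>2\<rparr>) (carrier SO3)
           misorientation_action"
proof -
  interpret SO3: group SO3 by (rule group_SO3)
  let ?P = "SO3\<lparr>carrier := G\<^sub>1\<rparr> \<times>\<times> SO3\<lparr>carrier := G\<^sub>2\<rparr>"
  have sub: "G\<^sub>1 \<subseteq> carrier SO3" "G\<^sub>2 \<subseteq> carrier SO3"
    using assms by (auto dest: subgroup.subset)
  have cancel: "inv\<^bsub>SO3\<^esub> a \<otimes>\<^bsub>SO3\<^esub> (a \<otimes>\<^bsub>SO3\<^esub> b) = b" "a \<otimes>\<^bsub>SO3\<^esub> (inv\<^bsub>SO3\<^esub> a \<otimes>\<^bsub>SO3\<^esub> b) = b"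
    if "a \<in> carrier SO3" "b \<in> carrier SO3" for a b
    using that by (simp_all flip: SO3.m_assoc)
  have bij: "misorientation_action (g, h) \<in> Bij (carrier SO3)"
    if "g \<in> carrier SO3" "h \<in> carrier SO3" for g h
  proof -
    have "inv\<^bsub>SO3\<^esub> g \<otimes>\<^bsub>SO3\<^esub> (g \<otimes>\<^bsub>SO3\<^esub> A \<otimes>\<^bsub>SO3\<^esub> inv\<^bsub>SO3\<^esub> h) \<otimes>\<^bsub>SO3\<^esub> h = A"
      and "g \<otimes>\<^bsub>SO3\<^esub> (inv\<^bsub>SO3\<^esub> g \<otimes>\<^bsub>SO3\<^esub> A \<otimes>\<^bsub>SO3\<^esub> h) \<otimes>\<^bsub>SO3\<^esub> inv\<^bsub>SO3\<^esub> h = A"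
      if "A \<in> carrier SO3" for A
      using that \<open>g \<in> carrier SO3\<close> \<open>h \<in> carrier SO3\<close>
      by (simp_all add: SO3.m_assoc cancel)
    then have "bij_betw (\<lambda>A. g \<otimes>\<^bsub>SO3\<^esub> A \<otimes>\<^bsub>SO3\<^esub> inv\<^bsub>SO3\<^esub> h) (carrier SO3) (carrier SO3)"
      using that
      by (intro bij_betw_byWitness[where f' = "\<lambda>A. inv\<^bsub>SO3\<^esub> g \<otimes>\<^bsub>SO3\<^esub> A \<otimes>\<^bsub>SO3\<^esub> h"]) auto
    then show ?thesis
      by (simp add: Bij_def misorientation_action_def cong: bij_betw_cong)
  qed
  have "misorientation_action \<in> hom ?P (BijGroup (carrier SO3))"
  proof (rule homI)
    fix x assume "x \<in> carrier ?P"
    then show "misorientation_action x \<in> carrier (BijGroup (carrier SO3))"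
      using bij sub by (auto simp: BijGroup_def)
  next
    fix x y assume "x \<in> carrier ?P" "y \<in> carrier ?P"
    then obtain g h g' h' where xy: "x = (g, h)" "y = (g', h')"
      and mem: "g \<in> carrier SO3" "h \<in> carrier SO3" "g' \<in> carrier SO3" "h' \<in> carrier SO3"
      using sub by (auto simp: subset_iff)
    then have *: "g \<otimes>\<^bsub>SO3\<^esub> g' \<otimes>\<^bsub>SO3\<^esub> A \<otimes>\<^bsub>SO3\<^esub> inv\<^bsub>SO3\<^esub> (h \<otimes>\<^bsub>SO3\<^esub> h')
        = g \<otimes>\<^bsub>SO3\<^esub> (g' \<otimes>\<^bsub>SO3\<^esub> A \<otimes>\<^bsub>SO3\<^esub> inv\<^bsub>SO3\<^esub> h') \<otimes>\<^bsub>SO3\<^esub> inv\<^bsub>SO3\<^esub> h"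
      if "A \<in> carrier SO3" for A
      using that by (simp add: SO3.m_assoc SO3.inv_mult_group)
    have "misorientation_action (x \<otimes>\<^bsub>?P\<^esub> y)
        = compose (carrier SO3) (misorientation_action x) (misorientation_action y)"
      using mem * by (intro ext) (simp add: xy compose_def misorientation_action_def)
    then show "misorientation_action (x \<otimes>\<^bsub>?P\<^esub> y)
        = misorientation_action x \<otimes>\<^bsub>BijGroup (carrier SO3)\<^esub> misorientation_action y"
      using bij mem by (simp add: xy BijGroup_def)
  qed
  then show ?thesis
    using assms
    by (simp add: group_action_def group_hom_def group_hom_axioms_def group_BijGroup
          DirProd_group SO3.subgroup_imp_group)
qed


section \<open>Topological manifolds and orientability\<close>

definition topological_manifold :: "nat \<Rightarrow> 'a topology \<Rightarrow> bool"
  where "topological_manifold n M \<longleftrightarrow>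
    Hausdorff_space M \<and> second_countable M \<and>
    (\<forall>x\<in>topspace M. \<exists>U V. openin M U \<and> x \<in> U \<and> openin (Euclidean_space n) V \<and>
        subtopology M U homeomorphic_space subtopology (Euclidean_space n) V)"

text \<open>There is no boundary, since every point has a neighbourhood homeomorphic to an open subset
  of the whole Euclidean space.\<close>

definition closed_manifold :: "nat \<Rightarrow> 'a topology \<Rightarrow> bool"
  where "closed_manifold n M \<longleftrightarrow> topological_manifold n M \<and> compact_space M"

definition homology_at :: "nat \<Rightarrow> 'a topology \<Rightarrow> 'a set \<Rightarrow> 'a chain set monoid"
  where "homology_at n M A = relative_homology_group (int n) M (topspace M - A)"

definition homology_restrict ::
    "nat \<Rightarrow> 'a topology \<Rightarrow> 'a set \<Rightarrow> 'a set \<Rightarrow> 'a chain set \<Rightarrow> 'a chain set"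
  where "homology_restrict n M A B =
    hom_induced (int n) M (topspace M - A) M (topspace M - B) id"

text \<open>A generator of \<open>H\<^sub>n(M, M - {x}; \<int>)\<close>, which is infinite cyclic
  when \<open>M\<close> is an \<open>n\<close>-manifold.\<close>

definition local_orientation :: "nat \<Rightarrow> 'a topology \<Rightarrow> 'a \<Rightarrow> 'a chain set \<Rightarrow> bool"
  where "local_orientation n M x c \<longleftrightarrow>
    c \<in> carrier (homology_at n M {x}) \<and>
    subgroup_generated (homology_at n M {x}) {c} = homology_at n M {x}"

text \<open>An orientation is a choice of local orientations that is locally consistent: near each point
  they are all restrictions of a single class in \<open>H\<^sub>n(M, M - U; \<int>)\<close>.\<close>

definition orientation :: "nat \<Rightarrow> 'a topology \<Rightarrow> ('a \<Rightarrow> 'a chain set) \<Rightarrow> bool"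
  where "orientation n M \<mu> \<longleftrightarrow>
    (\<forall>x\<in>topspace M. local_orientation n M x (\<mu> x)) \<and>
    (\<forall>x\<in>topspace M. \<exists>U c. openin M U \<and> x \<in> U \<and> c \<in> carrier (homology_at n M U) \<and>
        (\<forall>y\<in>U. homology_restrict n M U {y} c = \<mu> y))"

definition orientable :: "nat \<Rightarrow> 'a topology \<Rightarrow> bool"
  where "orientable n M \<longleftrightarrow> (\<exists>\<mu>. orientation n M \<mu>)"

end

theory Submission
  imports Defs "HOL-Computational_Algebra.Fundamental_Theorem_Algebra"
begin

text \<open>Let \<open>q\<close> be the projection of \<open>SO(3)\<close> onto the orbit space \<open>X\<close>. It is continuous, open and
  closed with finite fibres, so \<open>X\<close> is a second countable compact Hausdorff space. The substance
  lies in the orbits with nontrivial stabilisers, near which \<open>q\<close> is not a covering: there a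
  neighbourhood in \<open>X\<close> has to be recognised as Euclidean, and an orientation has to be extended
  across it.

  \<^emph>\<open>Local models.\<close> The Cayley map \<open>c\<close> parametrises the rotations of trace different from \<open>-1\<close> by
  all of space and satisfies \<open>c (h x) = h (c x) h\<^sup>T\<close> for every rotation \<open>h\<close>. Points near \<open>A\<close>
  have the form \<open>c x A\<close>, and for small \<open>x\<close> and \<open>y\<close> the points \<open>c x A\<close> and \<open>c y A\<close> lie in one
  orbit exactly if \<open>y = h x\<close> for some \<open>h\<close> in the finite rotation group \<open>H = G\<^sub>1 \<inter> A G\<^sub>2 A\<^sup>T\<close>
  (lemmas \<open>\<Phi>_eq_imp\<close> and \<open>\<Phi>_stab\<close>). So \<open>X\<close> looks locally like the quotient of space by \<open>H\<close>.

  \<^emph>\<open>That quotient is space again.\<close> The sphere is the Riemann sphere, \<open>H\<close> acts on it by Moebius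
  transformations, and the quotient of the Riemann sphere by a finite group is a Riemann sphere.
  To obtain the quotient map explicitly, without classifying \<open>H\<close>, lift \<open>H\<close> to \<open>SU(2)\<close> and use
  the Hopf map from \<open>\<complex>\<^sup>2\<close> onto space. The product \<open>R(v, v')\<close> of the determinants of \<open>h v\<close> and
  \<open>v'\<close> over \<open>h \<in> H\<close> is a form of degree \<open>|H|\<close> in each variable, and it vanishes exactly if \<open>v'\<close>
  is proportional to a point in the orbit of \<open>v\<close>. Comparing roots gives
  \<open>|R(v,a) R(v',b) - R(v,b) R(v',a)| = |R(a,b)| |R(v,v')|\<close> (lemma \<open>plucker_relation\<close>), so the
  ratio of \<open>R(v,a)\<close> and \<open>R(v,b)\<close> separates the orbits; by the fundamental theorem of algebra it
  takes all values. The cone over this map of spheres is the quotient map of theorem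
  \<open>rotation_quotient_map\<close>.

  \<^emph>\<open>Orientation.\<close> The regular orbits, those with trivial stabilisers, form a dense set, and in a
  chart ball only the images of finitely many lines are missing from it. Lines do not disconnect
  a ball in space, so a locally consistent orientation on the regular orbits extends over all of
  \<open>X\<close> (theorem \<open>orientable_of_dense_orientation\<close>). At a regular orbit \<open>q A\<close> the orientation is
  the image of one fixed generator of \<open>H\<^sub>3(\<real>\<^sup>3, \<real>\<^sup>3 - 0)\<close> under \<open>x \<mapsto> q (c x A)\<close>. Replacing \<open>A\<close>
  by another point of the orbit composes this map with a rotation, which is homotopic to the
  identity through rotations; moving to a nearby orbit is absorbed by a homotopy that uses the
  group multiplication.\<close>

section \<open>Local homology of manifolds\<close>

lemma iso_square:
  assumes comm: "\<And>x. x \<in> carrier G \<Longrightarrow> k (f x) = g (h x)"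
    and h: "h \<in> iso G G'" and g: "g \<in> iso G' H'" and k: "k \<in> iso H H'"
    and f: "f \<in> hom G H"
  shows "f \<in> iso G H"
proof -
  have "bij_betw (g \<circ> h) (carrier G) (carrier H')"
    using h g by (auto simp: iso_def intro: bij_betw_trans)
  then have "bij_betw (k \<circ> f) (carrier G) (carrier H')"
    by (rule bij_betw_cong[THEN iffD1, rotated]) (simp add: comm)
  moreover have "bij_betw k (carrier H) (carrier H')" "f ` carrier G \<subseteq> carrier H"
    using k f by (auto simp: iso_def hom_def)
  ultimately have "bij_betw f (carrier G) (carrier H)"
    using bij_betw_comp_iff2 by (metis)
  then show ?thesis
    using f by (simp add: iso_def)
qed

lemma iso_preserves_generator:
  fixes G :: "'a monoid" and H :: "'b monoid"
  assumes "group G" "group H" and f: "f \<in> iso G H"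
    and c: "c \<in> carrier G" and gen: "subgroup_generated G {c} = G"
  shows "f c \<in> carrier H" "subgroup_generated H {f c} = H"
proof -
  interpret G: group G by fact
  interpret H: group H by fact
  interpret group_hom G H f
    using f by (auto simp: group_hom_def group_hom_axioms_def iso_def assms)
  show "f c \<in> carrier H"
    using c by simp
  have "carrier (subgroup_generated H (f ` {c})) = f ` carrier (subgroup_generated G {c})"
    by (rule subgroup_generated_by_image) (use c in simp)
  also have "\<dots> = carrier H"
    using f by (simp add: gen iso_def bij_betw_def)
  finally show "subgroup_generated H {f c} = H"
    by (intro monoid.equality) auto
qed

text \<open>The homotopy inverse moves every point away from \<open>y\<close> by a fixed distance, chosen such that
  \<open>A\<close> lies within this distance of \<open>y\<close>. Along the way no point of the complement of \<open>A\<close> enters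
  \<open>A\<close>, because \<open>A\<close> is convex and contains \<open>y\<close>.\<close>

lemma inclusion_complement_convex_iso:
  fixes A :: "'a::euclidean_space set"
  assumes A: "bounded A" "convex A" "y \<in> A"
  shows "hom_induced p (top_of_set (UNIV - A)) {} (top_of_set (UNIV - {y})) {} id
    \<in> iso (reduced_homology_group p (top_of_set (UNIV - A)))
          (reduced_homology_group p (top_of_set (UNIV - {y})))"
proof -
  obtain R where R: "R > 0" "A \<subseteq> cball y R"
    using A(1) bounded_subset_ballD[of A y] ball_subset_cball by (metis order_trans)
  define H where "H t z = y + (1 + t * R / norm (z - y)) *\<^sub>R (z - y)" for t z
  have factor: "1 + t * R / norm (z - y) \<ge> 1" if "t \<in> {0..1}" for t z
    using that R by simp
  have outside: "y + s *\<^sub>R (z - y) \<notin> A" if "z \<notin> A" "s \<ge> 1" for s z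
  proof
    assume "y + s *\<^sub>R (z - y) \<in> A"
    then have "(1 - 1/s) *\<^sub>R y + (1/s) *\<^sub>R (y + s *\<^sub>R (z - y)) \<in> A"
      using A that by (intro convexD) auto
    moreover have "(1 - 1/s) *\<^sub>R y + (1/s) *\<^sub>R (y + s *\<^sub>R (z - y)) = z"
      using that by (simp add: algebra_simps)
    ultimately show False
      using that by simp
  qed
  have far: "H 1 z \<notin> A" if "z \<noteq> y" for z
  proof -
    have "H 1 z - y = (1 + R / norm (z - y)) *\<^sub>R (z - y)"
      by (simp add: H_def)
    then have "norm (H 1 z - y) = \<bar>1 + R / norm (z - y)\<bar> * norm (z - y)"
      by simp
    also have "\<dots> = norm (z - y) + R"
      using that R by (simp add: field_simps add_pos_pos)
    finally have "norm (H 1 z - y) > R"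
      using that by simp
    then have "H 1 z \<notin> cball y R"
      by (simp add: dist_norm norm_minus_commute)
    then show ?thesis
      using R(2) by blast
  qed
  have contH: "continuous_on ({0..1} \<times> (UNIV - {y})) (\<lambda>(t, z). H t z)"
    unfolding H_def split_beta by (intro continuous_intros) auto
  have cont1: "continuous_on (UNIV - {y}) (H 1)"
    unfolding H_def by (intro continuous_intros) auto
  have sub: "UNIV - A \<subseteq> UNIV - {y}"
    using A(3) by blast
  have H0: "H 0 = id"
    by (auto simp: H_def)
  have hom: "homotopic_with (\<lambda>h. True) (top_of_set S) (top_of_set S) (H 0) (H 1)"
    if "S \<subseteq> UNIV - {y}" and S: "\<And>t z. t \<in> {0..1} \<Longrightarrow> z \<in> S \<Longrightarrow> H t z \<in> S" for S
    unfolding homotopic_with_def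
  proof (intro exI[of _ "\<lambda>(t, z). H t z"] conjI allI ballI)
    have "continuous_on ({0..1} \<times> S) (\<lambda>(t, z). H t z)"
      by (rule continuous_on_subset[OF contH]) (use that(1) in auto)
    then show "continuous_map (prod_topology (top_of_set {0..1}) (top_of_set S)) (top_of_set S) (\<lambda>(t, z). H t z)"
      using S by (simp add: continuous_map_in_subtopology prod_topology_subtopology_eu Pi_iff split_beta)
  qed auto
  have hom1: "homotopic_with (\<lambda>h. True) (top_of_set (UNIV - {y})) (top_of_set (UNIV - {y})) (H 0) (H 1)"
  proof (rule hom)
    fix t :: real and z assume "t \<in> {0..1}" "z \<in> UNIV - {y}"
    moreover from this(1) have "1 + t * R / norm (z - y) \<noteq> 0"
      using factor[of t z] by linarith
    ultimately show "H t z \<in> UNIV - {y}"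
      unfolding H_def by simp
  qed simp
  have hom2: "homotopic_with (\<lambda>h. True) (top_of_set (UNIV - A)) (top_of_set (UNIV - A)) (H 0) (H 1)"
    by (rule hom[OF sub]) (use outside factor in \<open>simp add: H_def\<close>)
  show ?thesis
  proof (rule homotopy_equivalence_reduced_homology_group_isomorphism)
    show "continuous_map (top_of_set (UNIV - A)) (top_of_set (UNIV - {y})) id"
      using sub by auto
    show "continuous_map (top_of_set (UNIV - {y})) (top_of_set (UNIV - A)) (H 1)"
      using cont1 far by auto
    show "homotopic_with (\<lambda>h. True) (top_of_set (UNIV - A)) (top_of_set (UNIV - A)) (H 1 \<circ> id) id"
      using hom2 unfolding H0 by (simp add: homotopic_with_sym)
    show "homotopic_with (\<lambda>k. True) (top_of_set (UNIV - {y})) (top_of_set (UNIV - {y})) (id \<circ> H 1) id"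
      using hom1 unfolding H0 by (simp add: homotopic_with_sym)
  qed
qed

text \<open>Pushing points away from \<open>y\<close> is discontinuous at \<open>y\<close>, so it yields no homotopy inverse
  between the pairs themselves. The boundary maps avoid this: Euclidean space is contractible,
  so they turn both relative groups into reduced homology groups of complements.\<close>

lemma euclidean_restrict_iso:
  fixes A :: "'a::euclidean_space set"
  assumes A: "bounded A" "convex A" "y \<in> A"
  shows "hom_induced p euclidean (UNIV - A) euclidean (UNIV - {y}) id
    \<in> iso (relative_homology_group p euclidean (UNIV - A))
          (relative_homology_group p euclidean (UNIV - {y}))"
proof -
  have ne: "UNIV - A \<noteq> {}"
    using A(1) not_bounded_UNIV by (metis Diff_eq_empty_iff bounded_subset)
  have contr: "contractible_space (euclidean :: 'a topology)"
    using contractible_UNIV contractible_space_top_of_set[of "UNIV :: 'a set"] by simp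
  have sub: "UNIV - A \<subseteq> UNIV - {y}"
    using A(3) by blast
  show ?thesis
  proof (rule iso_square[where k = "hom_boundary p euclidean (UNIV - {y})"
        and h = "hom_boundary p euclidean (UNIV - A)"
        and g = "hom_induced (p - 1) (top_of_set (UNIV - A)) {} (top_of_set (UNIV - {y})) {} id"])
    show "hom_boundary p euclidean (UNIV - A)
        \<in> iso (relative_homology_group p euclidean (UNIV - A))
              (reduced_homology_group (p - 1) (top_of_set (UNIV - A)))"
      by (rule iso_relative_homology_of_contractible) (use contr ne in auto)
    show "hom_boundary p euclidean (UNIV - {y})
        \<in> iso (relative_homology_group p euclidean (UNIV - {y}))
              (reduced_homology_group (p - 1) (top_of_set (UNIV - {y})))"
      by (rule iso_relative_homology_of_contractible) (use contr ne sub in auto)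
    show "hom_boundary p euclidean (UNIV - {y})
        (hom_induced p euclidean (UNIV - A) euclidean (UNIV - {y}) id x)
      = hom_induced (p - 1) (top_of_set (UNIV - A)) {} (top_of_set (UNIV - {y})) {} id
          (hom_boundary p euclidean (UNIV - A) x)" for x
    proof -
      have "id \<in> UNIV - A \<rightarrow> UNIV - {y}"
        using sub by auto
      from naturality_hom_induced[OF continuous_map_id this, of p] show ?thesis
        by (metis comp_apply)
    qed
  qed (use inclusion_complement_convex_iso[OF A] in \<open>auto simp: hom_induced_hom\<close>)
qed

lemma euclidean_local_orientation_exists:
  "\<exists>c. local_orientation DIM('a) (euclidean :: 'a::euclidean_space topology) 0 c"
proof -
  let ?n = "DIM('a)"
  let ?E = "Euclidean_space ?n"
  let ?z = "\<lambda>i. 0 :: real"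
  let ?G = "relative_homology_group (int ?n) ?E (topspace ?E - {?z})"
  have "(euclidean :: 'a topology) homeomorphic_space ?E"
    using homeomorphic_subspace_Euclidean_space[of "UNIV :: 'a set" ?n] by simp
  then obtain f0 :: "'a \<Rightarrow> nat \<Rightarrow> real" where f0: "homeomorphic_map euclidean ?E f0"
    by (auto simp: homeomorphic_space)
  have cyc: "\<exists>c \<in> carrier ?G.
      subgroup_generated ?G {c}
        = ?G"
  proof -
    have top0: "topspace (Euclidean_space 0) = {?z}"
      by (auto simp: topspace_Euclidean_space)
    have "closedin (Euclidean_space 0) {?z}"
      by (simp add: closedin_Euclidean_space_iff topspace_Euclidean_space)
    \<comment> \<open>Raising the dimension from 0 to \<open>?n\<close> at once identifies the local homology with
      the zeroth homology of a point.\<close>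
    from relative_homology_group_Euclidean_complement_step[OF this, of 0 ?n]
    have "relative_homology_group 0 (Euclidean_space 0) (topspace (Euclidean_space 0) - {?z})
        \<cong> ?G"
      by simp
    then have "homology_group 0 (Euclidean_space 0)
        \<cong> ?G"
      using top0 by simp
    moreover have "homology_group 0 (Euclidean_space 0) \<cong> integer_group"
      by (rule homology_coefficients[OF top0])
    ultimately have "integer_group \<cong> ?G"
      using group.iso_sym iso_trans group_relative_homology_group by blast
    then obtain k where k: "k \<in> iso integer_group ?G"
      by (auto simp: is_iso_def)
    have "carrier (subgroup_generated integer_group {1}) = UNIV"
      using group.carrier_subgroup_generated_by_singleton[OF group_integer_group, of 1] by auto
    then have "subgroup_generated integer_group {1} = integer_group"
      by (intro monoid.equality) auto
    then show ?thesis
      using iso_preserves_generator[OF _ _ k, of 1] by auto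
  qed
  have z: "?z \<in> topspace ?E"
    by (simp add: topspace_Euclidean_space)
  moreover have "topspace ?E = f0 ` UNIV"
    using homeomorphic_imp_surjective_map[OF f0] by simp
  ultimately obtain a where a: "f0 a = ?z"
    by (metis imageE)
  define f where "f = f0 \<circ> (\<lambda>x. x + a)"
  have "homeomorphic_maps euclidean euclidean (\<lambda>x. x + a) (\<lambda>x. x - a)"
    by (auto simp: homeomorphic_maps_def intro!: continuous_intros)
  then have f: "homeomorphic_map euclidean ?E f"
    unfolding f_def by (intro homeomorphic_map_compose[OF _ f0]) (auto simp: homeomorphic_map_maps)
  have fz: "f 0 = ?z"
    by (simp add: f_def a)
  have "f ` (UNIV - {0}) = topspace ?E - {?z}"
    using homeomorphic_imp_surjective_map[OF f] homeomorphic_imp_injective_map[OF f] fz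
    by (simp add: image_set_diff)
  then have "hom_induced ?n euclidean (UNIV - {0}) ?E (topspace ?E - {?z}) f
      \<in> iso (relative_homology_group ?n euclidean (UNIV - {0}))
            ?G"
    by (intro homeomorphic_map_relative_homology_iso[OF f]) auto
  then have "?G
      \<cong> relative_homology_group ?n euclidean (UNIV - {0 :: 'a})"
    by (meson group.iso_sym group_relative_homology_group is_isoI)
  then obtain k where k: "k \<in> iso ?G
      (relative_homology_group ?n euclidean (UNIV - {0 :: 'a}))"
    by (auto simp: is_iso_def)
  obtain c where "c \<in> carrier ?G"
    "subgroup_generated ?G {c}
        = ?G"
    using cyc by blast
  then show ?thesis
    using iso_preserves_generator[OF _ _ k] by (auto simp: local_orientation_def homology_at_def)
qed

definition open_embedding :: "('e::topological_space \<Rightarrow> 'a) \<Rightarrow> 'a topology \<Rightarrow> bool"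
  where "open_embedding \<psi> M \<longleftrightarrow> continuous_map euclidean M \<psi> \<and> open_map euclidean M \<psi> \<and> inj \<psi>"

lemma open_embedding_homeomorphic_map:
  assumes "open_embedding \<psi> M"
  shows "homeomorphic_map euclidean (subtopology M (range \<psi>)) \<psi>" "openin M (range \<psi>)"
proof -
  show U: "openin M (range \<psi>)"
    using assms by (auto simp: open_embedding_def open_map_def)
  then show "homeomorphic_map euclidean (subtopology M (range \<psi>)) \<psi>"
    using assms unfolding open_embedding_def
    by (intro bijective_open_imp_homeomorphic_map)
       (auto simp: open_map_def continuous_map_in_subtopology openin_open_subtopology dest: openin_subset)
qed

text \<open>The part of \<open>M\<close> outside the chart is excised. This is possible because the closure of the
  bounded set \<open>A\<close> is compact, hence has a closed image in \<open>M\<close> that stays inside the chart.\<close>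

lemma open_embedding_excision:
  fixes \<psi> :: "'e::euclidean_space \<Rightarrow> 'a"
  assumes \<psi>: "open_embedding \<psi> M" and M: "Hausdorff_space M" and A: "bounded A"
  shows "hom_induced p euclidean (UNIV - A) M (topspace M - \<psi> ` A) \<psi>
    \<in> iso (relative_homology_group p euclidean (UNIV - A))
          (relative_homology_group p M (topspace M - \<psi> ` A))"
proof -
  let ?U = "range \<psi>"
  let ?MU = "subtopology M ?U"
  note hom = open_embedding_homeomorphic_map(1)[OF \<psi>] and U = open_embedding_homeomorphic_map(2)[OF \<psi>]
  have sub: "?U \<subseteq> topspace M"
    using U by (rule openin_subset)
  have inj: "inj \<psi>" and cont: "continuous_map euclidean M \<psi>"
    using \<psi> by (auto simp: open_embedding_def)
  have img: "\<psi> ` (UNIV - A) = ?U - \<psi> ` A"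
    by (simp add: image_set_diff inj)
  have "compactin M (\<psi> ` closure A)"
    by (rule image_compactin[OF _ cont]) (use A in auto)
  then have "closedin M (\<psi> ` closure A)"
    using M compactin_imp_closedin by blast
  then have "openin M (topspace M - \<psi> ` closure A)"
    by blast
  then have "topspace M - \<psi> ` closure A \<subseteq> M interior_of (topspace M - \<psi> ` A)"
    using closure_subset by (intro interior_of_maximal) auto
  moreover have "M closure_of (topspace M - ?U) = topspace M - ?U"
    using U by (intro closure_of_closedin) blast
  ultimately have "M closure_of (topspace M - ?U) \<subseteq> M interior_of (topspace M - \<psi> ` A)"
    by blast
  note exc0 = homology_excision_axiom[OF this, of "topspace M" p, simplified]
  have exc: "hom_induced p ?MU (?U - \<psi> ` A) M (topspace M - \<psi> ` A) id
      \<in> iso (relative_homology_group p ?MU (?U - \<psi> ` A)) (relative_homology_group p M (topspace M - \<psi> ` A))"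
  proof -
    have "topspace M - (topspace M - ?U) = ?U"
      "topspace M - \<psi> ` A - (topspace M - ?U) = ?U - \<psi> ` A"
      using sub by blast+
    then show ?thesis
      using exc0 by simp
  qed
  have "hom_induced p euclidean (UNIV - A) ?MU (?U - \<psi> ` A) \<psi>
      \<in> iso (relative_homology_group p euclidean (UNIV - A)) (relative_homology_group p ?MU (?U - \<psi> ` A))"
    by (rule homeomorphic_map_relative_homology_iso[OF hom]) (use img in auto)
  then have "hom_induced p ?MU (?U - \<psi> ` A) M (topspace M - \<psi> ` A) id \<circ>
      hom_induced p euclidean (UNIV - A) ?MU (?U - \<psi> ` A) \<psi>
    \<in> iso (relative_homology_group p euclidean (UNIV - A)) (relative_homology_group p M (topspace M - \<psi> ` A))"
    using exc by (rule iso_set_trans)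
  moreover have "hom_induced p ?MU (?U - \<psi> ` A) M (topspace M - \<psi> ` A) id \<circ>
      hom_induced p euclidean (UNIV - A) ?MU (?U - \<psi> ` A) \<psi>
    = hom_induced p euclidean (UNIV - A) M (topspace M - \<psi> ` A) (id \<circ> \<psi>)"
    by (rule hom_induced_compose[symmetric])
       (use hom sub img in \<open>auto simp: homeomorphic_imp_continuous_map continuous_map_from_subtopology inj_image_mem_iff[OF inj]\<close>)
  ultimately show ?thesis
    by simp
qed

lemma homology_restrict_iso:
  fixes \<psi> :: "'e::euclidean_space \<Rightarrow> 'a"
  assumes \<psi>: "open_embedding \<psi> M" and M: "Hausdorff_space M"
    and A: "bounded A" "convex A" "u \<in> A"
  shows "homology_restrict n M (\<psi> ` A) {\<psi> u} \<in> iso (homology_at n M (\<psi> ` A)) (homology_at n M {\<psi> u})"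
proof -
  have inj: "inj \<psi>" and cont: "continuous_map euclidean M \<psi>"
    using \<psi> by (auto simp: open_embedding_def)
  have range: "\<psi> z \<in> topspace M" for z
    using cont by (auto simp: continuous_map_def)
  let ?HA = "relative_homology_group n euclidean (UNIV - A)"
  let ?Hu = "relative_homology_group n euclidean (UNIV - {u})"
  let ?f = "homology_restrict n M (\<psi> ` A) {\<psi> u}"
  let ?a = "hom_induced n euclidean (UNIV - A) M (topspace M - \<psi> ` A) \<psi>"
  let ?b = "hom_induced n euclidean (UNIV - {u}) M (topspace M - {\<psi> u}) \<psi>"
  let ?r = "hom_induced n euclidean (UNIV - A) euclidean (UNIV - {u}) id"
  have a: "?a \<in> iso ?HA (homology_at n M (\<psi> ` A))"
    unfolding homology_at_def by (rule open_embedding_excision[OF \<psi> M A(1)])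
  have b: "?b \<in> iso ?Hu (homology_at n M {\<psi> u})"
    unfolding homology_at_def using open_embedding_excision[OF \<psi> M, of "{u}"] by simp
  have r: "?r \<in> iso ?HA ?Hu"
    by (rule euclidean_restrict_iso[OF A])
  have mem: "(\<lambda>z. \<psi> z) \<in> UNIV - B \<rightarrow> topspace M - \<psi> ` B" for B
    using range inj by (auto simp: inj_def)
  have "?f \<circ> ?a = ?b \<circ> ?r"
    using A(3) mem[of A] mem[of "{u}"] cont unfolding homology_restrict_def
    by (subst (1 2) hom_induced_compose[symmetric]) (auto simp: eta_contract_eq)
  then have comm: "?f (?a x) = ?b (?r x)" for x
    by (metis comp_apply)
  have "bij_betw (?b \<circ> ?r) (carrier ?HA) (carrier (homology_at n M {\<psi> u}))"
    using r b by (auto simp: iso_def intro: bij_betw_trans)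
  then have "bij_betw (?f \<circ> ?a) (carrier ?HA) (carrier (homology_at n M {\<psi> u}))"
    using \<open>?f \<circ> ?a = ?b \<circ> ?r\<close> by simp
  moreover have "bij_betw ?a (carrier ?HA) (carrier (homology_at n M (\<psi> ` A)))"
    using a by (simp add: iso_def)
  ultimately have "bij_betw ?f (carrier (homology_at n M (\<psi> ` A))) (carrier (homology_at n M {\<psi> u}))"
    using bij_betw_comp_iff by blast
  then show ?thesis
    by (simp add: iso_def homology_restrict_def homology_at_def hom_induced_hom)
qed

section \<open>Orientations from a dense subset\<close>

lemma homology_restrict_restrict:
  assumes "C \<subseteq> B" "B \<subseteq> A"
  shows "homology_restrict n M B C (homology_restrict n M A B c) = homology_restrict n M A C c"
  unfolding homology_restrict_def
  using assms by (subst hom_induced_compose') auto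

lemma homology_restrict_carrier: "homology_restrict n M A B c \<in> carrier (homology_at n M B)"
  by (simp add: homology_restrict_def homology_at_def hom_induced_carrier)

lemma group_homology_at: "group (homology_at n M A)"
  by (simp add: homology_at_def)

text \<open>On such a set a class is determined by its restriction to any single point. Equality of
  two local classes thereby becomes a condition that is both open and closed.\<close>

definition good_nbhd :: "nat \<Rightarrow> 'a topology \<Rightarrow> 'a set \<Rightarrow> bool"
  where "good_nbhd n M V \<longleftrightarrow> openin M V \<and>
    (\<forall>y\<in>V. homology_restrict n M V {y} \<in> iso (homology_at n M V) (homology_at n M {y}))"

lemma good_nbhd_inj:
  assumes "good_nbhd n M V" "y \<in> V" "c \<in> carrier (homology_at n M V)" "c' \<in> carrier (homology_at n M V)"
    and "homology_restrict n M V {y} c = homology_restrict n M V {y} c'"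
  shows "c = c'"
proof -
  have "inj_on (homology_restrict n M V {y}) (carrier (homology_at n M V))"
    using assms(1,2) by (simp add: good_nbhd_def iso_def bij_betw_def)
  then show ?thesis
    using assms(3-5) by (simp add: inj_on_def)
qed

lemma good_nbhd_agree:
  assumes W: "good_nbhd n M W" "z \<in> W" "W \<subseteq> V" "W \<subseteq> V'"
    and eq: "homology_restrict n M V {z} c = homology_restrict n M V' {z} c'"
    and y: "y \<in> W"
  shows "homology_restrict n M V {y} c = homology_restrict n M V' {y} c'"
proof -
  have "homology_restrict n M V W c = homology_restrict n M V' W c'"
    by (rule good_nbhd_inj[OF W(1,2) homology_restrict_carrier homology_restrict_carrier])
       (use W eq in \<open>simp add: homology_restrict_restrict\<close>)
  then have "homology_restrict n M W {y} (homology_restrict n M V W c)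
      = homology_restrict n M W {y} (homology_restrict n M V' W c')"
    by (rule arg_cong)
  then show ?thesis
    using y W(3,4) by (simp add: homology_restrict_restrict)
qed

lemma good_nbhd_convex_image:
  fixes \<psi> :: "'e::euclidean_space \<Rightarrow> 'a"
  assumes "open_embedding \<psi> M" "Hausdorff_space M" "open A" "bounded A" "convex A"
  shows "good_nbhd n M (\<psi> ` A)"
  unfolding good_nbhd_def
proof (intro conjI ballI)
  show "openin M (\<psi> ` A)"
    using assms by (simp add: open_embedding_def open_map_def)
qed (use homology_restrict_iso[OF assms(1,2,4,5)] in blast)

lemma good_nbhd_basis:
  fixes \<psi> :: "'e::euclidean_space \<Rightarrow> 'a"
  assumes \<psi>: "open_embedding \<psi> M" and M: "Hausdorff_space M"
    and W: "openin M W" "\<psi> u \<in> W"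
  obtains V where "good_nbhd n M V" "\<psi> u \<in> V" "V \<subseteq> W"
proof -
  have "open {u. \<psi> u \<in> W}"
    using \<psi> W openin_continuous_map_preimage[of euclidean M \<psi> W] by (simp add: open_embedding_def)
  then obtain \<epsilon> where "\<epsilon> > 0" "ball u \<epsilon> \<subseteq> {u. \<psi> u \<in> W}"
    using W(2) by (auto dest!: open_contains_ball[THEN iffD1, rule_format])
  then show thesis
    by (intro that[OF good_nbhd_convex_image[OF \<psi> M, of "ball u \<epsilon>" n]]) auto
qed

text \<open>Over each chart ball take the class that restricts to \<open>e\<close> at one chosen point of \<open>D\<close>. The
  points of \<open>D\<close> in the ball at which it restricts to \<open>e\<close> form a relatively open set, and so do
  those at which it does not; since the part of \<open>D\<close> in the ball is connected, it restricts to
  \<open>e\<close> at all of them. Two overlapping balls then have classes that agree at the points of \<open>D\<close> in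
  the overlap, and by density they agree on the whole overlap.\<close>

theorem orientable_of_dense_orientation:
  fixes M :: "'a topology" and chart :: "'a \<Rightarrow> 'e::euclidean_space \<Rightarrow> 'a"
  assumes M: "Hausdorff_space M"
    and chart: "\<And>x. x \<in> topspace M \<Longrightarrow> open_embedding (chart x) M"
      "\<And>x. x \<in> topspace M \<Longrightarrow> chart x 0 = x"
    and D: "D \<subseteq> topspace M" "M closure_of D = topspace M"
    and conn: "\<And>x. x \<in> topspace M \<Longrightarrow> connectedin M (chart x ` ball 0 1 \<inter> D)"
    and gen: "\<And>y. y \<in> D \<Longrightarrow> local_orientation n M y (e y)"
    and cons: "\<And>y. y \<in> D \<Longrightarrow> \<exists>V c. openin M V \<and> y \<in> V \<and> c \<in> carrier (homology_at n M V) \<and>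
        (\<forall>z\<in>V \<inter> D. homology_restrict n M V {z} c = e z)"
  shows "orientable n M"
proof -
  define V where "V x = chart x ` ball 0 1" for x
  have V: "good_nbhd n M (V x)" "openin M (V x)" "x \<in> V x" if "x \<in> topspace M" for x
  proof -
    show "good_nbhd n M (V x)"
      unfolding V_def by (rule good_nbhd_convex_image[OF chart(1)[OF that] M]) auto
    then show "openin M (V x)"
      by (simp add: good_nbhd_def)
    show "x \<in> V x"
      unfolding V_def using chart(2)[OF that] by (intro image_eqI[of _ _ 0]) auto
  qed
  have meet: "\<exists>y. y \<in> W \<inter> D" if "openin M W" "W \<noteq> {}" for W
    using that D dense_intersects_open by blast
  have basis: "\<exists>W. good_nbhd n M W \<and> x \<in> W \<and> W \<subseteq> U" if U: "openin M U" "x \<in> U" for U x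
  proof -
    have x: "x \<in> topspace M"
      using U openin_subset by blast
    show ?thesis
      by (rule good_nbhd_basis[OF chart(1)[OF x] M U(1), of 0 n]) (use chart(2)[OF x] U(2) in auto)
  qed
  let ?local = "\<lambda>x c. c \<in> carrier (homology_at n M (V x)) \<and>
    local_orientation n M x (homology_restrict n M (V x) {x} c) \<and>
    (\<forall>z\<in>V x \<inter> D. homology_restrict n M (V x) {z} c = e z)"
  have "\<exists>c. ?local x c" if x: "x \<in> topspace M" for x
  proof -
    obtain y where y: "y \<in> V x" "y \<in> D"
      using meet[OF V(2)[OF x]] V(3)[OF x] by blast
    let ?res = "\<lambda>z. homology_restrict n M (V x) {z}"
    have iso: "?res z \<in> iso (homology_at n M (V x)) (homology_at n M {z})" if "z \<in> V x" for z
      using V(1)[OF x] that by (simp add: good_nbhd_def)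
    have ey: "e y \<in> carrier (homology_at n M {y})"
      "subgroup_generated (homology_at n M {y}) {e y} = homology_at n M {y}"
      using gen[OF y(2)] by (auto simp: local_orientation_def)
    obtain c where c: "c \<in> carrier (homology_at n M (V x))" "?res y c = e y"
    proof -
      have "e y \<in> ?res y ` carrier (homology_at n M (V x))"
        using iso[OF y(1)] ey(1) by (simp add: iso_def bij_betw_def)
      then show thesis
        using that by auto
    qed
    have inv: "inv_into (carrier (homology_at n M (V x))) (?res y)
        \<in> iso (homology_at n M {y}) (homology_at n M (V x))"
      using group.iso_set_sym[OF group_homology_at iso[OF y(1)]] .
    have "inv_into (carrier (homology_at n M (V x))) (?res y) (e y) = c"
      unfolding c(2)[symmetric]
      by (rule inv_into_f_f) (use iso[OF y(1)] c(1) in \<open>simp_all add: iso_def bij_betw_def\<close>)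
    then have "subgroup_generated (homology_at n M (V x)) {c} = homology_at n M (V x)"
      using iso_preserves_generator(2)[OF group_homology_at group_homology_at inv ey] by simp
    from iso_preserves_generator[OF group_homology_at group_homology_at iso[OF V(3)[OF x]] c(1) this]
    have 1: "local_orientation n M x (?res x c)"
      by (simp add: local_orientation_def)
    have spread: "\<exists>W. openin M W \<and> z \<in> W \<and>
        ((\<forall>z'\<in>W \<inter> V x \<inter> D. ?res z' c = e z') \<or> (\<forall>z'\<in>W \<inter> V x \<inter> D. ?res z' c \<noteq> e z'))"
      if z: "z \<in> V x" "z \<in> D" for z
    proof -
      obtain U d where U: "openin M U" "z \<in> U" and d: "\<forall>z\<in>U \<inter> D. homology_restrict n M U {z} d = e z"
        using cons[OF z(2)] by blast
      obtain W where W: "good_nbhd n M W" "z \<in> W" "W \<subseteq> U \<inter> V x"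
        using basis[of "U \<inter> V x" z] U z V(2)[OF x] by blast
      have "?res z' c = e z'" if "z' \<in> W \<inter> D" "z'' \<in> W \<inter> D" "?res z'' c = e z''" for z' z''
      proof -
        have "?res z'' c = homology_restrict n M U {z''} d"
          using that W(3) d by auto
        then have "?res z' c = homology_restrict n M U {z'} d"
          using good_nbhd_agree[OF W(1), of z'' "V x" U c d z'] that W(3) by blast
        then show ?thesis
          using that W(3) d by auto
      qed
      moreover have "openin M W"
        using W(1) by (simp add: good_nbhd_def)
      ultimately show ?thesis
        using W(2) by blast
    qed
    have 2: "?res z c = e z" if z: "z \<in> V x \<inter> D" for z
    proof (rule ccontr)
      assume neq: "?res z c \<noteq> e z"
      define E1 where "E1 = \<Union>{W. openin M W \<and> (\<forall>z'\<in>W \<inter> V x \<inter> D. ?res z' c = e z')}"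
      define E2 where "E2 = \<Union>{W. openin M W \<and> (\<forall>z'\<in>W \<inter> V x \<inter> D. ?res z' c \<noteq> e z')}"
      have "connectedin M (V x \<inter> D)"
        unfolding V_def by (rule conn[OF x])
      moreover have "openin M E1" "openin M E2"
        by (auto simp: E1_def E2_def)
      moreover have "V x \<inter> D \<subseteq> E1 \<union> E2"
        unfolding E1_def E2_def using spread by blast
      moreover have "E1 \<inter> E2 \<inter> (V x \<inter> D) = {}"
        unfolding E1_def E2_def by blast
      moreover have "E1 \<inter> (V x \<inter> D) \<noteq> {}"
        using spread[OF y] y c(2) unfolding E1_def by blast
      moreover have "E2 \<inter> (V x \<inter> D) \<noteq> {}"
        using spread[of z] z neq unfolding E2_def by blast
      ultimately show False
        unfolding connectedin by blast
    qed
    show ?thesis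
      using c(1) 1 2 by blast
  qed
  then have "\<forall>x\<in>topspace M. \<exists>c. ?local x c"
    by blast
  then obtain c where cV: "\<forall>x\<in>topspace M. ?local x (c x)"
    by (rule bchoice[THEN exE])
  have c: "\<And>x. x \<in> topspace M \<Longrightarrow> c x \<in> carrier (homology_at n M (V x))"
      "\<And>x. x \<in> topspace M \<Longrightarrow> local_orientation n M x (homology_restrict n M (V x) {x} (c x))"
      "\<And>x z. x \<in> topspace M \<Longrightarrow> z \<in> V x \<Longrightarrow> z \<in> D \<Longrightarrow> homology_restrict n M (V x) {z} (c x) = e z"
    using cV by blast+
  define \<mu> where "\<mu> x = homology_restrict n M (V x) {x} (c x)" for x
  have agree: "homology_restrict n M (V x) {y} (c x) = \<mu> y" if x: "x \<in> topspace M" and y: "y \<in> V x" for x y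
  proof -
    have y': "y \<in> topspace M"
      using V(2)[OF x] y openin_subset by blast
    obtain W where W: "good_nbhd n M W" "y \<in> W" "W \<subseteq> V x \<inter> V y"
      using basis[of "V x \<inter> V y" y] V(2)[OF x] V(2,3)[OF y'] y by blast
    then obtain z where z: "z \<in> W" "z \<in> D"
      using meet[of W] by (auto simp: good_nbhd_def)
    have eqz: "homology_restrict n M (V x) {z} (c x) = homology_restrict n M (V y) {z} (c y)"
    proof -
      have "z \<in> V x" "z \<in> V y"
        using z W(3) by blast+
      then show ?thesis
        by (rule trans[OF c(3)[OF x _ z(2)] c(3)[OF y' _ z(2), symmetric]])
    qed
    show ?thesis
      unfolding \<mu>_def by (rule good_nbhd_agree[OF W(1) z(1)]) (use W(2,3) eqz in simp_all)
  qed
  have "orientation n M \<mu>"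
    unfolding orientation_def
  proof (intro conjI ballI)
    fix x assume x: "x \<in> topspace M"
    show "local_orientation n M x (\<mu> x)"
      unfolding \<mu>_def by (rule c(2)[OF x])
    show "\<exists>U c. openin M U \<and> x \<in> U \<and> c \<in> carrier (homology_at n M U) \<and>
        (\<forall>y\<in>U. homology_restrict n M U {y} c = \<mu> y)"
      using V(2,3)[OF x] c(1)[OF x] agree[OF x] by (intro exI[of _ "V x"] exI[of _ "c x"]) simp
  qed
  then show ?thesis
    by (auto simp: orientable_def)
qed

section \<open>Quaternions and rotations\<close>

text \<open>The map \<open>y \<mapsto> q y q\<^sup>*\<close> for the quaternion \<open>q\<close> with real part \<open>w\<close> and vector part \<open>x\<close>, where
  \<open>q\<^sup>*\<close> is the conjugate: a rotation for unit \<open>q\<close>, and in general \<open>w\<^sup>2 + x \<bullet> x\<close> times a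
  rotation. Leaving \<open>q\<close> unnormalised keeps all identities polynomial.\<close>

definition quat_matrix :: "real \<Rightarrow> real^3 \<Rightarrow> real^3^3"
  where "quat_matrix w x = vector
    [vector [w\<^sup>2 + (x$1)\<^sup>2 - (x$2)\<^sup>2 - (x$3)\<^sup>2, 2 * (x$1 * x$2 - w * x$3), 2 * (x$1 * x$3 + w * x$2)],
     vector [2 * (x$1 * x$2 + w * x$3), w\<^sup>2 - (x$1)\<^sup>2 + (x$2)\<^sup>2 - (x$3)\<^sup>2, 2 * (x$2 * x$3 - w * x$1)],
     vector [2 * (x$1 * x$3 - w * x$2), 2 * (x$2 * x$3 + w * x$1), w\<^sup>2 - (x$1)\<^sup>2 - (x$2)\<^sup>2 + (x$3)\<^sup>2]]"

lemmas mat3_simps = vec_eq_iff forall_3 sum_3 vector_3 inner_vec_def cross_components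
  matrix_matrix_mult_def matrix_vector_mult_def transpose_def mat_def

lemma quat_matrix_vector:
  "quat_matrix w x *v y = (w\<^sup>2 - x \<bullet> x) *\<^sub>R y + (2 * w) *\<^sub>R cross3 x y + (2 * (x \<bullet> y)) *\<^sub>R x"
  by (simp add: quat_matrix_def mat3_simps power2_eq_square) (simp add: algebra_simps)

lemma quat_matrix_mult:
  "quat_matrix w x ** quat_matrix w' x'
    = quat_matrix (w * w' - x \<bullet> x') (w *\<^sub>R x' + w' *\<^sub>R x + cross3 x x')"
  by (simp add: quat_matrix_def mat3_simps power2_eq_square) (simp add: algebra_simps)

lemma quat_norm_mult:
  fixes x x' :: "real^3"
  shows "(w * w' - x \<bullet> x')\<^sup>2
      + (w *\<^sub>R x' + w' *\<^sub>R x + cross3 x x') \<bullet> (w *\<^sub>R x' + w' *\<^sub>R x + cross3 x x')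
    = (w\<^sup>2 + x \<bullet> x) * (w'\<^sup>2 + x' \<bullet> x')"
  by (simp add: mat3_simps power2_eq_square) (simp add: algebra_simps)

lemma quat_matrix_scale: "quat_matrix (c * w) (c *\<^sub>R x) = c\<^sup>2 *\<^sub>R quat_matrix w x"
  by (simp add: quat_matrix_def mat3_simps power2_eq_square) (simp add: algebra_simps)

lemma quat_matrix_1_0: "quat_matrix 1 0 = mat 1"
  by (simp add: quat_matrix_def mat3_simps)

lemma norm_quat_matrix_vector: "norm (quat_matrix w x *v y) = (w\<^sup>2 + x \<bullet> x) * norm y"
proof -
  have "(quat_matrix w x *v y) \<bullet> (quat_matrix w x *v y) = (w\<^sup>2 + x \<bullet> x)\<^sup>2 * (y \<bullet> y)"
    by (simp add: quat_matrix_def mat3_simps power2_eq_square) (simp add: algebra_simps)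
  then have "(norm (quat_matrix w x *v y))\<^sup>2 = ((w\<^sup>2 + x \<bullet> x) * norm y)\<^sup>2"
    by (simp add: power2_norm_eq_inner power_mult_distrib)
  then show ?thesis
    by (simp add: power2_eq_iff_nonneg)
qed

lemma carrier_SO3: "A \<in> carrier SO3 \<longleftrightarrow> transpose A ** A = mat 1 \<and> det A = 1"
  by (simp add: SO3_def rotation_matrix_def orthogonal_matrix)

lemma transpose_mult_quat_matrix:
  "transpose (quat_matrix w x) ** quat_matrix w x = (w\<^sup>2 + x \<bullet> x)\<^sup>2 *\<^sub>R mat 1"
  by (simp add: quat_matrix_def mat3_simps power2_eq_square) (simp add: algebra_simps)

lemma det_quat_matrix: "det (quat_matrix w x) = (w\<^sup>2 + x \<bullet> x) ^ 3"
  by (simp add: quat_matrix_def mat3_simps det_3 power2_eq_square power3_eq_cube) (simp add: algebra_simps)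

lemma quat_matrix_SO3: "w\<^sup>2 + x \<bullet> x = 1 \<Longrightarrow> quat_matrix w x \<in> carrier SO3"
  by (simp add: carrier_SO3 transpose_mult_quat_matrix det_quat_matrix)

text \<open>The rotation of the quaternion with real part 1 and vector part \<open>x\<close>, that is the rotation
  about \<open>x\<close> by the angle \<open>2 arctan |x|\<close>. All rotations by less than a half turn arise in this
  way.\<close>

definition cayley :: "real^3 \<Rightarrow> real^3^3"
  where "cayley x = (1 / (1 + x \<bullet> x)) *\<^sub>R quat_matrix 1 x"

lemma one_plus_inner_pos: "1 + x \<bullet> x > 0" for x :: "'a::real_inner"
  by (simp add: add_pos_nonneg)

lemma cayley_eq_quat: "cayley x = quat_matrix (1 / sqrt (1 + x \<bullet> x)) ((1 / sqrt (1 + x \<bullet> x)) *\<^sub>R x)"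
  using quat_matrix_scale[of "1 / sqrt (1 + x \<bullet> x)" 1 x] one_plus_inner_pos[of x]
  by (simp add: cayley_def power_divide)

lemma cayley_quat_unit: "(1 / sqrt (1 + x \<bullet> x))\<^sup>2 + ((1 / sqrt (1 + x \<bullet> x)) *\<^sub>R x) \<bullet> ((1 / sqrt (1 + x \<bullet> x)) *\<^sub>R x) = 1"
  for x :: "real^3"
  using one_plus_inner_pos[of x] by (simp add: power_divide flip: power2_eq_square) (simp add: field_simps)

lemma cayley_SO3: "cayley x \<in> carrier SO3"
  unfolding cayley_eq_quat by (rule quat_matrix_SO3[OF cayley_quat_unit])

lemma cayley_0: "cayley 0 = mat 1"
  by (simp add: cayley_def quat_matrix_1_0)

text \<open>A rotation preserves cross products, so it equals its own cofactor matrix.\<close>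

lemma SO3_cofactors:
  assumes "A \<in> carrier SO3"
  shows
    "A$1$1 = A$2$2 * A$3$3 - A$2$3 * A$3$2" "A$1$2 = A$2$3 * A$3$1 - A$2$1 * A$3$3"
    "A$1$3 = A$2$1 * A$3$2 - A$2$2 * A$3$1" "A$2$1 = A$1$3 * A$3$2 - A$1$2 * A$3$3"
    "A$2$2 = A$1$1 * A$3$3 - A$1$3 * A$3$1" "A$2$3 = A$1$2 * A$3$1 - A$1$1 * A$3$2"
    "A$3$1 = A$1$2 * A$2$3 - A$1$3 * A$2$2" "A$3$2 = A$1$3 * A$2$1 - A$1$1 * A$2$3"
    "A$3$3 = A$1$1 * A$2$2 - A$1$2 * A$2$1"
  using cross_rotation_matrix[of A "axis 2 1" "axis 3 1"] cross_rotation_matrix[of A "axis 3 1" "axis 1 1"]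
    cross_rotation_matrix[of A "axis 1 1" "axis 2 1"] assms
  by (simp_all add: SO3_def cross_basis mat3_simps axis_def mult.commute)

lemma SO3_rows:
  assumes "A \<in> carrier SO3"
  shows
    "(A$1$1)\<^sup>2 + (A$1$2)\<^sup>2 + (A$1$3)\<^sup>2 = 1" "(A$2$1)\<^sup>2 + (A$2$2)\<^sup>2 + (A$2$3)\<^sup>2 = 1"
    "(A$3$1)\<^sup>2 + (A$3$2)\<^sup>2 + (A$3$3)\<^sup>2 = 1"
    "A$1$1 * A$2$1 + A$1$2 * A$2$2 + A$1$3 * A$2$3 = 0"
    "A$1$1 * A$3$1 + A$1$2 * A$3$2 + A$1$3 * A$3$3 = 0"
    "A$2$1 * A$3$1 + A$2$2 * A$3$2 + A$2$3 * A$3$3 = 0"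
  using assms
  by (auto simp: SO3_def rotation_matrix_def orthogonal_matrix_def mat3_simps power2_eq_square mult.commute)

lemma SO3_columns:
  assumes "A \<in> carrier SO3"
  shows
    "(A$1$1)\<^sup>2 + (A$2$1)\<^sup>2 + (A$3$1)\<^sup>2 = 1" "(A$1$2)\<^sup>2 + (A$2$2)\<^sup>2 + (A$3$2)\<^sup>2 = 1"
    "(A$1$3)\<^sup>2 + (A$2$3)\<^sup>2 + (A$3$3)\<^sup>2 = 1"
    "A$1$1 * A$1$2 + A$2$1 * A$2$2 + A$3$1 * A$3$2 = 0"
    "A$1$1 * A$1$3 + A$2$1 * A$2$3 + A$3$1 * A$3$3 = 0"
    "A$1$2 * A$1$3 + A$2$2 * A$2$3 + A$3$2 * A$3$3 = 0"
  using assms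
  by (auto simp: SO3_def rotation_matrix_def orthogonal_matrix_def mat3_simps power2_eq_square mult.commute)

definition cayley_inv :: "real^3^3 \<Rightarrow> real^3"
  where "cayley_inv A = (1 / (1 + trace A)) *\<^sub>R vector [A$3$2 - A$2$3, A$1$3 - A$3$1, A$2$1 - A$1$2]"

lemma trace_cayley: "1 + trace (cayley x) = 4 / (1 + x \<bullet> x)"
proof -
  have "trace (quat_matrix 1 x) = 3 - x \<bullet> x"
    by (simp add: quat_matrix_def trace_def mat3_simps power2_eq_square)
  then have "trace (cayley x) = (3 - x \<bullet> x) / (1 + x \<bullet> x)"
    by (simp add: cayley_def trace_def flip: sum_divide_distrib)
  then show ?thesis
    using one_plus_inner_pos[of x] by (simp add: field_simps)
qed

lemma cayley_inv_cayley: "cayley_inv (cayley x) = x"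
proof -
  have "vector [cayley x$3$2 - cayley x$2$3, cayley x$1$3 - cayley x$3$1, cayley x$2$1 - cayley x$1$2]
      = (4 / (1 + x \<bullet> x)) *\<^sub>R x"
    by (simp add: vec_eq_iff forall_3 cayley_def quat_matrix_def flip: diff_divide_distrib)
  moreover have "1 / (4 / (1 + x \<bullet> x)) * (4 / (1 + x \<bullet> x)) = 1"
    using one_plus_inner_pos[of x] by simp
  ultimately show ?thesis
    unfolding cayley_inv_def trace_cayley by (simp only: scaleR_scaleR scaleR_one)
qed

text \<open>If \<open>A\<close> comes from a quaternion with real part \<open>w\<close>, then \<open>1 + trace A = 4 w\<^sup>2\<close>, and the
  skew part of \<open>A\<close> gives \<open>4 w\<close> times the vector part. That the vector recovered from the skew
  part also produces the symmetric part of \<open>A\<close> comes down to six quadratic relations between the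
  entries, each of them a linear combination of the cofactor and orthogonality relations.\<close>

lemma cayley_cayley_inv:
  assumes A: "A \<in> carrier SO3" and s: "trace A \<noteq> -1"
  shows "cayley (cayley_inv A) = A"
proof -
  note e = SO3_cofactors[OF A] SO3_rows[OF A] SO3_columns[OF A]
  define s where "s = 1 + A$1$1 + A$2$2 + A$3$3"
  define p q r where "p = A$3$2 - A$2$3" "q = A$1$3 - A$3$1" "r = A$2$1 - A$1$2"
  have s0: "s \<noteq> 0"
    using s by (simp add: trace_def sum_3 s_def)
  have inv: "cayley_inv A = (1/s) *\<^sub>R vector [p, q, r]"
    by (simp add: cayley_inv_def trace_def sum_3 s_def p_q_r_def)
  have "p\<^sup>2 - s * (1 + A$1$1 - A$2$2 - A$3$3) = ((A$2$1)\<^sup>2 + (A$2$2)\<^sup>2 + (A$2$3)\<^sup>2) + ((A$3$1)\<^sup>2 + (A$3$2)\<^sup>2 + (A$3$3)\<^sup>2) - ((A$1$1)\<^sup>2 + (A$2$1)\<^sup>2 + (A$3$1)\<^sup>2) - 1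
      + 2 * ((A$2$2 * A$3$3 - A$2$3 * A$3$2) - A$1$1)"
    unfolding p_q_r_def s_def by (simp add: power2_eq_square algebra_simps)
  then have pp: "p\<^sup>2 = s * (1 + A$1$1 - A$2$2 - A$3$3)"
    unfolding e(11,12,16) e(1)[symmetric] by simp
  have "q\<^sup>2 - s * (1 - A$1$1 + A$2$2 - A$3$3) = ((A$1$1)\<^sup>2 + (A$1$2)\<^sup>2 + (A$1$3)\<^sup>2) + ((A$3$1)\<^sup>2 + (A$3$2)\<^sup>2 + (A$3$3)\<^sup>2) - ((A$1$2)\<^sup>2 + (A$2$2)\<^sup>2 + (A$3$2)\<^sup>2) - 1
      + 2 * ((A$1$1 * A$3$3 - A$1$3 * A$3$1) - A$2$2)"
    unfolding p_q_r_def s_def by (simp add: power2_eq_square algebra_simps)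
  then have qq: "q\<^sup>2 = s * (1 - A$1$1 + A$2$2 - A$3$3)"
    unfolding e(10,12,17) e(5)[symmetric] by simp
  have "r\<^sup>2 - s * (1 - A$1$1 - A$2$2 + A$3$3) = ((A$1$1)\<^sup>2 + (A$1$2)\<^sup>2 + (A$1$3)\<^sup>2) + ((A$2$1)\<^sup>2 + (A$2$2)\<^sup>2 + (A$2$3)\<^sup>2) - ((A$1$3)\<^sup>2 + (A$2$3)\<^sup>2 + (A$3$3)\<^sup>2) - 1
      + 2 * ((A$1$1 * A$2$2 - A$1$2 * A$2$1) - A$3$3)"
    unfolding p_q_r_def s_def by (simp add: power2_eq_square algebra_simps)
  then have rr: "r\<^sup>2 = s * (1 - A$1$1 - A$2$2 + A$3$3)"
    unfolding e(10,11,18) e(9)[symmetric] by simp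
  have "p * q - s * (A$1$2 + A$2$1) = ((A$2$3 * A$3$1 - A$2$1 * A$3$3) - A$1$2) + ((A$1$3 * A$3$2 - A$1$2 * A$3$3) - A$2$1)
      - (A$1$1 * A$2$1 + A$1$2 * A$2$2 + A$1$3 * A$2$3) - (A$1$1 * A$1$2 + A$2$1 * A$2$2 + A$3$1 * A$3$2)"
    unfolding p_q_r_def s_def by (simp add: power2_eq_square algebra_simps)
  then have pq: "p * q = s * (A$1$2 + A$2$1)"
    unfolding e(13,19) e(2,4)[symmetric] by simp
  have "p * r - s * (A$1$3 + A$3$1) = ((A$2$1 * A$3$2 - A$2$2 * A$3$1) - A$1$3) + ((A$1$2 * A$2$3 - A$1$3 * A$2$2) - A$3$1)
      - (A$1$1 * A$3$1 + A$1$2 * A$3$2 + A$1$3 * A$3$3) - (A$1$1 * A$1$3 + A$2$1 * A$2$3 + A$3$1 * A$3$3)"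
    unfolding p_q_r_def s_def by (simp add: power2_eq_square algebra_simps)
  then have pr: "p * r = s * (A$1$3 + A$3$1)"
    unfolding e(14,20) e(3,7)[symmetric] by simp
  have "q * r - s * (A$2$3 + A$3$2) = ((A$1$2 * A$3$1 - A$1$1 * A$3$2) - A$2$3) + ((A$1$3 * A$2$1 - A$1$1 * A$2$3) - A$3$2)
      - (A$2$1 * A$3$1 + A$2$2 * A$3$2 + A$2$3 * A$3$3) - (A$1$2 * A$1$3 + A$2$2 * A$2$3 + A$3$2 * A$3$3)"
    unfolding p_q_r_def s_def by (simp add: power2_eq_square algebra_simps)
  then have qr: "q * r = s * (A$2$3 + A$3$2)"
    unfolding e(15,21) e(6,8)[symmetric] by simp
  have "s\<^sup>2 + p\<^sup>2 + q\<^sup>2 + r\<^sup>2 = 4 * s"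
    unfolding pp qq rr by (simp add: s_def power2_eq_square algebra_simps)
  moreover have "1 + ((1/s) *\<^sub>R vector [p, q, r] :: real^3) \<bullet> ((1/s) *\<^sub>R vector [p, q, r])
      = (s\<^sup>2 + p\<^sup>2 + q\<^sup>2 + r\<^sup>2) / s\<^sup>2"
    using s0 by (simp add: mat3_simps power2_eq_square field_simps)
  ultimately have N: "1 + ((1/s) *\<^sub>R vector [p, q, r] :: real^3) \<bullet> ((1/s) *\<^sub>R vector [p, q, r]) = 4 / s"
    using s0 by (simp add: power2_eq_square)
  have "quat_matrix 1 ((1/s) *\<^sub>R vector [p, q, r]) = (1/s)\<^sup>2 *\<^sub>R quat_matrix s (vector [p, q, r])"
    using quat_matrix_scale[of "1/s" s "vector [p, q, r]"] s0 by simp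
  then have "cayley (cayley_inv A) = (1 / (4 * s)) *\<^sub>R quat_matrix s (vector [p, q, r])"
    unfolding cayley_def inv N using s0 by (simp add: power2_eq_square)
  also have "quat_matrix s (vector [p, q, r]) = (4 * s) *\<^sub>R A"
    unfolding quat_matrix_def using pp qq rr pq pr qr
    by (simp add: mat3_simps) (simp add: s_def p_q_r_def power2_eq_square algebra_simps)
  finally show ?thesis
    using s0 by simp
qed

text \<open>The product of the quaternions \<open>1 + u\<close> and \<open>1 + x\<close>, rescaled to real part 1.\<close>

definition rodrigues :: "real^3 \<Rightarrow> real^3 \<Rightarrow> real^3"
  where "rodrigues u x = (1 / (1 - u \<bullet> x)) *\<^sub>R (u + x + cross3 u x)"

lemma cayley_rodrigues:
  assumes "u \<bullet> x \<noteq> 1"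
  shows "cayley (rodrigues u x) = cayley u ** cayley x"
proof -
  define d where "d = 1 - u \<bullet> x"
  have d: "d \<noteq> 0"
    using assms by (simp add: d_def)
  have "cayley u ** cayley x = (1 / ((1 + u \<bullet> u) * (1 + x \<bullet> x))) *\<^sub>R (quat_matrix 1 u ** quat_matrix 1 x)"
    by (simp add: cayley_def matrix_scalar_ac flip: scalar_matrix_assoc)
  also have "quat_matrix 1 u ** quat_matrix 1 x = quat_matrix d (d *\<^sub>R rodrigues u x)"
    using d by (simp add: quat_matrix_mult rodrigues_def d_def add_ac)
  also have "\<dots> = d\<^sup>2 *\<^sub>R quat_matrix 1 (rodrigues u x)"
    using quat_matrix_scale[of d 1] by simp
  also have "(1 + u \<bullet> u) * (1 + x \<bullet> x) = d\<^sup>2 * (1 + rodrigues u x \<bullet> rodrigues u x)"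
  proof -
    define z where "z = u + x + cross3 u x"
    have "rodrigues u x \<bullet> rodrigues u x = (1 / d)\<^sup>2 * (z \<bullet> z)"
      by (simp add: rodrigues_def z_def d_def power2_eq_square)
    then have "d\<^sup>2 * (1 + rodrigues u x \<bullet> rodrigues u x) = d\<^sup>2 + z \<bullet> z"
      using d by (simp add: field_simps)
    then show ?thesis
      using quat_norm_mult[of 1 1 u x] by (simp add: d_def z_def add_ac)
  qed
  finally show ?thesis
    using d by (simp add: cayley_def)
qed

lemma rodrigues_0: "rodrigues u 0 = u"
  by (simp add: rodrigues_def)

text \<open>In the homotopy from the identity \<open>rodrigues u 0 = u\<close> to the translation \<open>rodrigues u x\<close>,
  only points in the ball of radius \<open>norm x\<close> ever pass through \<open>x\<close>.\<close>

lemma norm_le_of_rodrigues: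
  assumes eq: "rodrigues u (t *\<^sub>R x) = x" and t: "t \<in> {0..1}" and ne: "u \<bullet> (t *\<^sub>R x) \<noteq> 1"
  shows "norm u \<le> norm x"
proof -
  define m where "m = 1 - t - t * (u \<bullet> x)"
  have "(1 - u \<bullet> (t *\<^sub>R x)) *\<^sub>R rodrigues u (t *\<^sub>R x) = u + t *\<^sub>R x + cross3 u (t *\<^sub>R x)"
    using ne by (simp add: rodrigues_def)
  then have "u + t *\<^sub>R x + cross3 u (t *\<^sub>R x) = (1 - t * (u \<bullet> x)) *\<^sub>R x"
    unfolding eq by simp
  then have vec: "u + t *\<^sub>R cross3 u x = m *\<^sub>R x"
    by (simp add: m_def cross_mult_right algebra_simps)
  have "(u + t *\<^sub>R cross3 u x) \<bullet> x = u \<bullet> x"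
    by (simp add: inner_add_left dot_cross_self)
  then have s: "u \<bullet> x = m * (x \<bullet> x)"
    unfolding vec by simp
  have "m = 1 - t - t * (m * (x \<bullet> x))"
    using m_def unfolding s .
  then have mm: "m * (1 + t * (x \<bullet> x)) = 1 - t"
    by (simp add: algebra_simps)
  have pos: "1 + t * (x \<bullet> x) \<ge> 1"
    using t by simp
  have "m \<ge> 0"
  proof (rule ccontr)
    assume "\<not> m \<ge> 0"
    then have "m * (1 + t * (x \<bullet> x)) < 0"
      using pos by (intro mult_neg_pos) auto
    then show False
      using mm t by simp
  qed
  moreover have "m \<le> 1"
  proof -
    have "m * 1 \<le> m * (1 + t * (x \<bullet> x))"
      using \<open>m \<ge> 0\<close> pos by (rule mult_left_mono[rotated])
    then show ?thesis
      using mm t by simp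
  qed
  ultimately have "m\<^sup>2 \<le> 1"
    by (simp add: abs_square_le_1)
  have "(u + t *\<^sub>R cross3 u x) \<bullet> (u + t *\<^sub>R cross3 u x) = u \<bullet> u + t\<^sup>2 * (cross3 u x \<bullet> cross3 u x)"
    by (simp add: inner_add_left inner_add_right dot_cross_self power2_eq_square)
  then have "u \<bullet> u + t\<^sup>2 * (cross3 u x \<bullet> cross3 u x) = m\<^sup>2 * (x \<bullet> x)"
    unfolding vec by (simp add: power2_eq_square)
  moreover have "t\<^sup>2 * (cross3 u x \<bullet> cross3 u x) \<ge> 0"
    by simp
  moreover have "m\<^sup>2 * (x \<bullet> x) \<le> 1 * (x \<bullet> x)"
    using \<open>m\<^sup>2 \<le> 1\<close> by (rule mult_right_mono) simp
  ultimately have "u \<bullet> u \<le> x \<bullet> x"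
    by linarith
  then show ?thesis
    by (simp add: norm_le)
qed

lemma rodrigues_small:
  assumes r: "r \<le> 1 / 2" and u: "norm u < r" and x: "norm x < r"
  shows "u \<bullet> x < 1" "norm (rodrigues u x) < 4 * r"
proof -
  have "norm u * norm x \<le> (1 / 2) * norm x"
    using u r by (intro mult_right_mono) auto
  then have ux: "norm u * norm x \<le> (1 / 2) * r" "norm u * norm x \<le> 1 / 4"
    using x r by linarith+
  have "\<bar>u \<bullet> x\<bar> \<le> 1 / 4"
    using Cauchy_Schwarz_ineq2[of u x] ux(2) by linarith
  then show "u \<bullet> x < 1"
    by linarith
  have d: "1 - u \<bullet> x \<ge> 3 / 4"
    using \<open>\<bar>u \<bullet> x\<bar> \<le> 1 / 4\<close> by linarith
  have "(norm (cross3 u x))\<^sup>2 \<le> (norm u * norm x)\<^sup>2"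
    using norm_cross_dot[of u x] zero_le_power2[of "u \<bullet> x"] by linarith
  then have "norm (cross3 u x) \<le> norm u * norm x"
    by (rule power2_le_imp_le) simp
  then have "norm (u + x + cross3 u x) < 3 * r"
    using norm_triangle_ineq[of "u + x" "cross3 u x"] norm_triangle_ineq[of u x] norm_ge_zero[of u] u x ux(1)
    by linarith
  moreover have "norm (rodrigues u x) * (1 - u \<bullet> x) = norm (u + x + cross3 u x)"
    using d by (simp add: rodrigues_def)
  moreover have "norm (rodrigues u x) * (3 / 4) \<le> norm (rodrigues u x) * (1 - u \<bullet> x)"
    using d by (rule mult_left_mono) simp
  ultimately show "norm (rodrigues u x) < 4 * r"
    by linarith
qed

lemma SO3_inner: "h \<in> carrier SO3 \<Longrightarrow> (h *v x) \<bullet> (h *v y) = x \<bullet> y"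
  by (metis carrier_SO3 dot_lmul_matrix matrix_mul_assoc matrix_vector_mul_assoc matrix_vector_mul_lid inner_commute transpose_matrix_vector vector_transpose_matrix)

lemma SO3_norm: "h \<in> carrier SO3 \<Longrightarrow> norm (h *v x) = norm x"
  by (simp add: norm_eq_sqrt_inner SO3_inner)

lemma SO3_transpose:
  assumes "h \<in> carrier SO3"
  shows "transpose h \<in> carrier SO3" "transpose h ** h = mat 1" "h ** transpose h = mat 1"
  using assms by (auto simp: SO3_def rotation_matrix_def orthogonal_matrix_def)

lemma inv_SO3: "A \<in> carrier SO3 \<Longrightarrow> inv\<^bsub>SO3\<^esub> A = transpose A"
  using group.inv_equality[OF group_SO3, of "transpose A" A] SO3_transpose[of A] by (simp add: SO3_def)

lemma SO3_mult: "A \<in> carrier SO3 \<Longrightarrow> B \<in> carrier SO3 \<Longrightarrow> A ** B \<in> carrier SO3"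
  using subgroup.m_closed[OF group.subgroup_self[OF group_SO3], of A B] by (simp add: SO3_def)

lemma SO3_cancel:
  assumes "A \<in> carrier SO3"
  shows "transpose A ** (A ** B) = B" "A ** (transpose A ** B) = B"
    "B ** transpose A ** A = B" "B ** A ** transpose A = B"
  using SO3_transpose[OF assms] by (simp_all add: matrix_mul_assoc flip: matrix_mul_assoc[of B])

lemma cayley_conj:
  assumes h: "h \<in> carrier SO3"
  shows "cayley (h *v x) = h ** cayley x ** transpose h"
proof -
  have cay: "cayley x *v y = (1 / (1 + x \<bullet> x)) *\<^sub>R ((1 - x \<bullet> x) *\<^sub>R y + 2 *\<^sub>R cross3 x y + (2 * (x \<bullet> y)) *\<^sub>R x)" for x y
    by (simp add: cayley_def scaleR_matrix_vector_assoc[symmetric] quat_matrix_vector)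
  have rot: "rotation_matrix h"
    using h by (simp add: SO3_def)
  have "cayley (h *v x) *v (h *v z) = h *v (cayley x *v z)" for z
    unfolding cay SO3_inner[OF h] cross_rotation_matrix[OF rot]
    by (simp add: matrix_vector_right_distrib matrix_vector_mult_scaleR)
  then have "cayley (h *v x) ** h = h ** cayley x"
    by (simp add: matrix_eq flip: matrix_vector_mul_assoc)
  then have "cayley (h *v x) ** h ** transpose h = h ** cayley x ** transpose h"
    by simp
  then show ?thesis
    by (simp add: SO3_transpose[OF h] flip: matrix_mul_assoc)
qed

text \<open>Rotations by a half turn escape the Cayley map. They are first multiplied by a half turn
  about a coordinate axis: if \<open>trace h = -1\<close>, the traces of the three products add up to 1, so
  one of them differs from \<open>-1\<close>. The sign of \<open>w\<close> is at our disposal because \<open>q\<close> and \<open>-q\<close> give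
  the same rotation.\<close>

lemma SO3_quat:
  assumes h: "h \<in> carrier SO3"
  obtains w x where "w \<ge> 0" "w\<^sup>2 + x \<bullet> x = 1" "h = quat_matrix w x"
proof -
  have gen: "\<exists>w x. w\<^sup>2 + x \<bullet> x = 1 \<and> g = quat_matrix w x" if g: "g \<in> carrier SO3" "trace g \<noteq> -1" for g
    using cayley_cayley_inv[OF g] cayley_eq_quat[of "cayley_inv g"] cayley_quat_unit[of "cayley_inv g"] by metis
  have "\<exists>w x. w\<^sup>2 + x \<bullet> x = 1 \<and> h = quat_matrix w x"
  proof (cases "trace h = -1")
    case True
    define D where "D i = quat_matrix 0 (axis i 1)" for i
    have DD: "D i ** D i = mat 1" for i
      using exhaust_3[of i] by (auto simp: D_def quat_matrix_def mat3_simps axis_def)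
    have DSO: "D i \<in> carrier SO3" for i
      unfolding D_def by (rule quat_matrix_SO3) (simp add: inner_axis_axis)
    have "trace (D 1 ** h) + trace (D 2 ** h) + trace (D 3 ** h) = - trace h"
      by (simp add: D_def quat_matrix_def mat3_simps axis_def trace_def)
    then obtain i where i: "trace (D i ** h) \<noteq> -1"
      using True by force
    \<comment> \<open>\<open>D i ** h\<close> has a quaternion by the first case, and \<open>D i\<close> is its own inverse.\<close>
    have "D i ** h \<in> carrier SO3"
      using group.subgroup_self[OF group_SO3, THEN subgroup.m_closed, OF DSO h] by (simp add: SO3_def)
    then obtain w x where wx: "w\<^sup>2 + x \<bullet> x = 1" "D i ** h = quat_matrix w x"
      using gen i by blast
    have "h = D i ** (D i ** h)"
      by (simp add: matrix_mul_assoc DD)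
    then have h_eq: "h = quat_matrix (0 * w - axis i 1 \<bullet> x) (0 *\<^sub>R x + w *\<^sub>R axis i 1 + cross3 (axis i 1) x)"
      unfolding wx(2) by (simp add: D_def quat_matrix_mult)
    have "(0 * w - axis i 1 \<bullet> x)\<^sup>2 + (0 *\<^sub>R x + w *\<^sub>R axis i 1 + cross3 (axis i 1) x) \<bullet> (0 *\<^sub>R x + w *\<^sub>R axis i 1 + cross3 (axis i 1) x) = 1"
      using quat_norm_mult[of 0 w "axis i 1" x] wx(1) by (simp add: inner_axis_axis)
    with h_eq show ?thesis
      by blast
  qed (use gen h in blast)
  then obtain w x where wx: "w\<^sup>2 + x \<bullet> x = 1" "h = quat_matrix w x"
    by blast
  show thesis
  proof (cases "w \<ge> 0")
    case False
    have "h = quat_matrix (-w) (-x)"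
      using quat_matrix_scale[of "-1" w x] wx(2) by simp
    then show thesis
      using False wx(1) that[of "-w" "-x"] by simp
  qed (use wx that in blast)
qed

text \<open>The segment from 1 to a unit quaternion with nonnegative real part avoids 0, so along it
  \<open>quat_matrix\<close> is a nonzero multiple of a rotation and maps no nonzero vector to 0.\<close>

lemma SO3_homotopic_id:
  assumes h: "h \<in> carrier SO3"
  shows "homotopic_with (\<lambda>f. f \<in> UNIV - {0} \<rightarrow> UNIV - {0}) euclidean euclidean id (\<lambda>v. h *v v)"
proof -
  obtain w x where wx: "w \<ge> 0" "w\<^sup>2 + x \<bullet> x = 1" "h = quat_matrix w x"
    using SO3_quat[OF h] .
  define k where "k t v = quat_matrix (1 - t + t * w) (t *\<^sub>R x) *v v" for t and v :: "real^3"
  have pos: "(1 - t + t * w)\<^sup>2 + (t *\<^sub>R x) \<bullet> (t *\<^sub>R x) > 0" if "t \<in> {0..1}" for t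
  proof (cases "t = 1")
    case False
    then have "1 - t + t * w > 0"
      using that wx(1) by (simp add: add_pos_nonneg)
    then have "(1 - t + t * w)\<^sup>2 > 0"
      by simp
    moreover have "(t *\<^sub>R x) \<bullet> (t *\<^sub>R x) \<ge> 0"
      by (rule inner_ge_zero)
    ultimately show ?thesis
      by linarith
  qed (use wx(2) in auto)
  show ?thesis
    unfolding homotopic_with_def
  proof (intro exI[of _ "\<lambda>(t, v). k t v"] conjI allI ballI)
    have "continuous_on ({0..1} \<times> UNIV) (\<lambda>(t, v). k t v)"
      unfolding k_def quat_matrix_vector split_beta by (intro continuous_intros continuous_on_cross)
    then show "continuous_map (prod_topology (top_of_set {0..1}) euclidean) euclidean (\<lambda>(t, v). k t v)"
      using prod_topology_subtopology_eu[of "{0..1::real}" "UNIV :: (real^3) set"] by simp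
    show "(\<lambda>v. (case (t, v) of (t, v) \<Rightarrow> k t v)) \<in> UNIV - {0} \<rightarrow> UNIV - {0}" if "t \<in> {0..1}" for t
    proof -
      have "k t v \<noteq> 0" if "v \<noteq> 0" for v
      proof -
        have "norm (k t v) > 0"
          unfolding k_def norm_quat_matrix_vector using pos[OF \<open>t \<in> {0..1}\<close>] that by simp
        then show ?thesis
          by auto
      qed
      then show ?thesis
        by auto
    qed
  qed (simp_all add: k_def quat_matrix_1_0 wx(3))
qed

lemma SO3_fixed_points_line:
  assumes h: "h \<in> carrier SO3" "h \<noteq> mat 1"
  obtains a where "{v. h *v v = v} = span {a}"
proof -
  obtain w x where wx: "w\<^sup>2 + x \<bullet> x = 1" "h = quat_matrix w x"
    using SO3_quat[OF h(1)] .
  have x: "x \<noteq> 0"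
  proof
    assume "x = 0"
    then have "h = mat 1"
      using wx quat_matrix_scale[of w 1 0] by (simp add: quat_matrix_1_0)
    then show False
      using h(2) by simp
  qed
  have "v \<in> span {x}" if v: "h *v v = v" for v
  proof -
    have "(w\<^sup>2 - x \<bullet> x) *\<^sub>R v + (2 * w) *\<^sub>R cross3 x v + (2 * (x \<bullet> v)) *\<^sub>R x = (w\<^sup>2 + x \<bullet> x) *\<^sub>R v"
      using v wx by (simp add: quat_matrix_vector)
    then have "((w\<^sup>2 - x \<bullet> x) *\<^sub>R v + (2 * w) *\<^sub>R cross3 x v + (2 * (x \<bullet> v)) *\<^sub>R x) \<bullet> v = ((w\<^sup>2 + x \<bullet> x) *\<^sub>R v) \<bullet> v"
      by simp
    then have "(x \<bullet> v)\<^sup>2 = (x \<bullet> x) * (v \<bullet> v)"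
      by (simp add: inner_add_left dot_cross_self algebra_simps power2_eq_square)
    then have "(norm (cross3 x v))\<^sup>2 = 0"
      using norm_cross_dot[of x v] by (simp add: power_mult_distrib power2_norm_eq_inner)
    then have "cross3 x (cross3 x v) = 0"
      by simp
    moreover have "cross3 x (cross3 x v) = (x \<bullet> v) *\<^sub>R x - (x \<bullet> x) *\<^sub>R v"
      by (simp add: mat3_simps) (simp add: algebra_simps)
    ultimately have "(x \<bullet> x) *\<^sub>R v = (x \<bullet> v) *\<^sub>R x"
      by simp
    then have "(1 / (x \<bullet> x)) *\<^sub>R (x \<bullet> x) *\<^sub>R v = (1 / (x \<bullet> x)) *\<^sub>R (x \<bullet> v) *\<^sub>R x"
      by simp
    then have "v = ((x \<bullet> v) / (x \<bullet> x)) *\<^sub>R x"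
      using x by simp
    then show ?thesis
      by (simp add: span_singleton)
  qed
  moreover have "h *v v = v" if "v \<in> span {x}" for v
  proof -
    obtain c where "v = c *\<^sub>R x"
      using \<open>v \<in> span {x}\<close> by (auto simp: span_singleton)
    moreover have "h *v x = (w\<^sup>2 + x \<bullet> x) *\<^sub>R x"
      unfolding wx(2) quat_matrix_vector by (simp flip: scaleR_add_left)
    ultimately show ?thesis
      by (simp add: matrix_vector_mult_scaleR wx(1))
  qed
  ultimately show thesis
    using that[of x] by blast
qed

lemma rotation_axes:
  assumes H: "finite H" "\<And>h. h \<in> H \<Longrightarrow> h \<in> carrier SO3"
  obtains L where "finite L" "\<And>x. x \<in> (\<Union>a\<in>L. span {a}) \<longleftrightarrow> (\<exists>h\<in>H. h *v x = x \<and> h \<noteq> mat 1)"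
proof -
  have "\<forall>g\<in>H - {mat 1}. \<exists>a. {x. g *v x = x} = span {a}"
  proof
    fix g assume "g \<in> H - {mat 1}"
    then have "g \<in> carrier SO3" "g \<noteq> mat 1"
      using H(2) by auto
    then show "\<exists>a. {x. g *v x = x} = span {a}"
      by (rule SO3_fixed_points_line) blast
  qed
  then obtain ax where ax: "\<forall>g\<in>H - {mat 1}. {x. g *v x = x} = span {ax g}"
    by (rule bchoice[THEN exE])
  show thesis
  proof (rule that)
    show "finite (ax ` (H - {mat 1}))"
      using H(1) by blast
    fix x
    have "x \<in> (\<Union>a\<in>ax ` (H - {mat 1}). span {a}) \<longleftrightarrow> (\<exists>h\<in>H - {mat 1}. x \<in> span {ax h})"
      by blast
    also have "\<dots> \<longleftrightarrow> (\<exists>h\<in>H - {mat 1}. x \<in> {x. h *v x = x})"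
      using ax by (intro bex_cong refl) simp
    finally show "x \<in> (\<Union>a\<in>ax ` (H - {mat 1}). span {a}) \<longleftrightarrow> (\<exists>h\<in>H. h *v x = x \<and> h \<noteq> mat 1)"
      by blast
  qed
qed

section \<open>Avoiding finitely many lines in space\<close>

lemma negligible_span_pair: "negligible (span {a, b :: real^3})"
proof (rule negligible_lowdim)
  have "dim {a, b} \<le> card {a, b}"
    by (rule dim_le_card') simp
  also have "\<dots> \<le> 2"
    by (simp add: card_insert_if)
  finally show "dim (span {a, b}) < DIM(real^3)"
    by simp
qed

lemma avoid_planes:
  fixes W :: "(real^3) set"
  assumes "finite P" "open W" "W \<noteq> {}"
  obtains x where "x \<in> W" "\<And>a b. (a, b) \<in> P \<Longrightarrow> x \<notin> span {a, b}"
proof -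
  have "negligible (\<Union>p\<in>P. span {fst p, snd p})"
    using assms(1) negligible_span_pair by (intro negligible_Union) auto
  then have "\<not> W \<subseteq> (\<Union>p\<in>P. span {fst p, snd p})"
    using assms(2,3) open_not_negligible negligible_subset by blast
  then obtain x where x: "x \<in> W" "x \<notin> (\<Union>p\<in>P. span {fst p, snd p})"
    by blast
  show thesis
  proof (rule that[OF x(1)])
    fix a b assume "(a, b) \<in> P"
    then show "x \<notin> span {a, b}"
      using x(2) by force
  qed
qed

lemma avoid_lines:
  fixes W :: "(real^3) set"
  assumes "finite L" "open W" "W \<noteq> {}"
  obtains x where "x \<in> W" "\<And>a. a \<in> L \<Longrightarrow> x \<notin> span {a}"
proof -
  obtain x where x: "x \<in> W" "\<And>a b. (a, b) \<in> (\<lambda>a. (a, a)) ` L \<Longrightarrow> x \<notin> span {a, b}"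
    using avoid_planes[of "(\<lambda>a. (a, a)) ` L" W] assms by blast
  show thesis
  proof (rule that[OF x(1)])
    fix a assume "a \<in> L"
    then show "x \<notin> span {a}"
      using x(2)[of a a] by auto
  qed
qed

text \<open>Two points \<open>p\<close> and \<open>q\<close> are joined through a point \<open>c\<close> outside the planes spanned by \<open>p\<close> or
  \<open>q\<close> and one of the lines: if the segment from \<open>p\<close> to \<open>c\<close> met a line, then \<open>c\<close> would lie in the
  plane of \<open>p\<close> and that line.\<close>

lemma connected_convex_open_minus_lines:
  fixes W :: "(real^3) set"
  assumes L: "finite L" and W: "open W" "convex W"
  shows "connected (W - (\<Union>a\<in>L. span {a}))"
  unfolding connected_iff_connected_component
proof (intro ballI)
  let ?S = "W - (\<Union>a\<in>L. span {a})"
  fix p q assume p: "p \<in> ?S" and q: "q \<in> ?S"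
  obtain c where c: "c \<in> W" "\<And>a b. (a, b) \<in> {p, q} \<times> L \<Longrightarrow> c \<notin> span {a, b}"
    using avoid_planes[of "{p, q} \<times> L" W] L W p by blast
  have seg: "closed_segment z c \<subseteq> ?S" if z: "z \<in> {p, q}" for z
  proof
    fix u assume u: "u \<in> closed_segment z c"
    have zS: "z \<in> ?S"
      using z p q by blast
    then have "u \<in> W"
      using u W(2) c(1) closed_segment_subset by blast
    moreover have "u \<notin> span {a}" if a: "a \<in> L" for a
    proof
      assume ua: "u \<in> span {a}"
      obtain t where t: "u = (1 - t) *\<^sub>R z + t *\<^sub>R c"
        using u by (auto simp: in_segment)
      have "t \<noteq> 0"
        using t ua a zS by auto
      then have "c = (1/t) *\<^sub>R (u - (1 - t) *\<^sub>R z)"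
        unfolding t by simp
      moreover have "u \<in> span {z, a}" "z \<in> span {z, a}"
        using ua span_mono[of "{a}" "{z, a}"] by (auto intro: span_base)
      ultimately have "c \<in> span {z, a}"
        by (simp add: span_diff span_mul)
      then show False
        using c(2) z a by blast
    qed
    ultimately show "u \<in> ?S"
      by blast
  qed
  have "connected (closed_segment p c \<union> closed_segment q c)"
    by (intro connected_Un) auto
  moreover have "closed_segment p c \<union> closed_segment q c \<subseteq> ?S"
    using seg by blast
  ultimately show "connected_component ?S p q"
    unfolding connected_component_def by (meson UnI1 UnI2 ends_in_segment(1))
qed

section \<open>The Hopf map\<close>

text \<open>In complex notation this is the pair of \<open>2 z\<^sup>* w\<close> and \<open>|z|\<^sup>2 - |w|\<^sup>2\<close> for \<open>v = (z, w)\<close>,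
  with \<open>z\<^sup>*\<close> the conjugate of \<open>z\<close>. Real and imaginary parts are written out so that the
  identities below become polynomial identities in real variables.\<close>

definition hopf :: "complex \<times> complex \<Rightarrow> real^3"
  where "hopf v = vector
    [2 * (Re (fst v) * Re (snd v) + Im (fst v) * Im (snd v)),
     2 * (Re (fst v) * Im (snd v) - Im (fst v) * Re (snd v)),
     (Re (fst v))\<^sup>2 + (Im (fst v))\<^sup>2 - (Re (snd v))\<^sup>2 - (Im (snd v))\<^sup>2]"

definition cscale :: "complex \<Rightarrow> complex \<times> complex \<Rightarrow> complex \<times> complex"
  where "cscale c v = (c * fst v, c * snd v)"

definition su2 :: "complex \<Rightarrow> complex \<Rightarrow> complex \<times> complex \<Rightarrow> complex \<times> complex"
  where "su2 \<alpha> \<beta> v = (\<alpha> * fst v - cnj \<beta> * snd v, \<beta> * fst v + cnj \<alpha> * snd v)"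

text \<open>The double cover of \<open>SO(3)\<close> by \<open>SU(2)\<close>: the Hopf map intertwines the two actions.\<close>

lemma hopf_su2:
  "hopf (su2 (Complex w (- x$3)) (Complex (x$2) (- x$1)) v) = quat_matrix w x *v hopf v"
  by (simp add: hopf_def su2_def quat_matrix_def mat3_simps power2_eq_square) (simp add: algebra_simps)

lemma norm_hopf: "norm (hopf v) = (norm v)\<^sup>2"
proof -
  obtain a b c d where v: "v = (Complex a b, Complex c d)"
    by (metis complex_surj prod.collapse)
  have "hopf v \<bullet> hopf v = ((norm v)\<^sup>2)\<^sup>2"
    by (simp add: v hopf_def mat3_simps norm_Pair cmod_power2) (simp add: power2_eq_square algebra_simps)
  then show ?thesis
    by (simp add: norm_eq_sqrt_inner)
qed

lemma hopf_cscale: "hopf (cscale c v) = (cmod c)\<^sup>2 *\<^sub>R hopf v"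
  unfolding cmod_power2
  by (simp add: hopf_def cscale_def mat3_simps power2_eq_square) (simp add: algebra_simps)

lemma hopf_eq_imp:
  assumes "hopf v = hopf v'"
  obtains c where "cmod c = 1" "v' = cscale c v"
proof -
  obtain z w where v: "v = (z, w)" by force
  obtain z' w' where v': "v' = (z', w')" by force
  have "(norm v)\<^sup>2 = (norm v')\<^sup>2"
    using assms by (metis norm_hopf)
  then have 1: "(cmod z)\<^sup>2 + (cmod w)\<^sup>2 = (cmod z')\<^sup>2 + (cmod w')\<^sup>2"
    by (simp add: v v' norm_Pair)
  have "hopf v $ i = hopf v' $ i" for i
    using assms by simp
  from this[of 1] this[of 2] this[of 3]
  have 2: "cnj z * w = cnj z' * w'" "(cmod z)\<^sup>2 - (cmod w)\<^sup>2 = (cmod z')\<^sup>2 - (cmod w')\<^sup>2"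
    by (simp_all add: v v' hopf_def complex_eq_iff cmod_power2)
  have "(cmod z)\<^sup>2 = (cmod z')\<^sup>2" "(cmod w)\<^sup>2 = (cmod w')\<^sup>2"
    using 1 2(2) by linarith+
  then have n: "cmod z = cmod z'" "cmod w = cmod w'"
    by (simp_all add: power2_eq_iff_nonneg)
  show thesis
  proof (cases "z = 0")
    case False
    have "z' \<noteq> 0"
      using False n(1) by (metis norm_eq_zero)
    have "cnj z' * w' * z = cnj z * w * z"
      using 2(1) by simp
    also have "cnj z * w * z = w * (cnj z' * z')"
      using complex_norm_square[of z] complex_norm_square[of z'] n(1) by (simp add: mult_ac)
    finally have "w' * z = w * z'"
      using \<open>z' \<noteq> 0\<close> by (simp add: mult_ac)
    then have "v' = cscale (z' / z) v"
      using False by (simp add: v v' cscale_def field_simps)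
    moreover have "cmod (z' / z) = 1"
      using False n(1) \<open>z' \<noteq> 0\<close> by (simp add: norm_divide)
    ultimately show thesis
      using that by blast
  next
    case True
    then have "z' = 0"
      using n by simp
    show thesis
    proof (cases "w = 0")
      case True
      then show thesis
        using that[of 1] n \<open>z = 0\<close> \<open>z' = 0\<close> by (simp add: v v' cscale_def)
    next
      case False
      then have "w' \<noteq> 0"
        using n(2) by (metis norm_eq_zero)
      then show thesis
        using False that[of "w' / w"] n \<open>z = 0\<close> \<open>z' = 0\<close> by (simp add: v v' cscale_def norm_divide)
    qed
  qed
qed

lemma hopf_surj:
  obtains v where "hopf v = y"
proof -
  have n: "(norm y)\<^sup>2 = (y$1)\<^sup>2 + (y$2)\<^sup>2 + (y$3)\<^sup>2"
    unfolding power2_norm_eq_inner by (simp add: mat3_simps power2_eq_square)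
  have ge: "norm y + y$3 \<ge> 0"
    using component_le_norm_cart[of y 3] by linarith
  define r where "r = sqrt ((norm y + y$3) / 2)"
  have r2: "r\<^sup>2 = (norm y + y$3) / 2"
    using ge by (simp add: r_def)
  show thesis
  proof (cases "r = 0")
    case True
    then have "y$3 = - norm y"
      using r2 by simp
    then have "y$1 = 0" "y$2 = 0"
      using n by (simp_all add: sum_power2_eq_zero_iff)
    then have "hopf (0, of_real (sqrt (norm y))) = y"
      using \<open>y$3 = - norm y\<close> by (simp add: hopf_def vec_eq_iff forall_3)
    then show thesis
      by (rule that)
  next
    case False
    define w where "w = Complex (y$1 / (2 * r)) (y$2 / (2 * r))"
    have "(cmod w)\<^sup>2 * (4 * r\<^sup>2) = (y$1)\<^sup>2 + (y$2)\<^sup>2"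
      using False by (simp add: w_def cmod_power2 power_divide power_mult_distrib distrib_right)
    also have "\<dots> = (norm y - y$3) * (norm y + y$3)"
      using n by (simp add: power2_eq_square algebra_simps)
    also have "\<dots> = (norm y - y$3) / 2 * (4 * r\<^sup>2)"
      unfolding r2 by simp
    finally have "(cmod w)\<^sup>2 = (norm y - y$3) / 2"
      using False by simp
    then have "r\<^sup>2 - ((Re w)\<^sup>2 + (Im w)\<^sup>2) = y$3"
      using r2 by (simp add: cmod_power2 field_simps)
    then have "hopf (of_real r, w) = y"
      using False by (simp add: hopf_def vec_eq_iff forall_3 w_def)
    then show thesis
      by (rule that)
  qed
qed

lemma continuous_on_hopf: "continuous_on S hopf"
proof -
  have "continuous_on S (\<lambda>v. hopf v $ i)" for i
    using exhaust_3[of i]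
    by (elim disjE; simp only: hopf_def vector_3; intro continuous_intros)
  then show ?thesis
    using continuous_on_vec_lambda[of S "\<lambda>i v. hopf v $ i"] by simp
qed

lemma proper_imp_closed_image:
  fixes f :: "'a::heine_borel \<Rightarrow> 'b::metric_space"
  assumes cont: "continuous_on UNIV f" and proper: "\<And>B. bounded B \<Longrightarrow> bounded (f -` B)"
    and C: "closed C"
  shows "closed (f ` C)"
  unfolding closed_sequential_limits
proof (intro allI impI, elim conjE)
  fix y l assume y: "\<forall>n. y n \<in> f ` C" "y \<longlonglongrightarrow> l"
  then have "\<forall>n. \<exists>x. x \<in> C \<and> y n = f x"
    by blast
  then obtain x where "\<forall>n. x n \<in> C \<and> y n = f (x n)"
    by (rule choice[THEN exE])
  then have x: "x n \<in> C" "y n = f (x n)" for n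
    by auto
  have "bounded (range y)"
    using y(2) convergent_imp_bounded by blast
  then have "bounded (f -` range y)"
    by (rule proper)
  then have "bounded (range x)"
  proof (rule bounded_subset)
    show "range x \<subseteq> f -` range y"
      by (auto simp flip: x(2))
  qed
  then obtain a r where r: "strict_mono r" "(x \<circ> r) \<longlonglongrightarrow> a"
    using bounded_imp_convergent_subsequence by blast
  have "a \<in> C"
    by (rule closed_sequentially[OF C _ r(2)]) (simp add: x(1))
  have "(\<lambda>n. f ((x \<circ> r) n)) \<longlonglongrightarrow> f a"
    by (rule isCont_tendsto_compose[OF _ r(2)]) (use cont in \<open>simp add: continuous_on_eq_continuous_at\<close>)
  moreover have "(\<lambda>n. f ((x \<circ> r) n)) \<longlonglongrightarrow> l"
    using LIMSEQ_subseq_LIMSEQ[OF y(2) r(1)] unfolding o_def x(2) .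
  ultimately have "l = f a"
    using LIMSEQ_unique by blast
  then show "l \<in> f ` C"
    using \<open>a \<in> C\<close> by blast
qed

lemma closed_hopf_image: "closed C \<Longrightarrow> closed (hopf ` C)"
proof (rule proper_imp_closed_image[OF continuous_on_hopf])
  fix B :: "(real^3) set" assume "bounded B"
  then obtain b where "b > 0" and b: "\<And>x. x \<in> B \<Longrightarrow> norm x \<le> b"
    by (auto simp: bounded_pos)
  have "norm v \<le> sqrt b" if "v \<in> hopf -` B" for v
    using b[of "hopf v"] that by (simp add: norm_hopf real_le_rsqrt)
  then show "bounded (hopf -` B)"
    unfolding bounded_iff by blast
qed

text \<open>The Hopf map is closed and its fibres are the phase orbits. Thus a closed set that is
  invariant under phases is the preimage of a closed set in space, and it is everything as soon
  as that closed set contains the complement of finitely many lines.\<close>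

lemma hopf_dense_induct:
  assumes L: "finite L" and cl: "closed {v. P v}"
    and gen: "\<And>v. (\<And>a. a \<in> L \<Longrightarrow> hopf v \<notin> span {a}) \<Longrightarrow> P v"
    and phase: "\<And>c v. cmod c = 1 \<Longrightarrow> P v \<Longrightarrow> P (cscale c v)"
  shows "P v"
proof -
  have "hopf ` {v. P v} = UNIV"
  proof (rule ccontr)
    assume "hopf ` {v. P v} \<noteq> UNIV"
    then have "open (- hopf ` {v. P v})" "- hopf ` {v. P v} \<noteq> {}"
      using closed_hopf_image[OF cl] by auto
    then obtain y where y: "y \<notin> hopf ` {v. P v}" "\<And>a. a \<in> L \<Longrightarrow> y \<notin> span {a}"
      using avoid_lines[OF L] by (metis ComplD)
    obtain u where u: "hopf u = y"
      using hopf_surj .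
    then have "P u"
      using y(2) by (intro gen) auto
    then show False
      using y(1) u by blast
  qed
  then obtain u where "P u" "hopf u = hopf v"
    by (metis UNIV_I imageE mem_Collect_eq)
  then show ?thesis
    using hopf_eq_imp phase by metis
qed

lemma hopf_pole: "fst u = 0 \<or> snd u = 0 \<Longrightarrow> hopf u \<in> span {axis 3 1}"
proof -
  assume "fst u = 0 \<or> snd u = 0"
  then have "hopf u = (hopf u $ 3) *\<^sub>R axis 3 1"
    by (auto simp: hopf_def vec_eq_iff forall_3 axis_def)
  then show ?thesis
    unfolding span_singleton by blast
qed

definition det2 :: "complex \<times> complex \<Rightarrow> complex \<times> complex \<Rightarrow> complex"
  where "det2 u v = fst u * snd v - snd u * fst v"

lemma det2_cscale: "det2 (cscale c u) v = c * det2 u v" "det2 u (cscale c v) = c * det2 u v"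
  by (simp_all add: det2_def cscale_def algebra_simps)

lemma det2_self: "det2 u u = 0"
  by (simp add: det2_def)

lemma det2_swap: "det2 u v = - det2 v u"
  by (simp add: det2_def)

lemma cscale_cscale: "cscale c (cscale d v) = cscale (c * d) v"
  by (simp add: cscale_def)

lemma det2_eq_0:
  assumes "det2 u v = 0" "u \<noteq> 0"
  obtains c where "v = cscale c u"
proof (cases "fst u = 0")
  case True
  then have "snd u \<noteq> 0"
    using assms(2) by (metis prod.collapse zero_prod_def)
  then have "v = cscale (snd v / snd u) u"
    using assms(1) True by (simp add: det2_def cscale_def prod_eq_iff)
  then show thesis
    by (rule that)
next
  case False
  then have "v = cscale (fst v / fst u) u"
    using assms(1) by (simp add: det2_def cscale_def prod_eq_iff field_simps)
  then show thesis
    by (rule that)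
qed

lemma det2_eq_0_span:
  assumes "det2 u v = 0" "u \<noteq> 0"
  shows "hopf v \<in> span {hopf u}"
  using det2_eq_0[OF assms] by (metis hopf_cscale span_base span_mul singletonI)

lemma det2_su2:
  assumes "(cmod \<alpha>)\<^sup>2 + (cmod \<beta>)\<^sup>2 = 1"
  shows "det2 (su2 \<alpha> \<beta> u) (su2 \<alpha> \<beta> v) = det2 u v"
proof -
  have "det2 (su2 \<alpha> \<beta> u) (su2 \<alpha> \<beta> v) = (\<alpha> * cnj \<alpha> + \<beta> * cnj \<beta>) * det2 u v"
    by (simp add: det2_def su2_def algebra_simps)
  also have "\<alpha> * cnj \<alpha> + \<beta> * cnj \<beta> = of_real ((cmod \<alpha>)\<^sup>2 + (cmod \<beta>)\<^sup>2)"
    by (simp only: complex_norm_square[symmetric] of_real_add)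
  finally show ?thesis
    using assms by simp
qed

section \<open>Quotients of space by finite rotation groups\<close>

text \<open>\<open>U h\<close> is either one of the two lifts of \<open>h\<close> to \<open>SU(2)\<close>. The choices need not be compatible
  with the multiplication: they are so up to phases, and phases disappear under absolute values
  and under the Hopf map.\<close>

locale lifted_rotation_group =
  fixes H :: "(real^3^3) set" and U :: "real^3^3 \<Rightarrow> complex \<times> complex \<Rightarrow> complex \<times> complex"
  assumes H: "subgroup H SO3" and fin: "finite H"
    and U_su2: "h \<in> H \<Longrightarrow> \<exists>\<alpha> \<beta>. (cmod \<alpha>)\<^sup>2 + (cmod \<beta>)\<^sup>2 = 1 \<and> U h = su2 \<alpha> \<beta>"
    and hopf_U: "h \<in> H \<Longrightarrow> hopf (U h v) = h *v hopf v"
begin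

lemma H_SO3: "h \<in> H \<Longrightarrow> h \<in> carrier SO3"
  using subgroup.mem_carrier[OF H] .

lemma H_mult: "h \<in> H \<Longrightarrow> k \<in> H \<Longrightarrow> h ** k \<in> H"
  using subgroup.m_closed[OF H] by (simp add: SO3_def)

lemma H_one: "mat 1 \<in> H"
  using subgroup.one_closed[OF H] by (simp add: SO3_def)

lemma H_transpose: "h \<in> H \<Longrightarrow> transpose h \<in> H"
  using subgroup.m_inv_closed[OF H] inv_SO3[OF H_SO3] by metis

lemma U_cscale: "h \<in> H \<Longrightarrow> U h (cscale c v) = cscale c (U h v)"
  using U_su2[of h] by (auto simp: su2_def cscale_def algebra_simps)

lemma det2_U: "h \<in> H \<Longrightarrow> det2 (U h u) (U h v) = det2 u v"
  using U_su2[of h] det2_su2 by metis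

lemma norm_U: "h \<in> H \<Longrightarrow> norm (U h v) = norm v"
  using norm_hopf[of "U h v"] norm_hopf[of v] hopf_U[of h v] SO3_norm[OF H_SO3, of h "hopf v"]
  by (simp add: power2_eq_iff_nonneg)

lemma U_eq_0_iff: "h \<in> H \<Longrightarrow> U h v = 0 \<longleftrightarrow> v = 0"
  using norm_U by (metis norm_eq_zero)

lemma U_mult:
  assumes "h \<in> H" "k \<in> H"
  obtains c where "cmod c = 1" "U h (U k v) = cscale c (U (h ** k) v)"
proof -
  have "hopf (U (h ** k) v) = hopf (U h (U k v))"
    using assms by (simp add: hopf_U H_mult matrix_vector_mul_assoc)
  then show thesis
    by (rule hopf_eq_imp) (rule that)
qed

lemma U_one:
  obtains c where "cmod c = 1" "U (mat 1) v = cscale c v"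
proof -
  have "hopf v = hopf (U (mat 1) v)"
    using hopf_U[OF H_one] by simp
  then show thesis
    by (rule hopf_eq_imp) (rule that)
qed

text \<open>A form of degree \<open>card H\<close> in each of the two vectors, whose zeros are the pairs of vectors
  that lie over the same orbit of lines.\<close>

definition orbit_form :: "complex \<times> complex \<Rightarrow> complex \<times> complex \<Rightarrow> complex"
  where "orbit_form v v' = (\<Prod>h\<in>H. det2 (U h v) v')"

lemma orbit_form_cscale:
  "orbit_form (cscale c v) v' = c ^ card H * orbit_form v v'"
  "orbit_form v (cscale c v') = c ^ card H * orbit_form v v'"
  by (simp_all add: orbit_form_def U_cscale det2_cscale prod.distrib)

lemma orbit_form_eq_0:
  assumes "orbit_form v v' = 0"
  obtains h where "h \<in> H" "det2 (U h v) v' = 0"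
  using assms fin by (auto simp: orbit_form_def)

text \<open>It is essential that \<open>c\<close> does not depend on \<open>v'\<close>: values at several \<open>v'\<close> then change by a
  common factor, which cancels in ratios.\<close>

lemma orbit_form_invariant:
  assumes k: "k \<in> H"
  obtains c where "cmod c = 1" "\<And>v'. orbit_form (U k v) v' = c * orbit_form v v'"
proof -
  have "\<forall>h\<in>H. \<exists>c. cmod c = 1 \<and> U h (U k v) = cscale c (U (h ** k) v)"
    using U_mult[OF _ k] by metis
  then obtain c where c: "\<forall>h\<in>H. cmod (c h) = 1 \<and> U h (U k v) = cscale (c h) (U (h ** k) v)"
    by (rule bchoice[THEN exE])
  have bij: "bij_betw (\<lambda>h. h ** k) H H"
    by (rule bij_betw_byWitness[where f' = "\<lambda>h. h ** transpose k"])
       (use k H_mult H_transpose SO3_transpose[OF H_SO3[OF k]] in \<open>auto simp flip: matrix_mul_assoc\<close>)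
  show thesis
  proof (rule that)
    show "cmod (\<Prod>h\<in>H. c h) = 1"
      using c by (simp flip: prod_norm)
    fix v'
    have "orbit_form (U k v) v' = (\<Prod>h\<in>H. c h * det2 (U (h ** k) v) v')"
      unfolding orbit_form_def using c by (intro prod.cong) (simp_all add: det2_cscale)
    also have "\<dots> = (\<Prod>h\<in>H. c h) * (\<Prod>h\<in>H. det2 (U (h ** k) v) v')"
      by (simp add: prod.distrib)
    also have "(\<Prod>h\<in>H. det2 (U (h ** k) v) v') = orbit_form v v'"
      unfolding orbit_form_def by (rule prod.reindex_bij_betw[OF bij])
    finally show "orbit_form (U k v) v' = (\<Prod>h\<in>H. c h) * orbit_form v v'" .
  qed
qed

lemma orbit_form_self: "orbit_form v v = 0"
proof -
  obtain c where "U (mat 1) v = cscale c v"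
    using U_one .
  then have "det2 (U (mat 1) v) v = 0"
    by (simp add: det2_cscale det2_self)
  then show ?thesis
    unfolding orbit_form_def using fin H_one by (intro prod_zero) auto
qed

lemma norm_orbit_form_swap: "cmod (orbit_form v v') = cmod (orbit_form v' v)"
proof -
  have bij: "bij_betw transpose H H"
    by (rule bij_betw_byWitness[where f' = transpose]) (use H_transpose in auto)
  have "cmod (det2 (U h v) v') = cmod (det2 (U (transpose h) v') v)" if h: "h \<in> H" for h
  proof -
    obtain c where c: "cmod c = 1" "U (transpose h) (U h v) = cscale c (U (transpose h ** h) v)"
      using U_mult[OF H_transpose[OF h] h] .
    obtain c' where c': "cmod c' = 1" "U (mat 1) v = cscale c' v"
      using U_one .
    have "det2 (U h v) v' = det2 (U (transpose h) (U h v)) (U (transpose h) v')"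
      using det2_U[OF H_transpose[OF h]] by simp
    also have "\<dots> = c * c' * det2 v (U (transpose h) v')"
      using c(2) c'(2) SO3_transpose(2)[OF H_SO3[OF h]] by (simp add: det2_cscale cscale_cscale)
    finally have "cmod (det2 (U h v) v') = cmod (det2 v (U (transpose h) v'))"
      using c(1) c'(1) by (simp add: norm_mult)
    then show ?thesis
      using det2_swap[of v] by simp
  qed
  then have "(\<Prod>h\<in>H. cmod (det2 (U h v) v')) = (\<Prod>h\<in>H. cmod (det2 (U (transpose h) v') v))"
    by (intro prod.cong) auto
  also have "\<dots> = (\<Prod>h\<in>H. cmod (det2 (U h v') v))"
    by (rule prod.reindex_bij_betw[OF bij])
  finally show ?thesis
    by (simp add: orbit_form_def flip: prod_norm)
qed

lemma continuous_on_U: "h \<in> H \<Longrightarrow> continuous_on S (U h)"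
proof -
  assume "h \<in> H"
  then obtain \<alpha> \<beta> where "U h = su2 \<alpha> \<beta>"
    using U_su2 by blast
  then have "U h = (\<lambda>v. (\<alpha> * fst v - cnj \<beta> * snd v, \<beta> * fst v + cnj \<alpha> * snd v))"
    by (simp add: su2_def fun_eq_iff)
  then show ?thesis
    by (auto intro!: continuous_intros)
qed

lemma continuous_on_orbit_form:
  assumes "continuous_on S f" "continuous_on S g"
  shows "continuous_on S (\<lambda>x. orbit_form (f x) (g x))"
proof -
  have "continuous_on S (\<lambda>x. U h (f x))" if "h \<in> H" for h
    using continuous_on_compose[OF assms(1) continuous_on_U[OF that]] by (simp add: o_def)
  then show ?thesis
    unfolding orbit_form_def det2_def using assms by (intro continuous_intros) auto
qed

lemma orbit_form_poly:
  "\<exists>p. degree p \<le> card H \<and> (\<forall>z. orbit_form (z, 1) v' = poly p z)"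
proof -
  have "\<exists>q. degree q \<le> 1 \<and> (\<forall>z. det2 (U h (z, 1)) v' = poly q z)" if h: "h \<in> H" for h
  proof -
    obtain \<alpha> \<beta> where U: "U h = su2 \<alpha> \<beta>"
      using U_su2[OF h] by blast
    let ?q = "[:- cnj \<beta> * snd v' - cnj \<alpha> * fst v', \<alpha> * snd v' - \<beta> * fst v':]"
    have "det2 (U h (z, 1)) v' = poly ?q z" for z
      by (simp add: U su2_def det2_def algebra_simps)
    moreover have "degree ?q \<le> 1"
      by (simp add: degree_pCons_eq_if)
    ultimately show ?thesis
      by blast
  qed
  then have "\<forall>h\<in>H. \<exists>q. degree q \<le> 1 \<and> (\<forall>z. det2 (U h (z, 1)) v' = poly q z)"
    by blast
  then obtain q where q: "\<forall>h\<in>H. degree (q h) \<le> 1 \<and> (\<forall>z. det2 (U h (z, 1)) v' = poly (q h) z)"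
    by (rule bchoice[THEN exE])
  have "degree (\<Prod>h\<in>H. q h) \<le> (\<Sum>h\<in>H. degree (q h))"
    using degree_prod_sum_le[OF fin, of q] by (simp add: o_def)
  also have "\<dots> \<le> (\<Sum>h\<in>H. 1)"
    using q by (intro sum_mono) auto
  finally have "degree (\<Prod>h\<in>H. q h) \<le> card H"
    by simp
  moreover have "orbit_form (z, 1) v' = poly (\<Prod>h\<in>H. q h) z" for z
    unfolding orbit_form_def poly_prod using q by (intro prod.cong) auto
  ultimately show ?thesis
    by blast
qed

lemma hopf_parallel_norm:
  assumes "det2 u v = 0" "norm u = norm v"
  shows "hopf u = hopf v"
proof (cases "u = 0")
  case False
  obtain c where c: "v = cscale c u"
    using det2_eq_0[OF assms(1) False] .
  have "norm (hopf v) = norm (hopf u)"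
    by (simp add: norm_hopf assms(2))
  then have "(cmod c)\<^sup>2 * (norm u)\<^sup>2 = (norm u)\<^sup>2"
    by (simp add: c hopf_cscale norm_hopf)
  then have "(cmod c)\<^sup>2 = 1"
    using False by simp
  then show ?thesis
    by (simp add: c hopf_cscale)
qed (use assms(2) in auto)

definition plucker :: "complex \<times> complex \<Rightarrow> complex \<times> complex \<Rightarrow> complex \<times> complex \<Rightarrow> complex \<times> complex \<Rightarrow> complex"
  where "plucker a b v v' = orbit_form v a * orbit_form v' b - orbit_form v b * orbit_form v' a"

text \<open>As forms in \<open>v\<close>, both \<open>plucker (0, 1) b v v'\<close> and \<open>orbit_form v v'\<close> have degree \<open>card H\<close>
  and vanish on the orbit of \<open>v'\<close>. If this orbit is free, these are as many zeros as the degree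
  permits, so the two forms are proportional. The factor is found by evaluating at \<open>v = (0, 1)\<close>.
  The assumptions on \<open>v'\<close> make the orbit free and keep its roots in the coordinate \<open>z\<close> away from
  infinity and from the root 0 of \<open>(0, 1)\<close>.\<close>

lemma plucker_generic:
  assumes z: "\<And>h. h \<in> H \<Longrightarrow> fst (U h v') \<noteq> 0 \<and> snd (U h v') \<noteq> 0"
    and distinct: "\<And>h k. h \<in> H \<Longrightarrow> k \<in> H \<Longrightarrow> h \<noteq> k \<Longrightarrow> det2 (U h v') (U k v') \<noteq> 0"
  shows "cmod (plucker (0, 1) b (z, 1) v') = cmod (orbit_form (0, 1) b) * cmod (orbit_form (z, 1) v')"
proof -
  let ?a = "(0, 1) :: complex \<times> complex"
  let ?d = "card H"
  define G where "G v = plucker ?a b v v'" for v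
  obtain pa where pa: "degree pa \<le> ?d" "\<And>z. orbit_form (z, 1) ?a = poly pa z"
    using orbit_form_poly by metis
  obtain pb where pb: "degree pb \<le> ?d" "\<And>z. orbit_form (z, 1) b = poly pb z"
    using orbit_form_poly by metis
  obtain pv where pv: "degree pv \<le> ?d" "\<And>z. orbit_form (z, 1) v' = poly pv z"
    using orbit_form_poly by metis
  have G_scale: "G (cscale c v) = c ^ ?d * G v" for c v
    by (simp add: G_def plucker_def orbit_form_cscale algebra_simps)
  \<comment> \<open>Chosen so that 0 is a root in addition to the \<open>card H\<close> roots on the orbit, one more
    than the degree allows.\<close>
  define D where "D = Polynomial.smult (orbit_form ?a v') (Polynomial.smult (orbit_form v' b) pa - Polynomial.smult (orbit_form v' ?a) pb)
      - Polynomial.smult (G ?a) pv"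
  have D: "poly D z = G (z, 1) * orbit_form ?a v' - G ?a * orbit_form (z, 1) v'" for z
    by (simp add: D_def G_def plucker_def pa(2) pb(2) pv(2) algebra_simps)
  have degD: "degree D \<le> ?d"
    unfolding D_def using pa(1) pb(1) pv(1)
    by (intro degree_diff_le order_trans[OF degree_smult_le]) auto
  define r where "r k = fst (U k v') / snd (U k v')" for k
  have root: "poly D (r k) = 0" if k: "k \<in> H" for k
  proof -
    obtain c where c: "\<And>w. orbit_form (U k v') w = c * orbit_form v' w"
      using orbit_form_invariant[OF k] by metis
    have "(r k, 1) = cscale (1 / snd (U k v')) (U k v')"
      using z[OF k] by (simp add: r_def cscale_def)
    moreover have "G (U k v') = 0"
      by (simp add: G_def plucker_def c)
    moreover have "orbit_form (U k v') v' = 0"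
      by (simp add: c orbit_form_self)
    ultimately show ?thesis
      unfolding D by (simp add: G_scale orbit_form_cscale)
  qed
  have root0: "poly D 0 = 0"
    unfolding D by simp
  have "inj_on r H"
  proof (rule inj_onI, rule ccontr)
    fix h k assume hk: "h \<in> H" "k \<in> H" "r h = r k" "h \<noteq> k"
    then have "det2 (U h v') (U k v') = 0"
      using z[OF hk(1)] z[OF hk(2)] by (simp add: r_def det2_def field_simps)
    then show False
      using distinct hk by blast
  qed
  moreover have "0 \<notin> r ` H"
    using z by (auto simp: r_def)
  ultimately have card: "card (insert 0 (r ` H)) = Suc ?d"
    using fin by (simp add: card_image)
  have "D = 0"
  proof (rule ccontr)
    assume nz: "D \<noteq> 0"
    have "insert 0 (r ` H) \<subseteq> {z. poly D z = 0}"
      using root root0 by auto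
    then have "Suc ?d \<le> card {z. poly D z = 0}"
      unfolding card[symmetric] by (rule card_mono[OF poly_roots_finite[OF nz]])
    also have "\<dots> \<le> degree D"
      by (rule card_poly_roots_bound[OF nz])
    finally show False
      using degD by simp
  qed
  then have "G (z, 1) * orbit_form ?a v' = G ?a * orbit_form (z, 1) v'"
    using D[of z] by simp
  also have "G ?a = - (orbit_form ?a b * orbit_form v' ?a)"
    by (simp add: G_def plucker_def orbit_form_self)
  finally have "cmod (G (z, 1)) * cmod (orbit_form v' ?a)
      = cmod (orbit_form ?a b) * cmod (orbit_form v' ?a) * cmod (orbit_form (z, 1) v')"
    using norm_orbit_form_swap[of ?a v'] by (metis norm_minus_cancel norm_mult)
  moreover have "orbit_form v' ?a \<noteq> 0"
    using z fin by (auto simp: orbit_form_def det2_def)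
  ultimately show ?thesis
    by (simp add: G_def)
qed

lemma plucker_cscale:
  "plucker a b (cscale c v) v' = c ^ card H * plucker a b v v'"
  "plucker a b v (cscale c v') = c ^ card H * plucker a b v v'"
  by (simp_all add: plucker_def orbit_form_cscale algebra_simps)

text \<open>Both sides are continuous in \<open>v\<close> and in \<open>v'\<close> and unchanged by phases, so the generic case
  extends first to all \<open>v\<close>, where the multiples of \<open>(1, 0)\<close> were missing, and then to all \<open>v'\<close>.
  Absolute values free the relation of phases and of signs.\<close>

lemma plucker_relation:
  "cmod (plucker (0, 1) b v v') = cmod (orbit_form (0, 1) b) * cmod (orbit_form v v')"
proof -
  let ?P = "\<lambda>v v'. cmod (plucker (0, 1) b v v') = cmod (orbit_form (0, 1) b) * cmod (orbit_form v v')"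
  obtain L where L: "finite L" "\<And>x. x \<in> (\<Union>a\<in>L. span {a}) \<longleftrightarrow> (\<exists>h\<in>H. h *v x = x \<and> h \<noteq> mat 1)"
    by (rule rotation_axes[OF fin H_SO3], assumption) (rule that)
  let ?L = "(\<lambda>h. transpose h *v axis 3 1) ` H \<union> L"
  have main: "?P (z, 1) v'" if gen: "\<And>a. a \<in> ?L \<Longrightarrow> hopf v' \<notin> span {a}" for z v'
  proof (rule plucker_generic)
    fix h assume h: "h \<in> H"
    have "h *v hopf v' \<notin> span {axis 3 1}"
    proof
      assume "h *v hopf v' \<in> span {axis 3 1}"
      then obtain c where "h *v hopf v' = c *\<^sub>R axis 3 1"
        by (auto simp: span_singleton)
      then have "transpose h *v (h *v hopf v') = c *\<^sub>R (transpose h *v axis 3 1)"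
        by (simp add: matrix_vector_mult_scaleR)
      then have "hopf v' = c *\<^sub>R (transpose h *v axis 3 1)"
        by (simp add: matrix_vector_mul_assoc SO3_transpose[OF H_SO3[OF h]])
      then have "hopf v' \<in> span {transpose h *v axis 3 1}"
        by (auto simp: span_singleton)
      then show False
        using gen h by blast
    qed
    then show "fst (U h v') \<noteq> 0 \<and> snd (U h v') \<noteq> 0"
      using hopf_pole[of "U h v'"] h by (auto simp: hopf_U)
  next
    fix h k assume hk: "h \<in> H" "k \<in> H" "h \<noteq> k"
    show "det2 (U h v') (U k v') \<noteq> 0"
    proof
      assume "det2 (U h v') (U k v') = 0"
      then have "h *v hopf v' = k *v hopf v'"
        using hopf_parallel_norm[of "U h v'" "U k v'"] hk by (simp add: norm_U hopf_U)
      then have "transpose h *v (h *v hopf v') = transpose h *v (k *v hopf v')"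
        by simp
      then have fixed: "(transpose h ** k) *v hopf v' = hopf v'"
        by (simp add: matrix_vector_mul_assoc SO3_transpose[OF H_SO3[OF hk(1)]])
      have "transpose h ** k \<noteq> mat 1"
      proof
        assume "transpose h ** k = mat 1"
        then have "h ** (transpose h ** k) = h"
          by simp
        then show False
          using hk by (simp add: matrix_mul_assoc SO3_transpose[OF H_SO3[OF hk(1)]])
      qed
      then have "hopf v' \<in> (\<Union>a\<in>L. span {a})"
        unfolding L(2) using fixed H_mult[OF H_transpose[OF hk(1)] hk(2)] by blast
      then show False
        using gen by blast
    qed
  qed
  have step: "?P v v'" if gen: "\<And>a. a \<in> ?L \<Longrightarrow> hopf v' \<notin> span {a}" for v v'
  proof (rule hopf_dense_induct[where L = "{axis 3 1}" and P = "\<lambda>v. ?P v v'"])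
    show "closed {v. ?P v v'}"
      unfolding plucker_def by (intro closed_Collect_eq continuous_intros continuous_on_orbit_form)
    show "?P v v'" if "\<And>a. a \<in> {axis 3 1} \<Longrightarrow> hopf v \<notin> span {a}" for v
    proof -
      have "snd v \<noteq> 0"
        using that hopf_pole by blast
      then have v: "v = cscale (snd v) (fst v / snd v, 1)"
        by (simp add: cscale_def)
      show ?thesis
        using main[OF gen, of "fst v / snd v"]
        by (subst (1 2) v) (simp only: plucker_cscale orbit_form_cscale norm_mult mult.left_commute)
    qed
  qed (simp_all add: plucker_cscale orbit_form_cscale norm_mult norm_power)
  show ?thesis
  proof (rule hopf_dense_induct[where L = ?L and P = "\<lambda>v'. ?P v v'"])
    show "closed {v'. ?P v v'}"
      unfolding plucker_def by (intro closed_Collect_eq continuous_intros continuous_on_orbit_form)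
    show "finite ?L"
      using fin L(1) by simp
    show "?P v (cscale c v')" if "cmod c = 1" "?P v v'" for c v'
      using that by (simp add: plucker_cscale orbit_form_cscale norm_mult norm_power)
  qed (rule step)
qed

lemma orbit_form_nonzero:
  assumes "v \<noteq> 0"
  obtains v' where "orbit_form v v' \<noteq> 0"
proof -
  obtain y where y: "\<And>a. a \<in> (\<lambda>h. hopf (U h v)) ` H \<Longrightarrow> y \<notin> span {a}"
    using avoid_lines[of "(\<lambda>h. hopf (U h v)) ` H" UNIV] fin by auto
  obtain v' where v': "hopf v' = y"
    using hopf_surj .
  have "det2 (U h v) v' \<noteq> 0" if h: "h \<in> H" for h
    using det2_eq_0_span[of "U h v" v'] y h U_eq_0_iff[OF h, of v] v' assms by auto
  then show thesis
    using that orbit_form_eq_0 by blast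
qed

text \<open>Homogeneous coordinates of a map of degree \<open>card H\<close> between projective lines, whose fibres
  are the orbits if \<open>b\<close> is not over the orbit of \<open>(0, 1)\<close>.\<close>

definition invariants :: "complex \<times> complex \<Rightarrow> complex \<times> complex \<Rightarrow> complex \<times> complex"
  where "invariants b v = (orbit_form v (0, 1), orbit_form v b)"

lemma invariants_cscale: "invariants b (cscale c v) = cscale (c ^ card H) (invariants b v)"
  by (simp add: invariants_def orbit_form_cscale) (simp add: cscale_def)

lemma plucker_det2: "plucker (0, 1) b v v' = det2 (invariants b v) (invariants b v')"
  by (simp add: plucker_def invariants_def det2_def)

lemma invariants_eq_0:
  assumes b: "orbit_form (0, 1) b \<noteq> 0" and v: "invariants b v = 0"
  shows "v = 0"
proof (rule ccontr)
  assume nz: "v \<noteq> 0"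
  obtain v' where "orbit_form v v' \<noteq> 0"
    using orbit_form_nonzero[OF nz] .
  then show False
    using plucker_relation[of b v v'] v b by (simp add: plucker_det2 det2_def)
qed

lemma continuous_on_invariants: "continuous_on S (invariants b)"
  unfolding invariants_def by (intro continuous_intros continuous_on_orbit_form)

text \<open>Up to a factor, \<open>invariants b v\<close> equals \<open>w\<close> exactly at the zeros of a form \<open>Q\<close> of degree
  \<open>card H\<close>, which is at least 1. If \<open>Q (z, 1)\<close> is not constant, it has a root; if it is
  constant, the root is at infinity, that is at \<open>(1, 0)\<close>.\<close>

lemma invariants_surj:
  assumes b: "orbit_form (0, 1) b \<noteq> 0" and w: "w \<noteq> 0"
  obtains v c where "v \<noteq> 0" "c \<noteq> 0" "invariants b v = cscale c w"
proof -
  define Q where "Q v = det2 w (invariants b v)" for v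
  have Q_scale: "Q (cscale c v) = c ^ card H * Q v" for c v
    by (simp add: Q_def invariants_cscale det2_cscale)
  have "card H \<noteq> 0"
    using fin H_one by auto
  obtain pa where pa: "\<And>z. orbit_form (z, 1) (0, 1) = poly pa z"
    using orbit_form_poly by metis
  obtain pb where pb: "\<And>z. orbit_form (z, 1) b = poly pb z"
    using orbit_form_poly by metis
  define p where "p = Polynomial.smult (fst w) pb - Polynomial.smult (snd w) pa"
  have p: "Q (z, 1) = poly p z" for z
    by (simp add: Q_def p_def invariants_def det2_def pa pb)
  have "\<exists>v. v \<noteq> 0 \<and> Q v = 0"
  proof (cases "constant (poly p)")
    case False
    then obtain z where "poly p z = 0"
      using fundamental_theorem_of_algebra by blast
    then have "(z, 1) \<noteq> (0 :: complex \<times> complex) \<and> Q (z, 1) = 0"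
      by (simp add: p zero_prod_def)
    then show ?thesis
      by blast
  next
    case True
    define k where "k = poly p 0"
    have const: "Q (z, 1) = k" for z
      using True unfolding p constant_def k_def by blast
    have "Q v = snd v ^ card H * k" for v
    proof (rule hopf_dense_induct[where L = "{axis 3 1}" and P = "\<lambda>v. Q v = snd v ^ card H * k"])
      show "closed {v. Q v = snd v ^ card H * k}"
        unfolding Q_def det2_def
        by (intro closed_Collect_eq continuous_intros continuous_on_invariants)
      show "Q u = snd u ^ card H * k" if "\<And>a. a \<in> {axis 3 1} \<Longrightarrow> hopf u \<notin> span {a}" for u
      proof -
        have "snd u \<noteq> 0"
          using that hopf_pole by blast
        then have "u = cscale (snd u) (fst u / snd u, 1)"
          by (simp add: cscale_def)
        then show ?thesis
          using Q_scale const by metis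
      qed
      show "Q (cscale c u) = snd (cscale c u) ^ card H * k" if "Q u = snd u ^ card H * k" for c u
        using that by (simp add: Q_scale) (simp add: cscale_def power_mult_distrib)
    qed simp
    from this[of "(1, 0)"] have "Q (1, 0) = 0"
      using \<open>card H \<noteq> 0\<close> by simp
    moreover have "(1, 0) \<noteq> (0 :: complex \<times> complex)"
      by (simp add: zero_prod_def)
    ultimately show ?thesis
      by blast
  qed
  then obtain v where v: "v \<noteq> 0" "Q v = 0"
    by blast
  obtain c where c: "invariants b v = cscale c w"
    using det2_eq_0[of w "invariants b v"] v(2) w by (auto simp: Q_def)
  have "c \<noteq> 0"
  proof
    assume "c = 0"
    then have "invariants b v = 0"
      using c by (simp add: cscale_def zero_prod_def)
    then show False
      using invariants_eq_0[OF b] v(1) by blast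
  qed
  then show thesis
    using that v(1) c by blast
qed

text \<open>The Hopf image of \<open>invariants b v\<close> for a point \<open>v\<close> over \<open>x\<close>, rescaled to the length of
  \<open>x\<close>. Any choice of \<open>v\<close> gives the same value, since two choices differ by a phase. For \<open>x = 0\<close>
  the quotient of the norms is \<open>0 / 0 = 0\<close>, so the value is 0.\<close>

definition orbit_map :: "complex \<times> complex \<Rightarrow> real^3 \<Rightarrow> real^3"
  where "orbit_map b x = (let p = hopf (invariants b (SOME v. hopf v = x)) in (norm x / norm p) *\<^sub>R p)"

lemma orbit_map_hopf:
  "orbit_map b (hopf v) = (norm (hopf v) / norm (hopf (invariants b v))) *\<^sub>R hopf (invariants b v)"
proof -
  define u where "u = (SOME u. hopf u = hopf v)"
  have "hopf u = hopf v"
    unfolding u_def by (rule someI) (rule refl)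
  then obtain c where "cmod c = 1" "v = cscale c u"
    by (rule hopf_eq_imp)
  then have "hopf (invariants b v) = hopf (invariants b u)"
    by (simp add: invariants_cscale hopf_cscale norm_power)
  then show ?thesis
    unfolding orbit_map_def u_def[symmetric] by (simp add: Let_def)
qed

lemma orbit_map_invariant:
  assumes h: "h \<in> H"
  shows "orbit_map b (h *v x) = orbit_map b x"
proof -
  obtain v where v: "hopf v = x"
    using hopf_surj .
  obtain c where c: "cmod c = 1" "\<And>v'. orbit_form (U h v) v' = c * orbit_form v v'"
    using orbit_form_invariant[OF h] by metis
  have "invariants b (U h v) = cscale c (invariants b v)"
    by (simp add: invariants_def c(2) cscale_def)
  then have "orbit_map b (hopf (U h v)) = orbit_map b (hopf v)"
    using c(1) by (simp add: orbit_map_hopf hopf_cscale norm_hopf norm_U[OF h])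
  then show ?thesis
    by (simp add: hopf_U[OF h] v)
qed

lemma norm_orbit_map:
  assumes b: "orbit_form (0, 1) b \<noteq> 0"
  shows "norm (orbit_map b x) = norm x"
proof -
  obtain v where v: "hopf v = x"
    using hopf_surj .
  show ?thesis
  proof (cases "v = 0")
    case True
    then show ?thesis
      using v norm_hopf[of v] orbit_map_hopf[of b v] by simp
  next
    case False
    then have "invariants b v \<noteq> 0"
      using invariants_eq_0[OF b] by blast
    then have "norm (hopf (invariants b v)) \<noteq> 0"
      by (simp add: norm_hopf)
    then show ?thesis
      using orbit_map_hopf[of b v] v by simp
  qed
qed

text \<open>Equal values mean that \<open>invariants b\<close> takes proportional values at points over \<open>x\<close> and
  \<open>y\<close>. Then \<open>plucker (0, 1) b\<close> vanishes there, and so does \<open>orbit_form\<close>.\<close>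

lemma orbit_map_eq_imp:
  assumes b: "orbit_form (0, 1) b \<noteq> 0" and eq: "orbit_map b x = orbit_map b y"
  obtains h where "h \<in> H" "y = h *v x"
proof -
  have n: "norm x = norm y"
    using eq norm_orbit_map[OF b] by metis
  obtain v where v: "hopf v = x"
    using hopf_surj .
  obtain v' where v': "hopf v' = y"
    using hopf_surj .
  show thesis
  proof (cases "v = 0")
    case True
    then have "x = 0"
      using v norm_hopf[of v] by simp
    then show thesis
      using n that[OF H_one] by simp
  next
    case False
    then have "x \<noteq> 0"
      using v norm_hopf[of v] by auto
    then have "y \<noteq> 0"
      using n by auto
    then have "v' \<noteq> 0"
      using v' norm_hopf[of v'] by auto
    define r where "r = norm (hopf (invariants b v))"
    define r' where "r' = norm (hopf (invariants b v'))"
    have r: "r > 0" "r' > 0"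
      using invariants_eq_0[OF b, of v] invariants_eq_0[OF b, of v'] False \<open>v' \<noteq> 0\<close>
      unfolding r_def r'_def norm_hopf by fastforce+
    have "(norm x / r) *\<^sub>R hopf (invariants b v) = (norm x / r') *\<^sub>R hopf (invariants b v')"
      using eq orbit_map_hopf[of b v] orbit_map_hopf[of b v'] n by (simp add: v v' r_def r'_def)
    then have "(r' / norm x) *\<^sub>R (norm x / r) *\<^sub>R hopf (invariants b v)
        = (r' / norm x) *\<^sub>R (norm x / r') *\<^sub>R hopf (invariants b v')"
      by simp
    then have "hopf (invariants b v') = (r' / r) *\<^sub>R hopf (invariants b v)"
      using r \<open>x \<noteq> 0\<close> by simp
    also have "\<dots> = hopf (cscale (of_real (sqrt (r' / r))) (invariants b v))"
      using r by (simp add: hopf_cscale)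
    finally obtain c where c: "cscale (of_real (sqrt (r' / r))) (invariants b v) = cscale c (invariants b v')"
      by (rule hopf_eq_imp)
    have "of_real (sqrt (r' / r)) * det2 (invariants b v) (invariants b v')
        = det2 (cscale c (invariants b v')) (invariants b v')"
      by (simp add: det2_cscale flip: c)
    then have "plucker (0, 1) b v v' = 0"
      using r by (simp add: plucker_det2 det2_cscale det2_self)
    then have "orbit_form v v' = 0"
      using plucker_relation[of b v v'] b by simp
    then obtain h where h: "h \<in> H" "det2 (U h v) v' = 0"
      using orbit_form_eq_0 by blast
    have "(norm v)\<^sup>2 = (norm v')\<^sup>2"
      using n by (simp add: v[symmetric] v'[symmetric] norm_hopf)
    then have "norm (U h v) = norm v'"
      by (simp add: norm_U[OF h(1)] power2_eq_iff_nonneg)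
    then have "hopf (U h v) = hopf v'"
      using hopf_parallel_norm h(2) by blast
    then show thesis
      using that[OF h(1)] v v' hopf_U[OF h(1)] by simp
  qed
qed

lemma orbit_map_surj:
  assumes b: "orbit_form (0, 1) b \<noteq> 0"
  obtains x where "orbit_map b x = y"
proof (cases "y = 0")
  case True
  have "norm (orbit_map b 0) = 0"
    using norm_orbit_map[OF b, of 0] by simp
  then show thesis
    using that True by simp
next
  case False
  obtain w where w: "hopf w = y"
    using hopf_surj .
  have "w \<noteq> 0"
    using False w norm_hopf[of w] by auto
  then obtain v c where v: "v \<noteq> 0" "c \<noteq> 0" "invariants b v = cscale c w"
    using invariants_surj[OF b] by blast
  have "norm (hopf v) > 0"
    using v(1) by (simp add: norm_hopf)
  define t where "t = complex_of_real (sqrt (norm y / norm (hopf v)))"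
  have t: "(cmod t)\<^sup>2 = norm y / norm (hopf v)" "t \<noteq> 0"
    using \<open>norm (hopf v) > 0\<close> False by (auto simp: t_def)
  have nt: "norm (hopf (cscale t v)) = norm y"
    using \<open>norm (hopf v) > 0\<close> by (simp add: hopf_cscale t(1))
  define k where "k = (cmod (t ^ card H * c))\<^sup>2"
  have "k > 0"
    using t(2) v(2) by (simp add: k_def)
  have "hopf (invariants b (cscale t v)) = k *\<^sub>R y"
    by (simp add: invariants_cscale v(3) cscale_cscale hopf_cscale w k_def)
  then have "orbit_map b (hopf (cscale t v)) = y"
    using \<open>k > 0\<close> False by (simp add: orbit_map_hopf nt)
  then show thesis
    by (rule that)
qed

text \<open>Since the Hopf map is closed and onto, it suffices that the composition with it is
  continuous. At the origin this holds because norms are preserved.\<close>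

lemma continuous_on_orbit_map:
  assumes b: "orbit_form (0, 1) b \<noteq> 0"
  shows "continuous_on UNIV (orbit_map b)"
proof -
  let ?g = "\<lambda>v. orbit_map b (hopf v)"
  have nz: "hopf (invariants b v) \<noteq> 0" if "v \<noteq> 0" for v
    using invariants_eq_0[OF b, of v] that norm_hopf[of "invariants b v"] by auto
  have inv: "continuous_on S (\<lambda>v. hopf (invariants b v))" for S
    using continuous_on_compose[OF continuous_on_invariants continuous_on_hopf] by (simp add: o_def)
  have "continuous_on (- {0}) ?g"
    unfolding orbit_map_hopf using nz by (intro continuous_intros inv continuous_on_hopf) auto
  then have away: "isCont ?g v" if "v \<noteq> 0" for v
    using that by (simp add: continuous_on_eq_continuous_at open_Compl)
  have at0: "isCont ?g 0"
  proof -
    have 0: "?g 0 = 0"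
      using norm_orbit_map[OF b, of "hopf 0"] norm_hopf[of 0] by simp
    have "((\<lambda>v :: complex \<times> complex. (norm v)\<^sup>2) \<longlongrightarrow> (norm (0 :: complex \<times> complex))\<^sup>2) (at 0)"
      by (rule tendsto_power[OF tendsto_norm[OF tendsto_ident_at]])
    then have lim: "((\<lambda>v :: complex \<times> complex. (norm v)\<^sup>2) \<longlongrightarrow> 0) (at 0)"
      by (rule tendsto_eq_rhs) simp
    have "(?g \<longlongrightarrow> 0) (at 0)"
    proof (rule Lim_null_comparison[OF always_eventually lim], rule allI)
      show "norm (?g v) \<le> (norm v)\<^sup>2" for v
        by (simp add: norm_orbit_map[OF b] norm_hopf)
    qed
    then show ?thesis
      unfolding isCont_def 0 .
  qed
  have cont: "continuous_on UNIV ?g"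
  proof (rule continuous_at_imp_continuous_on, rule ballI)
    show "isCont ?g v" for v
      by (cases "v = 0") (simp_all only: at0 away not_False_eq_True)
  qed
  have "closed (orbit_map b -` C)" if C: "closed C" for C
  proof -
    have "closed (?g -` C)"
      using cont C closed_vimage by blast
    then have "closed (hopf ` (?g -` C))"
      by (rule closed_hopf_image)
    moreover have "hopf ` (?g -` C) = orbit_map b -` C"
    proof
      show "orbit_map b -` C \<subseteq> hopf ` (?g -` C)"
      proof
        fix x assume x: "x \<in> orbit_map b -` C"
        obtain v where "hopf v = x"
          using hopf_surj .
        with x show "x \<in> hopf ` (?g -` C)"
          by (intro image_eqI[of _ _ v]) auto
      qed
    qed auto
    ultimately show ?thesis
      by simp
  qed
  then show ?thesis
    using continuous_on_closed_vimage[OF closed_UNIV, of "orbit_map b"] by simp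
qed

lemma open_orbit_map_image:
  assumes b: "orbit_form (0, 1) b \<noteq> 0" and S: "open S"
  shows "open (orbit_map b ` S)"
proof -
  let ?C = "{x. \<forall>h\<in>H. h *v x \<notin> S}"
  have "closed {x. h *v x \<notin> S}" for h
  proof -
    have "continuous_on UNIV (\<lambda>x. h *v x)"
      by (intro linear_continuous_on matrix_vector_mul_bounded_linear)
    then have "open ((\<lambda>x. h *v x) -` S)"
      using S by (simp add: continuous_on_open_vimage)
    moreover have "{x. h *v x \<notin> S} = - ((\<lambda>x. h *v x) -` S)"
      by auto
    ultimately show ?thesis
      by (simp only: closed_Compl)
  qed
  then have "closed (\<Inter>h\<in>H. {x. h *v x \<notin> S})"
    by (intro closed_INT) auto
  moreover have "(\<Inter>h\<in>H. {x. h *v x \<notin> S}) = ?C"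
    by auto
  ultimately have "closed ?C"
    by simp
  have "closed (orbit_map b ` ?C)"
  proof (rule proper_imp_closed_image[OF continuous_on_orbit_map[OF b] _ \<open>closed ?C\<close>])
    fix B :: "(real^3) set" assume "bounded B"
    then obtain a where a: "\<And>x. x \<in> B \<Longrightarrow> norm x \<le> a"
      by (auto simp: bounded_iff)
    have "norm x \<le> a" if "x \<in> orbit_map b -` B" for x
      using a[of "orbit_map b x"] that norm_orbit_map[OF b] by simp
    then show "bounded (orbit_map b -` B)"
      unfolding bounded_iff by blast
  qed
  moreover have "orbit_map b ` S = - orbit_map b ` ?C"
  proof
    show "orbit_map b ` S \<subseteq> - orbit_map b ` ?C"
    proof (rule subsetI, rule ComplI)
      fix y assume "y \<in> orbit_map b ` S" "y \<in> orbit_map b ` ?C"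
      then obtain s x where s: "s \<in> S" "y = orbit_map b s" and x: "x \<in> ?C" "y = orbit_map b x"
        by blast
      have "orbit_map b x = orbit_map b s"
        by (rule trans[OF x(2)[symmetric] s(2)])
      then obtain h where h: "h \<in> H" "s = h *v x"
        by (rule orbit_map_eq_imp[OF b])
      then have "h *v x \<notin> S"
        using x(1) by simp
      then show False
        using s(1) h(2) by simp
    qed
    show "- orbit_map b ` ?C \<subseteq> orbit_map b ` S"
    proof
      fix y assume y: "y \<in> - orbit_map b ` ?C"
      obtain x where x: "orbit_map b x = y"
        using orbit_map_surj[OF b] .
      have "x \<notin> ?C"
      proof
        assume "x \<in> ?C"
        then have "orbit_map b x \<in> orbit_map b ` ?C"
          by (rule imageI)
        then show False
          using y x by simp
      qed
      then obtain h where h: "h \<in> H" "h *v x \<in> S"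
        by auto
      then show "y \<in> orbit_map b ` S"
        using orbit_map_invariant[OF h(1), of b x] x by (intro image_eqI[of _ _ "h *v x"]) simp_all
    qed
  qed
  ultimately show ?thesis
    by (simp only: open_Compl)
qed

end

text \<open>The quotient of space by a finite group of rotations is homeomorphic to space, by a
  homeomorphism that preserves the distance to the origin. As \<open>F\<close> is open, it is the quotient
  map.\<close>

theorem rotation_quotient_map:
  assumes H: "subgroup H SO3" "finite H"
  obtains F :: "real^3 \<Rightarrow> real^3"
  where "continuous_on UNIV F" "\<And>S. open S \<Longrightarrow> open (F ` S)" "surj F"
    "\<And>x. norm (F x) = norm x" "\<And>x y. F x = F y \<longleftrightarrow> (\<exists>h\<in>H. y = h *v x)"
proof -
  let ?lift = "\<lambda>h u. (\<exists>\<alpha> \<beta>. (cmod \<alpha>)\<^sup>2 + (cmod \<beta>)\<^sup>2 = 1 \<and> u = su2 \<alpha> \<beta>) \<and> (\<forall>v. hopf (u v) = h *v hopf v)"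
  have "\<forall>h\<in>H. \<exists>u. ?lift h u"
  proof
    fix h assume "h \<in> H"
    then have "h \<in> carrier SO3"
      using subgroup.mem_carrier[OF H(1)] by blast
    then obtain w x where wx: "w\<^sup>2 + x \<bullet> x = 1" "h = quat_matrix w x"
      by (rule SO3_quat)
    let ?\<alpha> = "Complex w (- x$3)" and ?\<beta> = "Complex (x$2) (- x$1)"
    have "(cmod ?\<alpha>)\<^sup>2 + (cmod ?\<beta>)\<^sup>2 = 1"
      using wx(1) by (simp add: cmod_power2 mat3_simps) (simp add: power2_eq_square)
    moreover have "hopf (su2 ?\<alpha> ?\<beta> v) = h *v hopf v" for v
      unfolding wx(2) by (rule hopf_su2)
    ultimately show "\<exists>u. ?lift h u"
      by blast
  qed
  then obtain U where U: "\<forall>h\<in>H. ?lift h (U h)"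
    by (rule bchoice[THEN exE])
  interpret lifted_rotation_group H U
    by (rule lifted_rotation_group.intro) (use H U in blast)+
  obtain b where b: "orbit_form (0, 1) b \<noteq> 0"
    using orbit_form_nonzero[of "(0, 1)"] by (auto simp: zero_prod_def)
  show thesis
  proof (rule that[of "orbit_map b"])
    show "surj (orbit_map b)"
    proof (rule surjI)
      show "orbit_map b (SOME x. orbit_map b x = y) = y" for y
        by (rule orbit_map_surj[OF b, of y]) (rule someI)
    qed
    show "orbit_map b x = orbit_map b y \<longleftrightarrow> (\<exists>h\<in>H. y = h *v x)" for x y
    proof
      show "\<exists>h\<in>H. y = h *v x" if "orbit_map b x = orbit_map b y"
        using that by (rule orbit_map_eq_imp[OF b]) blast
    qed (auto simp: orbit_map_invariant)
    show "continuous_on UNIV (orbit_map b)"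
      by (rule continuous_on_orbit_map[OF b])
    show "open (orbit_map b ` S)" if "open S" for S
      by (rule open_orbit_map_image[OF b that])
    show "norm (orbit_map b x) = norm x" for x
      by (rule norm_orbit_map[OF b])
  qed
qed

section \<open>The misorientation space is a closed manifold\<close>

lemma continuous_on_matrix_mult:
  fixes f :: "'a::topological_space \<Rightarrow> real^3^3"
  assumes "continuous_on S f" "continuous_on S g"
  shows "continuous_on S (\<lambda>x. f x ** g x)"
  unfolding matrix_matrix_mult_def using assms by (intro continuous_intros)

lemma continuous_on_transpose:
  fixes f :: "'a::topological_space \<Rightarrow> real^3^3"
  assumes "continuous_on S f"
  shows "continuous_on S (\<lambda>x. transpose (f x))"
  unfolding transpose_def using assms by (intro continuous_intros)

lemma compact_SO3: "compact (carrier SO3)"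
proof -
  have "carrier SO3 = {A :: real^3^3. transpose A ** A = mat 1} \<inter> {A. det A = 1}"
    using carrier_SO3 by auto
  moreover have "closed {A :: real^3^3. transpose A ** A = mat 1}"
    by (intro closed_Collect_eq continuous_on_matrix_mult continuous_on_transpose continuous_intros)
  moreover have "closed {A :: real^3^3. det A = 1}"
    unfolding det_3 by (intro closed_Collect_eq continuous_intros)
  ultimately have "closed (carrier SO3)"
    by auto
  moreover have "norm A \<le> 9" if A: "A \<in> carrier SO3" for A
  proof -
    have row: "(A$i$1)\<^sup>2 + (A$i$2)\<^sup>2 + (A$i$3)\<^sup>2 = 1" for i
      using SO3_rows(1-3)[OF A] exhaust_3[of i] by auto
    have "(A$i$j)\<^sup>2 \<le> 1" for i j
      using row[of i] exhaust_3[of j] zero_le_power2[of "A$i$1"] zero_le_power2[of "A$i$2"] zero_le_power2[of "A$i$3"]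
      by (elim disjE; simp only:; linarith)
    then have entry: "\<bar>A$i$j\<bar> \<le> 1" for i j
      by (simp add: abs_square_le_1)
    have "norm (A$i) \<le> 3" for i
      using norm_le_l1_cart[of "A$i"] entry[of i 1] entry[of i 2] entry[of i 3] by (simp add: sum_3)
    then have "(\<Sum>i\<in>UNIV. norm (A$i)) \<le> (\<Sum>i\<in>(UNIV :: 3 set). 3)"
      by (intro sum_mono)
    moreover have "norm A \<le> (\<Sum>i\<in>UNIV. norm (A$i))"
      unfolding norm_vec_def by (rule L2_set_le_sum) simp
    ultimately show ?thesis
      by simp
  qed
  then have "bounded (carrier SO3)"
    unfolding bounded_iff by blast
  ultimately show ?thesis
    by (simp add: compact_eq_bounded_closed)
qed

lemma continuous_on_cayley: "continuous_on S cayley"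
proof -
  have ne: "1 + x \<bullet> x \<noteq> 0" for x :: "real^3"
    using one_plus_inner_pos[of x] by linarith
  have "continuous_on S (\<lambda>x. quat_matrix 1 x $ i $ j)" for i j
    using exhaust_3[of i] exhaust_3[of j]
    by (elim disjE; simp only: quat_matrix_def vector_3; intro continuous_intros)
  then have "continuous_on S (\<lambda>x. \<chi> i j. quat_matrix 1 x $ i $ j)"
    by (intro continuous_on_vec_lambda)
  then have "continuous_on S (quat_matrix 1)"
    by simp
  then show ?thesis
    unfolding cayley_def using ne by (intro continuous_intros) auto
qed

lemma continuous_on_trace: "continuous_on S (trace :: real^3^3 \<Rightarrow> real)"
  unfolding trace_def by (intro continuous_intros)

lemma continuous_on_cayley_inv: "continuous_on {A. trace A \<noteq> -1} cayley_inv"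
proof -
  let ?v = "\<lambda>A :: real^3^3. vector [A$3$2 - A$2$3, A$1$3 - A$3$1, A$2$1 - A$1$2] :: real^3"
  have "continuous_on S (\<lambda>A. ?v A $ i)" for S :: "(real^3^3) set" and i :: 3
    using exhaust_3[of i] by (elim disjE; simp only: vector_3; intro continuous_intros)
  then have "continuous_on S (\<lambda>A. \<chi> i. ?v A $ i)"
    for S :: "(real^3^3) set"
    by (intro continuous_on_vec_lambda)
  then have "continuous_on S ?v"
    for S :: "(real^3^3) set"
    by simp
  then show ?thesis
    unfolding cayley_inv_def[abs_def]
    by (intro continuous_intros continuous_on_trace) (auto simp: add_eq_0_iff)
qed

lemma open_map_cayley_mult:
  assumes A: "A \<in> carrier SO3" and S: "open S"
  shows "openin SO3_topology ((\<lambda>x. cayley x ** A) ` S)"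
proof -
  let ?T = "{B :: real^3^3. trace B \<noteq> -1}"
  have "open ?T"
    by (intro open_Collect_neq continuous_on_trace continuous_intros)
  then have T: "open (?T \<inter> cayley_inv -` S)"
    by (rule continuous_open_preimage[OF continuous_on_cayley_inv _ S])
  have "open ((\<lambda>B. B ** transpose A) -` (?T \<inter> cayley_inv -` S))"
    by (rule open_vimage[OF T]) (intro continuous_on_matrix_mult continuous_intros)
  moreover have "(\<lambda>x. cayley x ** A) ` S = carrier SO3 \<inter> (\<lambda>B. B ** transpose A) -` (?T \<inter> cayley_inv -` S)"
  proof (intro equalityI subsetI)
    fix B assume "B \<in> (\<lambda>x. cayley x ** A) ` S"
    then obtain x where x: "x \<in> S" "B = cayley x ** A"
      by blast
    have "1 + trace (cayley x) \<noteq> 0"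
      using one_plus_inner_pos[of x] by (simp add: trace_cayley)
    then have "trace (cayley x) \<noteq> -1"
      by auto
    then show "B \<in> carrier SO3 \<inter> (\<lambda>B. B ** transpose A) -` (?T \<inter> cayley_inv -` S)"
      using x A by (simp add: SO3_cancel SO3_mult cayley_SO3 cayley_inv_cayley)
  next
    fix B assume B: "B \<in> carrier SO3 \<inter> (\<lambda>B. B ** transpose A) -` (?T \<inter> cayley_inv -` S)"
    then have "cayley (cayley_inv (B ** transpose A)) = B ** transpose A"
      by (intro cayley_cayley_inv SO3_mult SO3_transpose A) auto
    then have "B = cayley (cayley_inv (B ** transpose A)) ** A"
      using A by (simp add: SO3_cancel)
    then show "B \<in> (\<lambda>x. cayley x ** A) ` S"
      using B by (intro image_eqI[of _ _ "cayley_inv (B ** transpose A)"]) auto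
  qed
  ultimately show ?thesis
    unfolding SO3_topology_def by (metis openin_open)
qed

lemma second_countable_euclidean: "second_countable (euclidean :: 'a::second_countable_topology topology)"
proof -
  obtain \<B> :: "'a set set" where \<B>: "countable \<B>" "\<And>C. C \<in> \<B> \<Longrightarrow> open C"
      "\<And>S. open S \<Longrightarrow> \<exists>\<U>. \<U> \<subseteq> \<B> \<and> S = \<Union>\<U>"
    using univ_second_countable by blast
  have "\<exists>V\<in>\<B>. x \<in> V \<and> V \<subseteq> S" if S: "open S" "x \<in> S" for S x
  proof -
    obtain \<U> where "\<U> \<subseteq> \<B>" "S = \<Union>\<U>"
      using \<B>(3)[OF S(1)] by blast
    then show ?thesis
      using S(2) by blast
  qed
  then show ?thesis
    unfolding second_countable_def using \<B>(1,2) by (intro exI[of _ \<B>]) auto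
qed

text \<open>A homeomorphism from space onto the ball of radius \<open>r\<close>. Composing with it turns maps that
  are injective on a ball into embeddings of the whole space.\<close>

definition squash :: "real \<Rightarrow> real^3 \<Rightarrow> real^3"
  where "squash r w = (r / (1 + norm w)) *\<^sub>R w"

lemma one_plus_norm_pos: "1 + norm w > 0"
  by (simp add: add_pos_nonneg)

lemma continuous_on_squash: "continuous_on S (squash r)"
  unfolding squash_def[abs_def] using one_plus_norm_pos
  by (intro continuous_intros ballI) (rule less_imp_neq[symmetric])

lemma squash_0: "squash r 0 = 0"
  by (simp add: squash_def)

lemma norm_squash: "r > 0 \<Longrightarrow> norm (squash r w) = r * norm w / (1 + norm w)"
  using one_plus_norm_pos[of w] by (simp add: squash_def)

lemma norm_squash_less: "r > 0 \<Longrightarrow> norm (squash r w) < r"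
  using one_plus_norm_pos[of w] by (simp add: norm_squash field_simps)

lemma squash_inverse: "r > 0 \<Longrightarrow> (1 / (r - norm (squash r w))) *\<^sub>R squash r w = w"
proof -
  assume r: "r > 0"
  have "r - norm (squash r w) = r / (1 + norm w)"
    using r one_plus_norm_pos[of w] by (simp add: norm_squash field_simps)
  then show ?thesis
    using r one_plus_norm_pos[of w] by (simp add: squash_def)
qed

lemma inj_squash: "r > 0 \<Longrightarrow> inj (squash r)"
  by (rule inj_on_inverseI) (rule squash_inverse)

lemma open_squash_image:
  assumes "r > 0" "open S"
  shows "open (squash r ` S)"
  by (rule invariance_of_domain[OF continuous_on_squash assms(2)])
     (rule inj_on_subset[OF inj_squash[OF assms(1)]], simp)

lemma norm_squash_less_half: "r > 0 \<Longrightarrow> norm (squash r w) < r / 2 \<longleftrightarrow> norm w < 1"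
  using one_plus_norm_pos[of w] by (simp add: norm_squash field_simps)

lemma squash_eq_0_iff: "r > 0 \<Longrightarrow> squash r w = 0 \<longleftrightarrow> w = 0"
  using one_plus_norm_pos[of w] by (simp add: squash_def)

lemma squash_surj_ball:
  assumes "r > 0" "norm u < r"
  obtains w where "squash r w = u"
proof -
  define w where "w = (1 / (r - norm u)) *\<^sub>R u"
  have "norm w = norm u / (r - norm u)"
    using assms by (simp add: w_def)
  then have "1 + norm w = r / (r - norm u)"
    using assms by (simp add: field_simps)
  then have "r / (1 + norm w) = r - norm u"
    using assms by simp
  then have "squash r w = u"
    unfolding squash_def using assms by (simp add: w_def)
  then show thesis
    by (rule that)
qed

lemma squash_image_ball:
  assumes r: "r > 0"
  shows "squash r ` ball 0 1 = ball 0 (r / 2)"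
proof (intro equalityI subsetI)
  fix u :: "real^3" assume "u \<in> ball 0 (r / 2)"
  then have u: "norm u < r / 2" "norm u < r"
    using r by auto
  obtain w where w: "squash r w = u"
    using squash_surj_ball[OF r u(2)] .
  then show "u \<in> squash r ` ball 0 1"
    using u(1) norm_squash_less_half[OF r, of w] by (intro image_eqI[of _ _ w]) auto
next
  fix u assume "u \<in> squash r ` ball 0 1"
  then obtain w where "norm w < 1" "u = squash r w"
    by auto
  then have "norm u < r / 2"
    using norm_squash_less_half[OF r, of w] by blast
  then show "u \<in> ball 0 (r / 2)"
    by simp
qed

locale misorientation =
  fixes G\<^sub>1 G\<^sub>2 :: "(real^3^3) set"
  assumes G1: "subgroup G\<^sub>1 SO3" "finite G\<^sub>1" and G2: "subgroup G\<^sub>2 SO3" "finite G\<^sub>2"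
begin

lemma G1_SO3: "g \<in> G\<^sub>1 \<Longrightarrow> g \<in> carrier SO3" and G2_SO3: "g \<in> G\<^sub>2 \<Longrightarrow> g \<in> carrier SO3"
  by (rule subgroup.mem_carrier[OF G1(1)] subgroup.mem_carrier[OF G2(1)], assumption)+

lemma G1_mult: "g \<in> G\<^sub>1 \<Longrightarrow> h \<in> G\<^sub>1 \<Longrightarrow> g ** h \<in> G\<^sub>1" and G2_mult: "g \<in> G\<^sub>2 \<Longrightarrow> h \<in> G\<^sub>2 \<Longrightarrow> g ** h \<in> G\<^sub>2"
  using subgroup.m_closed[OF G1(1)] subgroup.m_closed[OF G2(1)] by (simp_all add: SO3_def)

lemma one_G1: "mat 1 \<in> G\<^sub>1" and one_G2: "mat 1 \<in> G\<^sub>2"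
  using subgroup.one_closed[OF G1(1)] subgroup.one_closed[OF G2(1)] by (simp_all add: SO3_def)

lemma G1_transpose: "g \<in> G\<^sub>1 \<Longrightarrow> transpose g \<in> G\<^sub>1" and G2_transpose: "g \<in> G\<^sub>2 \<Longrightarrow> transpose g \<in> G\<^sub>2"
  using subgroup.m_inv_closed[OF G1(1), of g] subgroup.m_inv_closed[OF G2(1), of g]
    inv_SO3[OF G1_SO3] inv_SO3[OF G2_SO3] by simp_all

abbreviation X :: "(real^3^3) set topology"
  where "X \<equiv> misorientation_space G\<^sub>1 G\<^sub>2"

definition proj :: "real^3^3 \<Rightarrow> (real^3^3) set"
  where "proj = orbit (SO3\<lparr>carrier := G\<^sub>1\<rparr> \<times>\<times> SO3\<lparr>carrier := G\<^sub>2\<rparr>) misorientation_action"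

lemma X_eq: "X = quotient_topology SO3_topology proj"
  by (simp add: misorientation_space_def orbit_space_def proj_def)

lemma topspace_SO3: "topspace SO3_topology = carrier SO3"
  by (simp add: SO3_topology_def)

lemma topspace_X: "topspace X = proj ` carrier SO3"
  by (simp add: X_eq topspace_SO3)

lemma quotient_proj: "quotient_map SO3_topology X proj"
  unfolding X_eq by (rule quotient_map_quotient_topology)

lemma continuous_proj: "continuous_map SO3_topology X proj"
  using quotient_proj by (rule quotient_imp_continuous_map)

lemma proj_eq:
  assumes "A \<in> carrier SO3"
  shows "proj A = {g ** A ** transpose h | g h. g \<in> G\<^sub>1 \<and> h \<in> G\<^sub>2}"
proof -
  have "misorientation_action (g, h) A = g ** A ** transpose h" if "h \<in> G\<^sub>2" for g h
    using assms that inv_SO3[OF G2_SO3[OF that]] by (simp add: misorientation_action_def) (simp add: SO3_def)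
  then have "misorientation_action x A = fst x ** A ** transpose (snd x)" if "snd x \<in> G\<^sub>2" for x
    using that by (metis prod.collapse)
  then show ?thesis
    unfolding proj_def orbit_def by (auto simp: DirProd_def) (metis fst_conv mem_Sigma_iff snd_conv)+
qed

lemma act_SO3: "A \<in> carrier SO3 \<Longrightarrow> g \<in> G\<^sub>1 \<Longrightarrow> h \<in> G\<^sub>2 \<Longrightarrow> g ** A ** transpose h \<in> carrier SO3"
  by (simp add: SO3_mult SO3_transpose G1_SO3 G2_SO3)

lemma proj_act_subset:
  assumes A: "A \<in> carrier SO3" and g: "g \<in> G\<^sub>1" and h: "h \<in> G\<^sub>2"
  shows "proj (g ** A ** transpose h) \<subseteq> proj A"
proof
  fix B assume "B \<in> proj (g ** A ** transpose h)"
  then obtain g' h' where g': "g' \<in> G\<^sub>1" "h' \<in> G\<^sub>2" "B = g' ** (g ** A ** transpose h) ** transpose h'"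
    unfolding proj_eq[OF act_SO3[OF A g h]] by blast
  have "B = (g' ** g) ** A ** transpose (h' ** h)"
    unfolding g'(3) by (simp add: matrix_transpose_mul matrix_mul_assoc)
  then show "B \<in> proj A"
    unfolding proj_eq[OF A] using g'(1,2) g h G1_mult G2_mult by blast
qed

lemma proj_act:
  assumes A: "A \<in> carrier SO3" and g: "g \<in> G\<^sub>1" and h: "h \<in> G\<^sub>2"
  shows "proj (g ** A ** transpose h) = proj A"
proof
  have "transpose g ** (g ** A ** transpose h) ** transpose (transpose h) = A"
    by (simp add: SO3_cancel[OF G2_SO3[OF h]] SO3_cancel[OF G1_SO3[OF g]] flip: matrix_mul_assoc[of g])
  then show "proj A \<subseteq> proj (g ** A ** transpose h)"
    using proj_act_subset[OF act_SO3[OF A g h] G1_transpose[OF g] G2_transpose[OF h]] by simp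
qed (rule proj_act_subset[OF assms])

lemma proj_eq_iff:
  assumes A: "A \<in> carrier SO3" and B: "B \<in> carrier SO3"
  shows "proj A = proj B \<longleftrightarrow> (\<exists>g\<in>G\<^sub>1. \<exists>h\<in>G\<^sub>2. B = g ** A ** transpose h)"
proof
  assume eq: "proj A = proj B"
  have "B = mat 1 ** B ** transpose (mat 1)"
    by (simp add: transpose_mat)
  then have "B \<in> proj A"
    unfolding eq proj_eq[OF B] using one_G1 one_G2 by blast
  then show "\<exists>g\<in>G\<^sub>1. \<exists>h\<in>G\<^sub>2. B = g ** A ** transpose h"
    unfolding proj_eq[OF A] by blast
qed (auto simp: proj_act[OF A])

lemma continuous_map_act:
  assumes "g \<in> G\<^sub>1" "h \<in> G\<^sub>2"
  shows "continuous_map SO3_topology SO3_topology (\<lambda>A. g ** A ** transpose h)"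
  unfolding SO3_topology_def continuous_map_in_subtopology
  using act_SO3 assms by (auto intro!: continuous_on_matrix_mult continuous_intros)

lemma proj_preimage_image:
  assumes "S \<subseteq> carrier SO3"
  shows "{A \<in> carrier SO3. proj A \<in> proj ` S}
    = (\<Union>p\<in>G\<^sub>1 \<times> G\<^sub>2. {A \<in> carrier SO3. fst p ** A ** transpose (snd p) \<in> S})"
proof (intro equalityI subsetI)
  fix A assume "A \<in> {A \<in> carrier SO3. proj A \<in> proj ` S}"
  then obtain B where A: "A \<in> carrier SO3" and B: "B \<in> S" "proj A = proj B"
    by blast
  then obtain g h where "g \<in> G\<^sub>1" "h \<in> G\<^sub>2" "B = g ** A ** transpose h"
    using proj_eq_iff[OF A, of B] assms by blast
  then show "A \<in> (\<Union>p\<in>G\<^sub>1 \<times> G\<^sub>2. {A \<in> carrier SO3. fst p ** A ** transpose (snd p) \<in> S})"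
    using A B by (intro UN_I[of "(g, h)"]) auto
next
  fix A assume "A \<in> (\<Union>p\<in>G\<^sub>1 \<times> G\<^sub>2. {A \<in> carrier SO3. fst p ** A ** transpose (snd p) \<in> S})"
  then obtain g h where A: "A \<in> carrier SO3" "g \<in> G\<^sub>1" "h \<in> G\<^sub>2" "g ** A ** transpose h \<in> S"
    by auto
  then show "A \<in> {A \<in> carrier SO3. proj A \<in> proj ` S}"
    using proj_act[OF A(1-3)] by (auto intro: image_eqI[of _ _ "g ** A ** transpose h"])
qed

lemma open_map_proj: "open_map SO3_topology X proj"
  unfolding open_map_def
proof (intro allI impI)
  fix S assume S: "openin SO3_topology S"
  then have sub: "S \<subseteq> carrier SO3"
    using openin_subset topspace_SO3 by blast
  have "openin SO3_topology {A \<in> carrier SO3. fst p ** A ** transpose (snd p) \<in> S}" if "p \<in> G\<^sub>1 \<times> G\<^sub>2" for p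
    using openin_continuous_map_preimage[OF continuous_map_act S, of "fst p" "snd p"] that
    by (auto simp: topspace_SO3)
  then have "openin SO3_topology {A \<in> carrier SO3. proj A \<in> proj ` S}"
    unfolding proj_preimage_image[OF sub] by (intro openin_Union) auto
  then show "openin X (proj ` S)"
    using sub by (simp add: X_eq openin_quotient_topology topspace_SO3 image_mono)
qed

lemma closed_map_proj: "closed_map SO3_topology X proj"
  unfolding closed_map_def
proof (intro allI impI)
  fix S assume S: "closedin SO3_topology S"
  then have sub: "S \<subseteq> carrier SO3"
    using closedin_subset topspace_SO3 by blast
  have "closedin SO3_topology {A \<in> carrier SO3. fst p ** A ** transpose (snd p) \<in> S}" if "p \<in> G\<^sub>1 \<times> G\<^sub>2" for p
    using closedin_continuous_map_preimage[OF continuous_map_act S, of "fst p" "snd p"] that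
    by (auto simp: topspace_SO3)
  then have "closedin SO3_topology {A \<in> carrier SO3. proj A \<in> proj ` S}"
    unfolding proj_preimage_image[OF sub] using G1(2) G2(2) by (intro closedin_Union) auto
  moreover have "proj ` S \<subseteq> topspace X"
    using sub by (auto simp: topspace_X)
  ultimately show "closedin X (proj ` S)"
    using quotient_proj unfolding quotient_map_closedin topspace_SO3 by blast
qed

lemma Hausdorff_X: "Hausdorff_space X"
proof (rule normal_t1_imp_Hausdorff_space)
  have met: "metrizable_space SO3_topology"
    unfolding SO3_topology_def by (intro metrizable_space_subtopology metrizable_space_euclidean)
  show "normal_space X"
    by (rule normal_space_continuous_closed_map_image[OF _ continuous_proj closed_map_proj])
       (simp_all add: metrizable_imp_normal_space[OF met] topspace_SO3 topspace_X)
  show "t1_space X"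
    unfolding t1_space_closedin_singleton
  proof
    fix y assume "y \<in> topspace X"
    then obtain A where A: "A \<in> carrier SO3" "y = proj A"
      by (auto simp: topspace_X)
    have "closedin SO3_topology {A}"
      unfolding SO3_topology_def using A(1) by (simp add: closed_closedin closedin_subset_topspace)
    then have "closedin X (proj ` {A})"
      by (rule closed_map_proj[unfolded closed_map_def, rule_format])
    then show "closedin X {y}"
      by (simp add: A)
  qed
qed

lemma compact_X: "compact_space X"
proof -
  have "compactin SO3_topology (carrier SO3)"
    unfolding SO3_topology_def using compact_SO3 by (simp add: compactin_subtopology)
  from image_compactin[OF this continuous_proj] show ?thesis
    by (simp add: compact_space_def topspace_X)
qed

lemma second_countable_X: "second_countable X"
proof (rule second_countable_open_map_image[OF continuous_proj open_map_proj])
  show "second_countable SO3_topology"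
    unfolding SO3_topology_def by (intro second_countable_subtopology second_countable_euclidean)
qed (simp add: topspace_SO3 topspace_X)

text \<open>Coordinates around \<open>proj A\<close>. They are a chart only if no other element of the group fixes
  \<open>A\<close>; in general they have to be divided by \<open>stab A\<close>.\<close>

definition \<Phi> :: "real^3^3 \<Rightarrow> real^3 \<Rightarrow> (real^3^3) set"
  where "\<Phi> A x = proj (cayley x ** A)"

lemma \<Phi>_0: "\<Phi> A 0 = proj A"
  by (simp add: \<Phi>_def cayley_0)

lemma continuous_map_\<Phi>:
  assumes A: "A \<in> carrier SO3"
  shows "continuous_map euclidean X (\<Phi> A)"
proof -
  have "continuous_map euclidean SO3_topology (\<lambda>x. cayley x ** A)"
    unfolding SO3_topology_def continuous_map_in_subtopology using A
    by (auto simp: SO3_mult cayley_SO3 intro!: continuous_on_matrix_mult continuous_on_cayley continuous_intros)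
  from continuous_map_compose[OF this continuous_proj] show ?thesis
    by (simp add: \<Phi>_def[abs_def] o_def)
qed

lemma \<Phi>_topspace: "A \<in> carrier SO3 \<Longrightarrow> \<Phi> A x \<in> topspace X"
  by (simp add: \<Phi>_def topspace_X SO3_mult cayley_SO3)

lemma open_\<Phi>_image:
  assumes A: "A \<in> carrier SO3" and S: "open S"
  shows "openin X (\<Phi> A ` S)"
proof -
  have "openin X (proj ` (\<lambda>x. cayley x ** A) ` S)"
    using open_map_proj open_map_cayley_mult[OF A S] unfolding open_map_def by blast
  then show ?thesis
    by (simp add: \<Phi>_def[abs_def] image_image)
qed

text \<open>The stabiliser of \<open>A\<close>, projected to the first factor. The projection is injective because
  \<open>g ** A ** transpose h = A\<close> forces \<open>h = transpose A ** g ** A\<close>.\<close>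

definition stab :: "real^3^3 \<Rightarrow> (real^3^3) set"
  where "stab A = {g \<in> G\<^sub>1. transpose A ** g ** A \<in> G\<^sub>2}"

lemma stab_SO3: "g \<in> stab A \<Longrightarrow> g \<in> carrier SO3"
  by (simp add: stab_def G1_SO3)

lemma finite_stab: "finite (stab A)"
  using G1(2) by (simp add: stab_def)

lemma subgroup_stab:
  assumes A: "A \<in> carrier SO3"
  shows "subgroup (stab A) SO3"
proof
  show "stab A \<subseteq> carrier SO3"
    using stab_SO3 by blast
  show "g \<otimes>\<^bsub>SO3\<^esub> h \<in> stab A" if "g \<in> stab A" "h \<in> stab A" for g h
  proof -
    have "transpose A ** (g ** h) ** A = (transpose A ** g ** A) ** (transpose A ** h ** A)"
      by (metis A SO3_cancel(2) matrix_mul_assoc)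
    then show ?thesis
      using that by (simp add: stab_def G1_mult G2_mult SO3_def)
  qed
  show "\<one>\<^bsub>SO3\<^esub> \<in> stab A"
    using one_G1 one_G2 SO3_transpose[OF A] by (simp add: stab_def SO3_def)
  show "inv\<^bsub>SO3\<^esub> g \<in> stab A" if g: "g \<in> stab A" for g
  proof -
    have "transpose A ** transpose g ** A = transpose (transpose A ** g ** A)"
      by (simp add: matrix_transpose_mul matrix_mul_assoc)
    then show ?thesis
      using g G1_transpose G2_transpose inv_SO3[OF stab_SO3[OF g]] by (simp add: stab_def)
  qed
qed

lemma \<Phi>_stab:
  assumes A: "A \<in> carrier SO3" and h: "h \<in> stab A"
  shows "\<Phi> A (h *v x) = \<Phi> A x"
proof -
  have "h ** (cayley x ** A) ** transpose (transpose A ** h ** A) = cayley (h *v x) ** A"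
    unfolding cayley_conj[OF stab_SO3[OF h]]
    by (simp add: matrix_transpose_mul flip: matrix_mul_assoc) (simp add: SO3_cancel[OF A] matrix_mul_assoc)
  then show ?thesis
    using proj_act[of "cayley x ** A" h "transpose A ** h ** A"] h A
    by (simp add: \<Phi>_def stab_def SO3_mult cayley_SO3)
qed

text \<open>Group elements that do not fix \<open>A\<close> move the neighbourhood of radius \<open>r\<close> off itself.\<close>

definition isolating :: "real^3^3 \<Rightarrow> real \<Rightarrow> bool"
  where "isolating A r \<longleftrightarrow> (\<forall>x y g h. norm x < r \<longrightarrow> norm y < r \<longrightarrow> g \<in> G\<^sub>1 \<longrightarrow> h \<in> G\<^sub>2 \<longrightarrow>
    cayley y ** A = g ** (cayley x ** A) ** transpose h \<longrightarrow> A = g ** A ** transpose h)"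

text \<open>Only finitely many group elements have to be considered, and each that moves \<open>A\<close> separates
  sufficiently small neighbourhoods of \<open>A\<close> from their images.\<close>

lemma isolating_exists: "\<exists>r>0. isolating A r"
proof -
  let ?f = "\<lambda>g h p. cayley (snd p) ** A - g ** (cayley (fst p) ** A) ** transpose h"
  have "\<forall>\<^sub>F p in nhds 0. ?f (fst k) (snd k) p = 0 \<longrightarrow> A = fst k ** A ** transpose (snd k)"
    if "k \<in> G\<^sub>1 \<times> G\<^sub>2" for k
  proof (cases "A = fst k ** A ** transpose (snd k)")
    case False
    have "continuous_on UNIV (\<lambda>p :: (real^3) \<times> (real^3). cayley (fst p))"
      "continuous_on UNIV (\<lambda>p :: (real^3) \<times> (real^3). cayley (snd p))"
      using continuous_on_compose[OF continuous_on_fst[OF continuous_on_id] continuous_on_cayley]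
        continuous_on_compose[OF continuous_on_snd[OF continuous_on_id] continuous_on_cayley]
      by (simp_all add: o_def)
    then have "open {p. ?f (fst k) (snd k) p \<noteq> 0}"
      by (intro open_Collect_neq continuous_on_matrix_mult continuous_intros)
    moreover have "0 \<in> {p. ?f (fst k) (snd k) p \<noteq> 0}"
      using False by (simp add: cayley_0)
    ultimately have "\<forall>\<^sub>F p in nhds 0. p \<in> {p. ?f (fst k) (snd k) p \<noteq> 0}"
      by (rule eventually_nhds_in_open)
    then show ?thesis
      by eventually_elim simp
  qed simp
  then have "\<forall>\<^sub>F p in nhds 0. \<forall>k\<in>G\<^sub>1 \<times> G\<^sub>2. ?f (fst k) (snd k) p = 0 \<longrightarrow> A = fst k ** A ** transpose (snd k)"
    using G1(2) G2(2) by (intro eventually_ball_finite) auto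
  then obtain d where d: "d > 0"
    "\<And>p. dist p 0 < d \<Longrightarrow> \<forall>k\<in>G\<^sub>1 \<times> G\<^sub>2. ?f (fst k) (snd k) p = 0 \<longrightarrow> A = fst k ** A ** transpose (snd k)"
    unfolding eventually_nhds_metric by blast
  have "isolating A (d / 2)"
    unfolding isolating_def
  proof (intro allI impI)
    fix x y g h
    assume xy: "norm x < d / 2" "norm y < d / 2" and gh: "g \<in> G\<^sub>1" "h \<in> G\<^sub>2"
      and eq: "cayley y ** A = g ** (cayley x ** A) ** transpose h"
    have "norm (x, y) < d"
      using norm_Pair_le[of x y] xy by linarith
    then have "dist (x, y) 0 < d"
      by simp
    from bspec[OF d(2)[OF this], of "(g, h)"] gh eq show "A = g ** A ** transpose h"
      by simp
  qed
  then show ?thesis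
    using d(1) half_gt_zero by blast
qed

definition radius :: "real^3^3 \<Rightarrow> real"
  where "radius A = (SOME r. r > 0 \<and> isolating A r)"

lemma radius_pos: "radius A > 0" and isolating_radius: "isolating A (radius A)"
  using someI_ex[OF isolating_exists[of A], folded radius_def] by simp_all

lemma fixed_imp_stab:
  assumes A: "A \<in> carrier SO3" and g: "g \<in> G\<^sub>1" and h: "h \<in> G\<^sub>2" and eq: "A = g ** A ** transpose h"
  shows "g \<in> stab A" "h = transpose A ** g ** A"
proof -
  have "A ** h = g ** A"
    using eq SO3_cancel(3)[OF G2_SO3[OF h], of "g ** A"] by simp
  then show "h = transpose A ** g ** A"
    using SO3_cancel(1)[OF A, of h] by (simp add: matrix_mul_assoc)
  then show "g \<in> stab A"
    using g h by (simp add: stab_def)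
qed

lemma \<Phi>_eq_imp:
  assumes A: "A \<in> carrier SO3" and xy: "norm x < radius A" "norm y < radius A"
    and eq: "\<Phi> A x = \<Phi> A y"
  obtains h where "h \<in> stab A" "y = h *v x"
proof -
  have "cayley x ** A \<in> carrier SO3" "cayley y ** A \<in> carrier SO3"
    by (simp_all add: A SO3_mult cayley_SO3)
  then obtain g h where gh: "g \<in> G\<^sub>1" "h \<in> G\<^sub>2" "cayley y ** A = g ** (cayley x ** A) ** transpose h"
    using eq unfolding \<Phi>_def by (auto simp: proj_eq_iff)
  have "A = g ** A ** transpose h"
    by (rule isolating_radius[unfolded isolating_def, rule_format, OF xy gh])
  note st = fixed_imp_stab[OF A gh(1,2) this]
  have "cayley y ** A = g ** cayley x ** transpose g ** A"
    unfolding gh(3) st(2)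
    by (simp add: matrix_transpose_mul flip: matrix_mul_assoc) (simp add: SO3_cancel[OF A] matrix_mul_assoc)
  then have "cayley y ** A ** transpose A = cayley (g *v x) ** A ** transpose A"
    by (simp add: cayley_conj[OF G1_SO3[OF gh(1)]])
  then have "cayley y = cayley (g *v x)"
    by (simp add: SO3_cancel[OF A])
  then have "y = g *v x"
    by (metis cayley_inv_cayley)
  then show thesis
    using that st(1) by blast
qed

text \<open>The free orbits; \<open>proj\<close> is a covering over them.\<close>

definition regular :: "(real^3^3) set set"
  where "regular = proj ` {A \<in> carrier SO3. stab A = {mat 1}}"

lemma stab_act_trivial:
  assumes A: "A \<in> carrier SO3" and g: "g \<in> G\<^sub>1" and h: "h \<in> G\<^sub>2" and triv: "stab A = {mat 1}"
  shows "stab (g ** A ** transpose h) = {mat 1}"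
proof (intro equalityI subsetI)
  fix k assume k: "k \<in> stab (g ** A ** transpose h)"
  have "transpose (g ** A ** transpose h) ** k ** (g ** A ** transpose h)
      = h ** (transpose A ** (transpose g ** k ** g) ** A) ** transpose h"
    by (simp add: matrix_transpose_mul matrix_mul_assoc)
  then have "h ** (transpose A ** (transpose g ** k ** g) ** A) ** transpose h \<in> G\<^sub>2"
    using k by (simp add: stab_def)
  then have "transpose h ** (h ** (transpose A ** (transpose g ** k ** g) ** A) ** transpose h) ** h \<in> G\<^sub>2"
    by (rule G2_mult[OF G2_mult[OF G2_transpose[OF h]] h])
  then have "transpose A ** (transpose g ** k ** g) ** A \<in> G\<^sub>2"
    by (simp add: SO3_cancel(1,2)[OF G2_SO3[OF h]] SO3_transpose[OF G2_SO3[OF h]] flip: matrix_mul_assoc)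
  then have "transpose g ** k ** g \<in> stab A"
    using k g by (auto simp: stab_def intro!: G1_mult G1_transpose)
  then have "transpose g ** k ** g = mat 1"
    using triv by simp
  then have "g ** (transpose g ** k ** g) ** transpose g = g ** mat 1 ** transpose g"
    by (rule arg_cong)
  then have "k = mat 1"
    by (simp add: SO3_cancel(1,2)[OF G1_SO3[OF g]] SO3_transpose[OF G1_SO3[OF g]] flip: matrix_mul_assoc)
  then show "k \<in> {mat 1}"
    by simp
next
  fix k assume "k \<in> {mat 1 :: real^3^3}"
  then show "k \<in> stab (g ** A ** transpose h)"
    using subgroup.one_closed[OF subgroup_stab[OF act_SO3[OF A g h]]] by (simp add: SO3_def)
qed

lemma regular_iff:
  assumes A: "A \<in> carrier SO3"
  shows "proj A \<in> regular \<longleftrightarrow> stab A = {mat 1}"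
proof
  assume "proj A \<in> regular"
  then obtain B where B: "B \<in> carrier SO3" "stab B = {mat 1}" "proj B = proj A"
    by (auto simp: regular_def)
  then obtain g h where "g \<in> G\<^sub>1" "h \<in> G\<^sub>2" "A = g ** B ** transpose h"
    using proj_eq_iff[OF B(1) A] by blast
  then show "stab A = {mat 1}"
    using stab_act_trivial[OF B(1) _ _ B(2)] by blast
qed (use A in \<open>auto simp: regular_def\<close>)

lemma stab_\<Phi>:
  assumes A: "A \<in> carrier SO3" and x: "norm x < radius A"
  shows "stab (cayley x ** A) = {h \<in> stab A. h *v x = x}"
proof (intro equalityI subsetI)
  let ?C = "cayley x ** A"
  have C: "?C \<in> carrier SO3"
    by (simp add: A SO3_mult cayley_SO3)
  fix g assume g: "g \<in> stab ?C"
  define h where "h = transpose ?C ** g ** ?C"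
  have gG: "g \<in> G\<^sub>1" "h \<in> G\<^sub>2"
    using g by (simp_all add: stab_def h_def)
  have eqC: "?C = g ** ?C ** transpose h"
    by (simp add: h_def matrix_transpose_mul flip: matrix_mul_assoc)
       (simp add: SO3_cancel[OF A] SO3_cancel[OF cayley_SO3] SO3_cancel[OF G1_SO3[OF gG(1)]])
  have "A = g ** A ** transpose h"
    by (rule isolating_radius[unfolded isolating_def, rule_format, OF x x gG eqC])
  note st = fixed_imp_stab[OF A gG this]
  have "?C = g ** cayley x ** transpose g ** A"
    by (subst eqC, subst st(2))
       (simp add: matrix_transpose_mul flip: matrix_mul_assoc, simp add: SO3_cancel[OF A] matrix_mul_assoc)
  then have "?C ** transpose A = cayley (g *v x) ** A ** transpose A"
    by (simp add: cayley_conj[OF G1_SO3[OF gG(1)]])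
  then have "cayley x = cayley (g *v x)"
    by (simp add: SO3_cancel[OF A])
  then have "g *v x = x"
    by (metis cayley_inv_cayley)
  then show "g \<in> {h \<in> stab A. h *v x = x}"
    using st(1) by simp
next
  fix g assume "g \<in> {h \<in> stab A. h *v x = x}"
  then have g: "g \<in> stab A" "g *v x = x"
    by auto
  have "cayley x = g ** cayley x ** transpose g"
    using cayley_conj[OF stab_SO3[OF g(1)], of x] g(2) by simp
  then have "cayley x ** g = g ** cayley x"
    using SO3_cancel(3)[OF stab_SO3[OF g(1)], of "g ** cayley x"] by simp
  then have "transpose (cayley x) ** (g ** cayley x) = g"
    using SO3_cancel(1)[OF cayley_SO3[of x], of g] by simp
  then have "transpose (cayley x ** A) ** g ** (cayley x ** A) = transpose A ** g ** A"
    by (simp add: matrix_transpose_mul flip: matrix_mul_assoc) (simp add: matrix_mul_assoc)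
  then show "g \<in> stab (cayley x ** A)"
    using g(1) by (simp add: stab_def)
qed

lemma regular_\<Phi>_iff:
  assumes A: "A \<in> carrier SO3" and x: "norm x < radius A"
  shows "\<Phi> A x \<in> regular \<longleftrightarrow> (\<forall>h\<in>stab A. h *v x = x \<longrightarrow> h = mat 1)"
proof -
  have "mat 1 \<in> stab A"
    using subgroup.one_closed[OF subgroup_stab[OF A]] by (simp add: SO3_def)
  then show ?thesis
    unfolding \<Phi>_def regular_iff[OF SO3_mult[OF cayley_SO3 A]] stab_\<Phi>[OF A x] by auto
qed

text \<open>On small balls the map \<open>\<Phi> A\<close> and the quotient map \<open>F\<close> by \<open>stab A\<close> have the same fibres and
  are both open, so \<open>\<Phi> A\<close> factors through \<open>F\<close> and an embedding. As \<open>F\<close> preserves norms, chart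
  balls correspond to balls in the domain of \<open>\<Phi> A\<close>, in which the points over singular orbits
  form finitely many lines.\<close>

lemma chart_exists:
  assumes A: "A \<in> carrier SO3"
  obtains \<psi> :: "real^3 \<Rightarrow> (real^3^3) set"
  where "open_embedding \<psi> X" "\<psi> 0 = proj A" "connectedin X (\<psi> ` ball 0 1 \<inter> regular)"
proof -
  let ?r = "radius A"
  have r: "?r > 0"
    by (rule radius_pos)
  obtain F :: "real^3 \<Rightarrow> real^3" where F: "continuous_on UNIV F" "\<And>S. open S \<Longrightarrow> open (F ` S)" "surj F"
      "\<And>x. norm (F x) = norm x" "\<And>x y. F x = F y \<longleftrightarrow> (\<exists>h\<in>stab A. y = h *v x)"
    by (rule rotation_quotient_map[OF subgroup_stab[OF A] finite_stab]) (blast intro: that)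
  \<comment> \<open>A section of \<open>F\<close>. It need not be continuous, but \<open>\<Phi> A \<circ> s\<close> does not depend on its
    choice.\<close>
  define s where "s w = (SOME x. F x = squash ?r w)" for w
  have s: "F (s w) = squash ?r w" for w
    unfolding s_def by (rule someI_ex) (metis F(3) surjD)
  have small: "norm x < ?r" if "F x = squash ?r w" for x w
    using norm_squash_less[OF r, of w] F(4)[of x] that by simp
  define \<psi> where "\<psi> w = \<Phi> A (s w)" for w
  have \<psi>: "\<psi> w = \<Phi> A x" if x: "F x = squash ?r w" for x w
  proof -
    have "F (s w) = F x"
      using s x by simp
    then obtain h where "h \<in> stab A" "x = h *v s w"
      using F(5) by blast
    then show ?thesis
      by (simp add: \<psi>_def \<Phi>_stab[OF A])
  qed
  have \<psi>_image: "\<psi> ` S = \<Phi> A ` (F -` (squash ?r ` S))" for S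
  proof (intro equalityI subsetI)
    fix y assume "y \<in> \<psi> ` S"
    then obtain w where "w \<in> S" "y = \<Phi> A (s w)"
      by (auto simp: \<psi>_def)
    then show "y \<in> \<Phi> A ` (F -` (squash ?r ` S))"
      using s by auto
  next
    fix y assume "y \<in> \<Phi> A ` (F -` (squash ?r ` S))"
    then obtain x w where x: "y = \<Phi> A x" "w \<in> S" "F x = squash ?r w"
      by auto
    then have "y = \<psi> w"
      using \<psi> by simp
    then show "y \<in> \<psi> ` S"
      using x(2) by blast
  qed
  show thesis
  proof (rule that[of \<psi>])
    show "open_embedding \<psi> X"
      unfolding open_embedding_def
    proof (intro conjI)
      show "continuous_map euclidean X \<psi>"
        unfolding continuous_map_def
      proof (intro conjI allI impI)
        show "\<psi> \<in> topspace euclidean \<rightarrow> topspace X"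
          by (simp add: \<psi>_def \<Phi>_topspace[OF A])
        fix W assume W: "openin X W"
        have "open {x. \<Phi> A x \<in> W}"
          using openin_continuous_map_preimage[OF continuous_map_\<Phi>[OF A] W] by simp
        then have "open (F ` {x. \<Phi> A x \<in> W})"
          by (rule F(2))
        then have "open (squash ?r -` (F ` {x. \<Phi> A x \<in> W}))"
          by (rule open_vimage) (rule continuous_on_squash)
        moreover have "squash ?r -` (F ` {x. \<Phi> A x \<in> W}) = {w. \<psi> w \<in> W}"
        proof (intro equalityI subsetI)
          fix w assume "w \<in> squash ?r -` (F ` {x. \<Phi> A x \<in> W})"
          then obtain x where "squash ?r w = F x" "\<Phi> A x \<in> W"
            by auto
          then show "w \<in> {w. \<psi> w \<in> W}"
            using \<psi>[of x w] by simp
        next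
          fix w assume "w \<in> {w. \<psi> w \<in> W}"
          then show "w \<in> squash ?r -` (F ` {x. \<Phi> A x \<in> W})"
            using s[of w] by (auto simp: \<psi>_def intro!: image_eqI[of _ _ "s w"])
        qed
        ultimately show "openin euclidean {w \<in> topspace euclidean. \<psi> w \<in> W}"
          by simp
      qed
      show "open_map euclidean X \<psi>"
        unfolding open_map_def
      proof (intro allI impI)
        fix S :: "(real^3) set" assume "openin euclidean S"
        then have "open (squash ?r ` S)"
          using open_squash_image[OF r] by simp
        then have "open (F -` (squash ?r ` S))"
          by (rule open_vimage) (rule F(1))
        then show "openin X (\<psi> ` S)"
          unfolding \<psi>_image by (rule open_\<Phi>_image[OF A])
      qed
      show "inj \<psi>"
      proof (rule injI)
        fix w w' assume "\<psi> w = \<psi> w'"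
        then have "\<Phi> A (s w) = \<Phi> A (s w')"
          by (simp add: \<psi>_def)
        then obtain h where "h \<in> stab A" "s w' = h *v s w"
          by (rule \<Phi>_eq_imp[OF A small[OF s] small[OF s]])
        then have "F (s w) = F (s w')"
          using F(5) by blast
        then have "squash ?r w = squash ?r w'"
          by (simp add: s)
        then show "w = w'"
          using inj_squash[OF r] by (simp add: inj_eq)
      qed
    qed
    have "F 0 = squash ?r 0"
      using F(4)[of 0] by (simp add: squash_0)
    then show "\<psi> 0 = proj A"
      using \<psi> \<Phi>_0 by metis
    have "F -` ball 0 (?r / 2) = ball 0 (?r / 2)"
      using F(4) by auto
    then have ball: "\<psi> ` ball 0 1 = \<Phi> A ` ball 0 (?r / 2)"
      unfolding \<psi>_image squash_image_ball[OF r] by simp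
    obtain L where L: "finite L" "\<And>x. x \<in> (\<Union>a\<in>L. span {a}) \<longleftrightarrow> (\<exists>h\<in>stab A. h *v x = x \<and> h \<noteq> mat 1)"
      by (rule rotation_axes[OF finite_stab[of A] stab_SO3], assumption) (rule that)
    have reg: "\<Phi> A x \<in> regular \<longleftrightarrow> x \<notin> (\<Union>a\<in>L. span {a})" if "x \<in> ball 0 (?r / 2)" for x
    proof -
      have "norm x < ?r"
        using that r by simp
      then show ?thesis
        unfolding L(2) regular_\<Phi>_iff[OF A \<open>norm x < ?r\<close>] by blast
    qed
    have "\<psi> ` ball 0 1 \<inter> regular = \<Phi> A ` (ball 0 (?r / 2) - (\<Union>a\<in>L. span {a}))"
      unfolding ball
    proof -
      have "\<Phi> A ` B \<inter> regular = \<Phi> A ` (B - S)" if "\<And>x. x \<in> B \<Longrightarrow> \<Phi> A x \<in> regular \<longleftrightarrow> x \<notin> S" for B S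
        using that by blast
      then show "\<Phi> A ` ball 0 (?r / 2) \<inter> regular = \<Phi> A ` (ball 0 (?r / 2) - (\<Union>a\<in>L. span {a}))"
        using reg .
    qed
    moreover have "connectedin euclidean (ball 0 (?r / 2) - (\<Union>a\<in>L. span {a}))"
      using connected_convex_open_minus_lines[OF L(1) open_ball convex_ball] by simp
    ultimately show "connectedin X (\<psi> ` ball 0 1 \<inter> regular)"
      using connectedin_continuous_map_image[OF continuous_map_\<Phi>[OF A]] by simp
  qed
qed

lemma manifold_X: "topological_manifold 3 X"
  unfolding topological_manifold_def
proof (intro conjI ballI)
  fix y assume "y \<in> topspace X"
  then obtain A where A: "A \<in> carrier SO3" "y = proj A"
    by (auto simp: topspace_X)
  obtain \<psi> :: "real^3 \<Rightarrow> (real^3^3) set" where \<psi>: "open_embedding \<psi> X" "\<psi> 0 = proj A"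
    by (rule chart_exists[OF A(1)]) (rule that)
  have "subtopology X (range \<psi>) homeomorphic_space (euclidean :: (real^3) topology)"
    using open_embedding_homeomorphic_map(1)[OF \<psi>(1)] homeomorphic_map_imp_homeomorphic_space
      homeomorphic_space_sym by blast
  also have "(euclidean :: (real^3) topology) homeomorphic_space Euclidean_space 3"
    using homeomorphic_subspace_Euclidean_space[of "UNIV :: (real^3) set" 3] by simp
  finally have "subtopology X (range \<psi>) homeomorphic_space
      subtopology (Euclidean_space 3) (topspace (Euclidean_space 3))"
    by simp
  moreover have "y \<in> range \<psi>"
    unfolding A(2) \<psi>(2)[symmetric] by (rule rangeI)
  ultimately show "\<exists>U V. openin X U \<and> y \<in> U \<and> openin (Euclidean_space 3) V \<and>
      subtopology X U homeomorphic_space subtopology (Euclidean_space 3) V"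
    using open_embedding_homeomorphic_map(2)[OF \<psi>(1)] openin_topspace by blast
qed (rule Hausdorff_X second_countable_X)+

lemma dense_regular: "X closure_of regular = topspace X"
  unfolding dense_intersects_open
proof (intro allI impI, elim conjE)
  fix T assume T: "openin X T" "T \<noteq> {}"
  then obtain y where "y \<in> T" "y \<in> topspace X"
    using openin_subset by blast
  then obtain A where A: "A \<in> carrier SO3" "proj A \<in> T"
    by (auto simp: topspace_X)
  obtain L where L: "finite L" "\<And>x. x \<in> (\<Union>a\<in>L. span {a}) \<longleftrightarrow> (\<exists>h\<in>stab A. h *v x = x \<and> h \<noteq> mat 1)"
    by (rule rotation_axes[OF finite_stab[of A] stab_SO3], assumption) (rule that)
  let ?W = "{x. \<Phi> A x \<in> T} \<inter> ball 0 (radius A)"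
  have "open {x. \<Phi> A x \<in> T}"
    using openin_continuous_map_preimage[OF continuous_map_\<Phi>[OF A(1)] T(1)] by simp
  then have "open ?W"
    by blast
  moreover have "0 \<in> ?W"
    using A radius_pos[of A] by (simp add: \<Phi>_0)
  ultimately obtain x where x: "x \<in> ?W" "\<And>a. a \<in> L \<Longrightarrow> x \<notin> span {a}"
    using avoid_lines[OF L(1), of ?W] by blast
  then have "norm x < radius A"
    by simp
  have "x \<notin> (\<Union>a\<in>L. span {a})"
    using x(2) by blast
  then have "\<Phi> A x \<in> regular"
    unfolding L(2) regular_\<Phi>_iff[OF A(1) \<open>norm x < radius A\<close>] by blast
  then show "regular \<inter> T \<noteq> {}"
    using x(1) by blast
qed

section \<open>The misorientation space is orientable\<close>

text \<open>On the ball of radius \<open>r\<close> the map \<open>\<Phi> A\<close> is a chart, a sheet of the covering over the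
  regular orbits.\<close>

definition sheet :: "real^3^3 \<Rightarrow> real \<Rightarrow> bool"
  where "sheet A r \<longleftrightarrow> A \<in> carrier SO3 \<and> r > 0 \<and> inj_on (\<Phi> A) (ball 0 r)"

lemma open_embedding_sheet:
  assumes "sheet A r"
  shows "open_embedding (\<Phi> A \<circ> squash r) X"
proof -
  have A: "A \<in> carrier SO3" and r: "r > 0" and inj: "inj_on (\<Phi> A) (ball 0 r)"
    using assms by (auto simp: sheet_def)
  have "continuous_map euclidean euclidean (squash r)"
    using continuous_on_squash by simp
  then have "continuous_map euclidean X (\<Phi> A \<circ> squash r)"
    using continuous_map_\<Phi>[OF A] by (rule continuous_map_compose)
  moreover have "open_map euclidean X (\<Phi> A \<circ> squash r)"
    unfolding open_map_def
  proof (intro allI impI)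
    fix S :: "(real^3) set" assume "openin euclidean S"
    then have "open (squash r ` S)"
      using open_squash_image[OF r] by simp
    then show "openin X ((\<Phi> A \<circ> squash r) ` S)"
      unfolding image_comp[symmetric] by (rule open_\<Phi>_image[OF A])
  qed
  moreover have "inj (\<Phi> A \<circ> squash r)"
  proof (rule comp_inj_on[OF inj_squash[OF r]])
    show "inj_on (\<Phi> A) (range (squash r))"
      by (rule inj_on_subset[OF inj]) (auto simp: norm_squash_less[OF r])
  qed
  ultimately show ?thesis
    by (simp add: open_embedding_def)
qed

lemma sheet_avoid:
  assumes "sheet A r" "norm u < r" "norm x < r" "u \<noteq> x"
  shows "\<Phi> A u \<in> topspace X - {\<Phi> A x}"
proof -
  have "\<Phi> A u \<noteq> \<Phi> A x"
    using assms by (auto simp: sheet_def dest: inj_onD)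
  then show ?thesis
    using assms by (simp add: sheet_def \<Phi>_topspace)
qed

lemma sheet_avoid_0:
  assumes "sheet A r" "norm u < r" "u \<noteq> 0"
  shows "\<Phi> A u \<in> topspace X - {proj A}"
  using sheet_avoid[OF assms(1,2), of 0] assms by (simp add: sheet_def \<Phi>_0)

text \<open>The homotopies below take place in the coordinate space, where they are explicit. Only the
  condition that \<open>S\<close> stays in \<open>T\<close> has to be checked in the quotient.\<close>

lemma hom_induced_\<Phi>_homotopy:
  assumes A: "A \<in> carrier SO3"
    and k: "continuous_on ({0..1} \<times> UNIV) (\<lambda>p. k (fst p) (snd p))"
    and T: "\<And>t w. t \<in> {0..1} \<Longrightarrow> w \<in> S \<Longrightarrow> \<Phi> A (k t w) \<in> T"
  shows "hom_induced p euclidean S X T (\<lambda>w :: real^3. \<Phi> A (k 0 w)) = hom_induced p euclidean S X T (\<lambda>w. \<Phi> A (k (1 :: real) w))"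
proof (rule homology_homotopy_axiom)
  show "homotopic_with (\<lambda>h. h \<in> S \<rightarrow> T) euclidean X (\<lambda>w. \<Phi> A (k 0 w)) (\<lambda>w. \<Phi> A (k 1 w))"
    unfolding homotopic_with_def
  proof (intro exI[of _ "\<lambda>p. \<Phi> A (k (fst p) (snd p))"] conjI allI ballI)
    have "continuous_map (prod_topology (top_of_set {0..1}) euclidean) euclidean (\<lambda>p. k (fst p) (snd p))"
      using k prod_topology_subtopology_eu[of "{0..1::real}" "UNIV :: (real^3) set"] by simp
    from continuous_map_compose[OF this continuous_map_\<Phi>[OF A]]
    show "continuous_map (prod_topology (top_of_set {0..1}) euclidean) X (\<lambda>p. \<Phi> A (k (fst p) (snd p)))"
      by (simp add: o_def)
  qed (use T in auto)
qed

definition base_class :: "(real^3) chain set"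
  where "base_class = (SOME c. local_orientation 3 (euclidean :: (real^3) topology) 0 c)"

lemma base_class: "local_orientation 3 (euclidean :: (real^3) topology) 0 base_class"
proof -
  have "\<exists>c. local_orientation 3 (euclidean :: (real^3) topology) 0 c"
    using euclidean_local_orientation_exists[where 'a = "real^3"] by simp
  then show ?thesis
    unfolding base_class_def by (rule someI_ex)
qed

definition sheet_class :: "real^3^3 \<Rightarrow> real \<Rightarrow> (real^3^3) set chain set"
  where "sheet_class A r = hom_induced 3 euclidean (UNIV - {0}) X (topspace X - {proj A}) (\<Phi> A \<circ> squash r) base_class"

lemma sheet_class_generator:
  assumes s: "sheet A r"
  shows "local_orientation 3 X (proj A) (sheet_class A r)"
proof -
  have "(\<Phi> A \<circ> squash r) ` {0} = {proj A}"
    by (simp add: squash_0 \<Phi>_0)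
  then have iso: "hom_induced 3 euclidean (UNIV - {0}) X (topspace X - {proj A}) (\<Phi> A \<circ> squash r)
      \<in> iso (relative_homology_group 3 euclidean (UNIV - {0})) (relative_homology_group 3 X (topspace X - {proj A}))"
    using open_embedding_excision[OF open_embedding_sheet[OF s] Hausdorff_X, of "{0}" 3] by simp
  have "base_class \<in> carrier (relative_homology_group 3 (euclidean :: (real^3) topology) (UNIV - {0}))"
    "subgroup_generated (relative_homology_group 3 (euclidean :: (real^3) topology) (UNIV - {0})) {base_class}
      = relative_homology_group 3 euclidean (UNIV - {0})"
    using base_class by (simp_all add: local_orientation_def homology_at_def)
  from iso_preserves_generator[OF group_relative_homology_group group_relative_homology_group iso this]
  show ?thesis
    by (simp add: local_orientation_def homology_at_def sheet_class_def)
qed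

lemma sheet_class_radius:
  assumes s: "sheet A r" "sheet A r'"
  shows "sheet_class A r = sheet_class A r'"
proof -
  define \<rho> where "\<rho> t = (1 - t) * r + t * r'" for t
  have r: "r > 0" "r' > 0" and A: "A \<in> carrier SO3"
    using s by (auto simp: sheet_def)
  have \<rho>: "\<rho> t > 0" "\<rho> t \<le> max r r'" if "t \<in> {0..1}" for t
  proof -
    have "(1 - t) * min r r' + t * min r r' \<le> \<rho> t"
      unfolding \<rho>_def using that by (intro add_mono mult_left_mono) auto
    then show "\<rho> t > 0"
      using r by (simp add: algebra_simps)
    have "\<rho> t \<le> (1 - t) * max r r' + t * max r r'"
      unfolding \<rho>_def using that by (intro add_mono mult_left_mono) auto
    then show "\<rho> t \<le> max r r'"
      by (simp add: algebra_simps)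
  qed
  have m: "sheet A (max r r')"
    using s by (simp add: max_def)
  let ?hom = "hom_induced 3 euclidean (UNIV - {0}) X (topspace X - {proj A})"
  have "?hom (\<lambda>w. \<Phi> A (squash (\<rho> 0) w)) = ?hom (\<lambda>w. \<Phi> A (squash (\<rho> 1) w))"
  proof (rule hom_induced_\<Phi>_homotopy[OF A])
    show "continuous_on ({0..1} \<times> UNIV) (\<lambda>p :: real \<times> (real^3). squash (\<rho> (fst p)) (snd p))"
      unfolding squash_def \<rho>_def using one_plus_norm_pos
      by (intro continuous_intros ballI) (rule less_imp_neq[symmetric])
    show "\<Phi> A (squash (\<rho> t) w) \<in> topspace X - {proj A}" if "t \<in> {0..1}" "w \<in> UNIV - {0}" for t w
    proof (rule sheet_avoid_0[OF m])
      show "norm (squash (\<rho> t) w) < max r r'"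
        using norm_squash_less[OF \<rho>(1)[OF that(1)], of w] \<rho>(2)[OF that(1)] by linarith
      show "squash (\<rho> t) w \<noteq> 0"
        using squash_eq_0_iff[OF \<rho>(1)[OF that(1)]] that(2) by simp
    qed
  qed
  then show ?thesis
    by (simp add: sheet_class_def \<rho>_def o_def)
qed

lemma \<Phi>_act:
  assumes A: "A \<in> carrier SO3" and g: "g \<in> G\<^sub>1" and h: "h \<in> G\<^sub>2"
  shows "\<Phi> (g ** A ** transpose h) x = \<Phi> A (transpose g *v x)"
proof -
  have "g ** (cayley (transpose g *v x) ** A) ** transpose h = cayley x ** (g ** A ** transpose h)"
    unfolding cayley_conj[OF G1_SO3[OF G1_transpose[OF g]]]
    by (simp add: SO3_cancel(1,2)[OF G1_SO3[OF g]] flip: matrix_mul_assoc)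
  then show ?thesis
    using proj_act[OF SO3_mult[OF cayley_SO3 A] g h] by (metis \<Phi>_def)
qed

lemma squash_rotate: "g \<in> carrier SO3 \<Longrightarrow> squash r (g *v w) = g *v squash r w"
  by (simp add: squash_def SO3_norm matrix_vector_mult_scaleR)

text \<open>Moving \<open>A\<close> along its orbit composes \<open>\<Phi> A\<close> with a rotation. Rotations are homotopic to the
  identity away from the origin, and this is where it matters that the group elements preserve
  the orientation.\<close>

lemma sheet_act:
  assumes s: "sheet A r" and g: "g \<in> G\<^sub>1" and h: "h \<in> G\<^sub>2"
  shows "sheet (g ** A ** transpose h) r" "sheet_class (g ** A ** transpose h) r = sheet_class A r"
proof -
  let ?B = "g ** A ** transpose h" and ?g = "transpose g"
  have A: "A \<in> carrier SO3" and r: "r > 0"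
    using s by (auto simp: sheet_def)
  have gSO: "g \<in> carrier SO3" "?g \<in> carrier SO3"
    using G1_SO3[OF g] SO3_transpose by auto
  show "sheet ?B r"
    unfolding sheet_def
  proof (intro conjI inj_onI)
    fix x y assume xy: "x \<in> ball 0 r" "y \<in> ball 0 r" "\<Phi> ?B x = \<Phi> ?B y"
    have "?g *v x = ?g *v y"
    proof (rule inj_onD[of "\<Phi> A" "ball 0 r"])
      show "inj_on (\<Phi> A) (ball 0 r)"
        using s by (simp add: sheet_def)
      show "\<Phi> A (?g *v x) = \<Phi> A (?g *v y)"
        using xy(3) by (simp only: \<Phi>_act[OF A g h])
      show "?g *v x \<in> ball 0 r" "?g *v y \<in> ball 0 r"
        using xy(1,2) SO3_norm[OF gSO(2)] by (simp_all only: mem_ball_0)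
    qed
    then have "g *v (?g *v x) = g *v (?g *v y)"
      by (rule arg_cong)
    then show "x = y"
      by (simp only: matrix_vector_mul_assoc SO3_transpose(3)[OF gSO(1)] matrix_vector_mul_lid)
  qed (use A g h r act_SO3 in auto)
  let ?h = "\<Phi> A \<circ> squash r"
  have hom: "homotopic_with (\<lambda>f. f \<in> UNIV - {0} \<rightarrow> topspace X - {proj A}) euclidean X (?h \<circ> id) (?h \<circ> (\<lambda>v. ?g *v v))"
  proof (rule homotopic_with_compose_continuous_map_left[OF SO3_homotopic_id[OF gSO(2)]])
    show "continuous_map euclidean X ?h"
      using open_embedding_sheet[OF s] by (simp add: open_embedding_def)
    have "?h w \<in> topspace X - {proj A}" if "w \<noteq> 0" for w
      using sheet_avoid_0[OF s norm_squash_less[OF r]] squash_eq_0_iff[OF r] that by simp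
    then show "?h \<circ> j \<in> UNIV - {0} \<rightarrow> topspace X - {proj A}" if "j \<in> UNIV - {0} \<rightarrow> UNIV - {0}" for j
      using that by (auto simp: Pi_iff)
  qed
  have "\<Phi> ?B \<circ> squash r = ?h \<circ> (\<lambda>v. ?g *v v)"
    by (simp only: fun_eq_iff o_apply \<Phi>_act[OF A g h] squash_rotate[OF gSO(2)] simp_thms)
  moreover have "proj ?B = proj A"
    by (rule proj_act[OF A g h])
  ultimately show "sheet_class ?B r = sheet_class A r"
    unfolding sheet_class_def using homology_homotopy_axiom[OF hom, of 3] by (simp only: o_id comp_id)
qed

lemma sheet_class_proj:
  assumes "sheet A r" "sheet B r'" "proj A = proj B"
  shows "sheet_class A r = sheet_class B r'"
proof -
  obtain g h where "g \<in> G\<^sub>1" "h \<in> G\<^sub>2" and B: "B = g ** A ** transpose h"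
    using assms proj_eq_iff[of A B] by (auto simp: sheet_def)
  then have "sheet B r" "sheet_class B r = sheet_class A r"
    using sheet_act[OF assms(1)] by blast+
  then show ?thesis
    using sheet_class_radius[OF _ assms(2)] by metis
qed

definition regular_class :: "(real^3^3) set \<Rightarrow> (real^3^3) set chain set"
  where "regular_class y = (SOME c. \<exists>A r. sheet A r \<and> proj A = y \<and> c = sheet_class A r)"

lemma regular_class:
  assumes "sheet A r"
  shows "regular_class (proj A) = sheet_class A r"
proof -
  have "\<exists>c B r'. sheet B r' \<and> proj B = proj A \<and> c = sheet_class B r'"
    using assms by blast
  then have "\<exists>B r'. sheet B r' \<and> proj B = proj A \<and> regular_class (proj A) = sheet_class B r'"
    unfolding regular_class_def by (rule someI_ex)
  then show ?thesis
    using sheet_class_proj assms by metis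
qed

lemma regular_sheet:
  assumes A: "A \<in> carrier SO3" and "stab A = {mat 1}"
  shows "sheet A (radius A)"
  unfolding sheet_def
proof (intro conjI inj_onI)
  fix x y assume "x \<in> ball 0 (radius A)" "y \<in> ball 0 (radius A)" and eq: "\<Phi> A x = \<Phi> A y"
  then have "norm x < radius A" "norm y < radius A"
    by simp_all
  then obtain h where "h \<in> stab A" "y = h *v x"
    using eq by (rule \<Phi>_eq_imp[OF A])
  then show "x = y"
    using assms(2) by simp
qed (use A radius_pos in auto)

lemma \<Phi>_translate:
  assumes "u \<bullet> x \<noteq> 1"
  shows "\<Phi> (cayley x ** A) u = \<Phi> A (rodrigues u x)"
  using cayley_rodrigues[OF assms] by (simp add: \<Phi>_def matrix_mul_assoc)

text \<open>The class \<open>c\<close> is the image under the chart \<open>\<Phi> A\<close> of a class on a ball that restricts to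
  \<open>base_class\<close> at the origin. At \<open>z = \<Phi> A x\<close> it has to be compared with the class of the chart
  at \<open>cayley x ** A\<close>, which differs from \<open>\<Phi> A\<close> by the translation \<open>rodrigues u x\<close>. The
  translations by \<open>t x\<close> for \<open>0 \<le> t \<le> 1\<close> connect the two, and no point outside the ball passes
  through \<open>x\<close> on the way.\<close>

lemma regular_class_consistent:
  assumes A: "A \<in> carrier SO3" and s: "sheet A R"
  shows "\<exists>V c. openin X V \<and> proj A \<in> V \<and> c \<in> carrier (homology_at 3 X V) \<and>
    (\<forall>z\<in>V. homology_restrict 3 X V {z} c = regular_class z)"
proof -
  have R: "R > 0"
    using s by (simp add: sheet_def)
  \<comment> \<open>Products of two elements of the ball of radius \<open>r\<close> lie in the ball of radius
    \<open>4 * r\<close>, which has to be smaller than \<open>R\<close>.\<close>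
  define r where "r = min (R / 8) (1 / 2)"
  have r: "r > 0" "r \<le> 1 / 2" "4 * r < R" "r < R"
    using R by (auto simp: r_def min_def)
  have sr: "sheet A r"
    using s r by (auto simp: sheet_def intro: inj_on_subset)
  let ?\<psi> = "\<Phi> A \<circ> squash r"
  let ?B = "ball 0 1 :: (real^3) set"
  let ?H0 = "relative_homology_group 3 (euclidean :: (real^3) topology) (UNIV - {0})"
  let ?HB = "relative_homology_group 3 euclidean (UNIV - ?B)"
  let ?res = "hom_induced 3 euclidean (UNIV - ?B) euclidean (UNIV - {0}) id"
  define V where "V = ?\<psi> ` ?B"
  note emb = open_embedding_sheet[OF sr]
  have cont: "continuous_map euclidean X ?\<psi>" and inj: "inj ?\<psi>"
    using emb by (auto simp: open_embedding_def)
  have openV: "openin X V"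
    using emb by (simp add: V_def open_embedding_def open_map_def)
  have 0: "?\<psi> 0 = proj A"
    by (simp add: squash_0 \<Phi>_0)
  have memV: "proj A \<in> V"
    unfolding V_def by (rule image_eqI[of _ _ 0]) (simp_all add: squash_0 \<Phi>_0)
  have "?res
      \<in> iso ?HB ?H0"
    by (rule euclidean_restrict_iso) auto
  then have "?res ` carrier ?HB
      = carrier ?H0"
    by (simp add: iso_def bij_betw_def)
  moreover have "base_class \<in> carrier ?H0"
    using base_class by (simp add: local_orientation_def homology_at_def)
  ultimately have "base_class \<in> ?res
      ` carrier ?HB"
    by simp
  then obtain c0 where c0: "base_class = ?res c0"
    by (rule imageE)
  define c where "c = hom_induced 3 euclidean (UNIV - ?B) X (topspace X - V) ?\<psi> c0"
  have cV: "c \<in> carrier (homology_at 3 X V)"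
    unfolding c_def homology_at_def by (simp add: hom_induced_carrier)
  have "homology_restrict 3 X V {z} c = regular_class z" if z: "z \<in> V" for z
  proof -
    obtain w0 where w0: "norm w0 < 1" "z = ?\<psi> w0"
      using z by (auto simp: V_def)
    define x where "x = squash r w0"
    have x: "norm x < r / 2" "norm x < r" and zx: "z = \<Phi> A x"
      using norm_squash_less_half[OF r(1), of w0] w0 r(1) by (simp_all add: x_def)
    define C where "C = cayley x ** A"
    have C: "C \<in> carrier SO3"
      by (simp add: C_def A SO3_mult cayley_SO3)
    have projC: "proj C = z"
      by (simp add: C_def zx \<Phi>_def)
    have \<Phi>C: "\<Phi> C u = \<Phi> A (rodrigues u x)" if "norm u < r" for u
      unfolding C_def using rodrigues_small(1)[OF r(2) that x(2)] by (intro \<Phi>_translate) simp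
    have sC: "sheet C r"
      unfolding sheet_def
    proof (intro conjI inj_onI)
      fix u v assume "u \<in> ball 0 r" "v \<in> ball 0 r" and eq: "\<Phi> C u = \<Phi> C v"
      then have uv: "norm u < r" "norm v < r"
        by simp_all
      have "inj_on (\<Phi> A) (ball 0 R)"
        using s by (simp add: sheet_def)
      moreover have "\<Phi> A (rodrigues u x) = \<Phi> A (rodrigues v x)"
        using eq by (simp only: \<Phi>C uv)
      moreover have "rodrigues u x \<in> ball 0 R" "rodrigues v x \<in> ball 0 R"
        using rodrigues_small(2)[OF r(2) _ x(2)] uv r(3) by (force intro: less_trans)+
      ultimately have "rodrigues u x = rodrigues v x"
        by (rule inj_onD)
      then have "cayley u ** cayley x = cayley v ** cayley x"
        using cayley_rodrigues[of u x] cayley_rodrigues[of v x]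
          rodrigues_small(1)[OF r(2) uv(1) x(2)] rodrigues_small(1)[OF r(2) uv(2) x(2)] by simp
      then have "cayley u ** cayley x ** transpose (cayley x) = cayley v ** cayley x ** transpose (cayley x)"
        by (rule arg_cong)
      then have "cayley u = cayley v"
        by (simp only: SO3_cancel(4)[OF cayley_SO3])
      then show "u = v"
        by (metis cayley_inv_cayley)
    qed (use C r in auto)
    let ?T = "topspace X - {z}"
    have "homology_restrict 3 X V {z} c = hom_induced 3 euclidean (UNIV - ?B) X ?T (id \<circ> ?\<psi>) c0"
      unfolding homology_restrict_def c_def of_nat_numeral
    proof (rule hom_induced_compose'[OF cont])
      have "?\<psi> w \<in> topspace X" for w
        using sr by (simp add: sheet_def \<Phi>_topspace)
      moreover have "?\<psi> w \<notin> V" if "w \<notin> ?B" for w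
        unfolding V_def inj_image_mem_iff[OF inj] by (rule that)
      ultimately show "?\<psi> \<in> UNIV - ?B \<rightarrow> topspace X - V"
        by blast
    qed (use z in auto)
    also have "id \<circ> ?\<psi> = (\<lambda>w. \<Phi> A (rodrigues (squash r w) (0 *\<^sub>R x)))"
      by (simp add: fun_eq_iff rodrigues_0)
    also have "hom_induced 3 euclidean (UNIV - ?B) X ?T \<dots>
        = hom_induced 3 euclidean (UNIV - ?B) X ?T (\<lambda>w. \<Phi> A (rodrigues (squash r w) (1 *\<^sub>R x)))"
    proof (rule hom_induced_\<Phi>_homotopy[OF A])
      have tx: "norm (t *\<^sub>R x) < r" if "t \<in> {0..1}" for t
      proof -
        have "\<bar>t\<bar> * norm x \<le> 1 * norm x"
          using that by (intro mult_right_mono) auto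
        then show ?thesis
          using x(2) by simp
      qed
      have ne: "squash r w \<bullet> (t *\<^sub>R x) < 1" if "t \<in> {0..1}" for t w
        by (rule rodrigues_small(1)[OF r(2) norm_squash_less[OF r(1)] tx[OF that]])
      have sq: "continuous_on ({0..1} \<times> UNIV) (\<lambda>p :: real \<times> (real^3). squash r (snd p))"
        using continuous_on_compose2[OF continuous_on_squash[of UNIV r] continuous_on_snd[OF continuous_on_id]] by auto
      have "1 - squash r (snd p) \<bullet> (fst p *\<^sub>R x) \<noteq> 0" if "p \<in> {0..1} \<times> UNIV" for p
        using ne[of "fst p" "snd p"] that by auto
      then show "continuous_on ({0..1} \<times> UNIV) (\<lambda>p. rodrigues (squash r (snd p)) (fst p *\<^sub>R x))"
        unfolding rodrigues_def by (intro continuous_intros sq continuous_on_cross) blast+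
      show "\<Phi> A (rodrigues (squash r w) (t *\<^sub>R x)) \<in> ?T" if t: "t \<in> {0..1}" and w: "w \<in> UNIV - ?B" for t w
        unfolding zx
      proof (rule sheet_avoid[OF s])
        show "norm (rodrigues (squash r w) (t *\<^sub>R x)) < R"
          using rodrigues_small(2)[OF r(2) norm_squash_less[OF r(1)] tx[OF t], of w] r(3) by linarith
        show "norm x < R"
          using x(2) r(4) by linarith
        show "rodrigues (squash r w) (t *\<^sub>R x) \<noteq> x"
        proof
          assume "rodrigues (squash r w) (t *\<^sub>R x) = x"
          then have "norm (squash r w) \<le> norm x"
            using ne[OF t, of w] by (intro norm_le_of_rodrigues[OF _ t]) auto
          then have "norm (squash r w) < r / 2"
            using x(1) by linarith
          then have "norm w < 1"
            using norm_squash_less_half[OF r(1)] by blast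
          then show False
            using w by simp
        qed
      qed
    qed
    also have "(\<lambda>w. \<Phi> A (rodrigues (squash r w) (1 *\<^sub>R x))) = \<Phi> C \<circ> squash r \<circ> id"
      by (simp add: fun_eq_iff \<Phi>C norm_squash_less[OF r(1)])
    also have "hom_induced 3 euclidean (UNIV - ?B) X ?T (\<Phi> C \<circ> squash r \<circ> id) c0
        = hom_induced 3 euclidean (UNIV - {0}) X ?T (\<Phi> C \<circ> squash r)
            (?res c0)"
    proof (rule hom_induced_compose'[symmetric])
      show "continuous_map euclidean X (\<Phi> C \<circ> squash r)"
        using open_embedding_sheet[OF sC] by (simp add: open_embedding_def)
      have "(\<Phi> C \<circ> squash r) w \<in> ?T" if "w \<noteq> 0" for w
        using sheet_avoid_0[OF sC norm_squash_less[OF r(1)]] squash_eq_0_iff[OF r(1)] that projC by simp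
      then show "\<Phi> C \<circ> squash r \<in> UNIV - {0} \<rightarrow> ?T"
        by auto
    qed auto
    also have "\<dots> = sheet_class C r"
      by (simp add: sheet_class_def c0 projC)
    also have "\<dots> = regular_class z"
      using regular_class[OF sC] projC by simp
    finally show ?thesis .
  qed
  then show ?thesis
    using openV memV cV by blast
qed

lemma orientable_X: "orientable 3 X"
proof -
  have "\<forall>y\<in>topspace X. \<exists>\<psi> :: real^3 \<Rightarrow> (real^3^3) set.
      open_embedding \<psi> X \<and> \<psi> 0 = y \<and> connectedin X (\<psi> ` ball 0 1 \<inter> regular)"
  proof
    fix y assume "y \<in> topspace X"
    then obtain A where A: "A \<in> carrier SO3" "y = proj A"
      by (auto simp: topspace_X)
    show "\<exists>\<psi> :: real^3 \<Rightarrow> (real^3^3) set.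
        open_embedding \<psi> X \<and> \<psi> 0 = y \<and> connectedin X (\<psi> ` ball 0 1 \<inter> regular)"
      unfolding A(2) by (rule chart_exists[OF A(1)]) blast
  qed
  then obtain chart :: "(real^3^3) set \<Rightarrow> real^3 \<Rightarrow> (real^3^3) set" where chart:
    "\<forall>y\<in>topspace X. open_embedding (chart y) X \<and> chart y 0 = y \<and> connectedin X (chart y ` ball 0 1 \<inter> regular)"
    by (rule bchoice[THEN exE])
  have reg: "\<exists>A. A \<in> carrier SO3 \<and> y = proj A \<and> sheet A (radius A)" if "y \<in> regular" for y
    using that regular_sheet by (auto simp: regular_def)
  show ?thesis
  proof (rule orientable_of_dense_orientation[of X chart regular 3 regular_class])
    show "Hausdorff_space X"
      by (rule Hausdorff_X)
    show "regular \<subseteq> topspace X"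
      by (auto simp: regular_def topspace_X)
    show "X closure_of regular = topspace X"
      by (rule dense_regular)
  next
    fix y assume "y \<in> regular"
    then obtain A where A: "A \<in> carrier SO3" "y = proj A" "sheet A (radius A)"
      using reg by blast
    show "local_orientation 3 X y (regular_class y)"
      using sheet_class_generator[OF A(3)] regular_class[OF A(3)] A(2) by simp
    obtain V c where "openin X V" "proj A \<in> V" "c \<in> carrier (homology_at 3 X V)"
      "\<forall>z\<in>V. homology_restrict 3 X V {z} c = regular_class z"
      using regular_class_consistent[OF A(1,3)] by blast
    then show "\<exists>V c. openin X V \<and> y \<in> V \<and> c \<in> carrier (homology_at 3 X V) \<and>
        (\<forall>z\<in>V \<inter> regular. homology_restrict 3 X V {z} c = regular_class z)"
      using A(2) by (intro exI[of _ V] exI[of _ c]) simp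
  qed (use chart in simp_all)
qed

end

theorem proposition1p3:
  fixes G\<^sub>1 G\<^sub>2 :: "(real^3^3) set"
  assumes "subgroup G\<^sub>1 SO3" and "finite G\<^sub>1"
    and "subgroup G\<^sub>2 SO3" and "finite G\<^sub>2"
  shows "closed_manifold 3 (misorientation_space G\<^sub>1 G\<^sub>2) \<and>
         orientable 3 (misorientation_space G\<^sub>1 G\<^sub>2)"
proof -
  interpret misorientation G\<^sub>1 G\<^sub>2
    by (rule misorientation.intro) (rule assms)+
  show ?thesis
    unfolding closed_manifold_def using manifold_X compact_X orientable_X by blast
qed

end
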